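(* Let $\theta>0$. Let $(L_1,L_2,\dots)$ be a $PD(\theta)$-distributed random vector and let $U_1,U_2,\dots$ be i.i.d. random variables distributed uniformly on $[0,1]$ and independent of $(L_1,L_2,\dots)$. Define the point process $$\mathfrak{E}_\infty^* := \sum_{i=1}^\infty \sum_{q\in\mathbb{Z}} \delta_{(U_i+q)/L_i}.$$ For a random permutation $\sigma\in\mathfrak{S}_n$ drawn from the Ewens measure with parameter $\theta$ and for real $\alpha$, let $$\mathfrak{E}_n^\alpha := \sum_{j=1}^n C_j^{(n)}\sum_{i\in\mathbb{Z}}\delta_{n(i/j-\alpha)},$$ where $C_j^{(n)}=C_j^{(n)}(\sigma)$ is the number of cycles of $\sigma$ of length $j$. If $\alpha\in(0,1)$ is an irrational number with finite irrationality measure, then $\mathfrak{E}_n^\alpha\to\mathfrak{E}_\infty^*$ weakly as $n\to\infty$.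
   Context: The Ewens measure with parameter $\theta>0$ on the symmetric group $\mathfrak{S}_n$ is $\nu_{n,\theta}(\sigma)=\theta^{K(\sigma)}/\big(\theta(\theta+1)\cdots(\theta+n-1)\big)$, where $K(\sigma)$ is the number of cycles of $\sigma$. $PD(\theta)$ (Poisson-Dirichlet distribution): let $W_1,W_2,\dots$ be i.i.d. with density $\theta(1-x)^{\theta-1}$ on $[0,1]$ and $V_j=W_j\prod_{i=1}^{j-1}(1-W_i)$; then $PD(\theta)$ is the law of the decreasing order statistics of $(V_1,V_2,\dots)$. The irrationality measure of a real number $\alpha$ is the infimum of all $\lambda$ such that $|\alpha-p/q|<1/q^\lambda$ has only finitely many integer solutions $p,q$. Weak convergence $\xi_n\to\xi$ of point processes on $\mathbb{R}$ (random locally finite counting measures) means $\int_{\mathbb{R}} f\,d\xi_n\to\int_{\mathbb{R}} f\,d\xi$ in distribution for all continuous compactly supported $f:\mathbb{R}\to\mathbb{R}$ (equivalently, convergence of finite-dimensional distributions on bounded stochastic continuity sets). $\delta_x$ is the Dirac mass at $x$. *)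

theory Defs
  imports "HOL-Probability.Probability" "HOL-Combinatorics.Combinatorics"
begin

section \<open>The Ewens measure\<close>

definition cycle_sets :: "nat \<Rightarrow> (nat \<Rightarrow> nat) \<Rightarrow> nat set set" where
  "cycle_sets n \<sigma> = orbit \<sigma> ` {1..n}"

definition num_cycles :: "nat \<Rightarrow> (nat \<Rightarrow> nat) \<Rightarrow> nat" where
  "num_cycles n \<sigma> = card (cycle_sets n \<sigma>)"

definition cycle_count :: "nat \<Rightarrow> (nat \<Rightarrow> nat) \<Rightarrow> nat \<Rightarrow> nat" where
  "cycle_count n \<sigma> j = card {c \<in> cycle_sets n \<sigma>. card c = j}"

definition ewens :: "nat \<Rightarrow> real \<Rightarrow> (nat \<Rightarrow> nat) measure" where
  "ewens n \<theta> = point_measure {\<sigma>. \<sigma> permutes {1..n}}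
     (\<lambda>\<sigma>. ennreal (\<theta> ^ num_cycles n \<sigma> / pochhammer \<theta> n))"


section \<open>The Poisson--Dirichlet distribution\<close>

text \<open>Sequences are indexed from 0, so index \<open>k\<close> here is index \<open>k + 1\<close> in the usual notation.\<close>

definition stick_law :: "real \<Rightarrow> real measure" where
  "stick_law \<theta> = density lborel (\<lambda>x. ennreal (\<theta> * (1 - x) powr (\<theta> - 1)) * indicator {0..1} x)"

definition stick_breaking :: "(nat \<Rightarrow> real) \<Rightarrow> nat \<Rightarrow> real" where
  "stick_breaking w j = w j * (\<Prod>i<j. 1 - w i)"

text \<open>The \<open>k\<close>-th largest entry of \<open>v\<close>, counted with multiplicity: the largest number attained or
  exceeded at \<open>k + 1\<close> indices. For sequences that can be sorted into decreasing order it is the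
  \<open>k\<close>-th entry of the sorted sequence, see \<open>order_stat_sorted\<close> below.\<close>

definition order_stat :: "(nat \<Rightarrow> real) \<Rightarrow> nat \<Rightarrow> real" where
  "order_stat v k = (SUP F\<in>{F. finite F \<and> card F = Suc k}. Min (v ` F))"

definition poisson_dirichlet :: "real \<Rightarrow> (nat \<Rightarrow> real) measure" where
  "poisson_dirichlet \<theta> =
     distr (\<Pi>\<^sub>M i\<in>(UNIV :: nat set). stick_law \<theta>) (\<Pi>\<^sub>M i\<in>(UNIV :: nat set). borel)
       (\<lambda>w. order_stat (stick_breaking w))"

lemma order_stat_sorted:
  assumes "bij \<pi>" and "decseq (v \<circ> \<pi>)"
  shows "order_stat v k = v (\<pi> k)"
  unfolding order_stat_def
proof (rule cSup_eq_maximum)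
  have inj: "inj \<pi>" using assms(1) by (rule bij_is_inj)
  have "Min (v ` (\<pi> ` {..k})) = v (\<pi> k)"
    using assms(2) by (intro Min_eqI) (auto simp: decseq_def)
  moreover have "card (\<pi> ` {..k}) = Suc k"
    using inj by (subst card_image) (auto intro: inj_on_subset)
  ultimately show "v (\<pi> k) \<in> (\<lambda>F. Min (v ` F)) ` {F. finite F \<and> card F = Suc k}"
    by (intro image_eqI[where x = "\<pi> ` {..k}"]) auto
next
  fix x assume "x \<in> (\<lambda>F. Min (v ` F)) ` {F. finite F \<and> card F = Suc k}"
  then obtain F where F: "finite F" "card F = Suc k" "x = Min (v ` F)" by auto
  have "\<exists>j\<in>F. j \<notin> \<pi> ` {..<k}"
  proof (rule ccontr)
    assume "\<not> (\<exists>j\<in>F. j \<notin> \<pi> ` {..<k})"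
    then have "F \<subseteq> \<pi> ` {..<k}" by blast
    then have "card F \<le> card (\<pi> ` {..<k})" by (intro card_mono) auto
    also have "\<dots> \<le> k" using card_image_le[of "{..<k}" \<pi>] by simp
    finally show False using F by simp
  qed
  then obtain j where j: "j \<in> F" "j \<notin> \<pi> ` {..<k}" by blast
  obtain i where i: "j = \<pi> i" using assms(1) by (meson bij_pointE)
  with j have "k \<le> i" by (auto simp: not_less[symmetric])
  have "x \<le> v j" using F j by simp
  also have "\<dots> \<le> v (\<pi> k)" using assms(2) \<open>k \<le> i\<close> i by (auto simp: decseq_def)
  finally show "x \<le> v (\<pi> k)" .
qed

lemma countable_finite_sets: "countable {F :: nat set. finite F \<and> card F = Suc k}"
  by (rule countable_subset[OF _ countable_Collect_finite]) auto

lemma measurable_order_stat: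
  "order_stat \<in> (\<Pi>\<^sub>M i\<in>(UNIV :: nat set). borel) \<rightarrow>\<^sub>M (\<Pi>\<^sub>M i\<in>(UNIV :: nat set). borel)"
proof (rule measurable_PiM_single')
  fix k :: nat
  let ?P = "\<Pi>\<^sub>M i\<in>(UNIV :: nat set). (borel :: real measure)"
  let ?I = "{F :: nat set. finite F \<and> card F = Suc k}"
  let ?B = "\<lambda>v. \<exists>m::nat. \<forall>F\<in>?I. Min (v ` F) \<le> real m"
  have meas: "(\<lambda>v. Min (v ` F)) \<in> borel_measurable ?P" if "F \<in> ?I" for F
  proof -
    have "(\<lambda>v. Min ((\<lambda>i. v i) ` F)) \<in> borel_measurable ?P"
      using that by (intro borel_measurable_Min measurable_component_singleton) auto
    then show ?thesis by simp
  qed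
  have B: "{v \<in> space ?P. ?B v} \<in> sets ?P"
    by (intro sets.sets_Collect_countable_Ex sets.sets_Collect_countable_All'
        countable_finite_sets borel_measurable_le meas borel_measurable_const)
  have bdd: "bdd_above ((\<lambda>F. Min (v ` F)) ` ?I) \<longleftrightarrow> ?B v" for v :: "nat \<Rightarrow> real"
  proof
    assume "bdd_above ((\<lambda>F. Min (v ` F)) ` ?I)"
    then obtain c where "\<forall>F\<in>?I. Min (v ` F) \<le> c" by (auto simp: bdd_above_def)
    moreover obtain m where "c \<le> real m" using real_arch_simple by blast
    ultimately show "?B v" by (meson order_trans)
  qed (auto simp: bdd_above_def)
  have unbdd: "Sup X = (LEAST z::real. False)" if "\<not> bdd_above X" for X
  proof -
    have "(\<lambda>z. \<forall>x\<in>X. x \<le> z) = (\<lambda>z. False)" using that by (auto simp: bdd_above_def fun_eq_iff)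
    then show ?thesis by (simp add: Sup_real_def)
  qed
  have trunc: "(\<lambda>v. if ?B v then Min (v ` F) else 0) \<in> borel_measurable ?P" if "F \<in> ?I" for F
    by (rule measurable_If[OF meas[OF that] borel_measurable_const B])
  have trunc_bdd: "bdd_above ((\<lambda>F. if ?B v then Min (v ` F) else 0) ` ?I)" for v :: "nat \<Rightarrow> real"
    by (cases "?B v") (use bdd[of v] in \<open>auto simp: bdd_above_def\<close>)
  have "(\<lambda>v. SUP F\<in>?I. if ?B v then Min (v ` F) else 0) \<in> borel_measurable ?P"
    by (rule borel_measurable_cSUP[OF countable_finite_sets trunc trunc_bdd])
  then have "(\<lambda>v. if ?B v then SUP F\<in>?I. if ?B v then Min (v ` F) else 0 else (LEAST z. False))
      \<in> borel_measurable ?P"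
    by (rule measurable_If[OF _ borel_measurable_const B])
  also have "(\<lambda>v. if ?B v then SUP F\<in>?I. if ?B v then Min (v ` F) else 0 else (LEAST z. False))
      = (\<lambda>v. order_stat v k)"
  proof
    fix v :: "nat \<Rightarrow> real"
    show "(if ?B v then SUP F\<in>?I. if ?B v then Min (v ` F) else 0 else (LEAST z. False))
      = order_stat v k"
      using bdd[of v] unbdd[of "(\<lambda>F. Min (v ` F)) ` ?I"]
      by (cases "?B v") (simp_all add: order_stat_def)
  qed
  finally show "(\<lambda>v. order_stat v k) \<in> borel_measurable ?P" .
qed (auto simp: space_PiM)

lemma prob_space_stick_law:
  assumes "\<theta> > 0"
  shows "prob_space (stick_law \<theta>)"
proof (rule prob_spaceI)
  have "((\<lambda>t::real. t powr (1 - 1) * (1 - t) powr (\<theta> - 1)) has_integral Beta 1 \<theta>) {0..1}"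
    using assms by (intro has_integral_Beta_real) auto
  moreover have "Beta 1 \<theta> = 1 / \<theta>"
  proof -
    have "\<theta> \<notin> \<int>\<^sub>\<le>\<^sub>0" using assms by (auto elim!: nonpos_Ints_cases)
    then have "Gamma (1 + \<theta>) = \<theta> * Gamma \<theta>" using Gamma_plus1[of \<theta>] by (simp add: add.commute)
    moreover have "Gamma \<theta> \<noteq> 0" using Gamma_real_pos[OF assms] by linarith
    ultimately show ?thesis using assms by (simp add: Beta_def)
  qed
  ultimately have "((\<lambda>t::real. \<theta> * (t powr 0 * (1 - t) powr (\<theta> - 1))) has_integral 1) {0..1}"
    using assms has_integral_mult_right[of _ "1 / \<theta>" "{0..1}" \<theta>] by fastforce
  then have "((\<lambda>t::real. \<theta> * (1 - t) powr (\<theta> - 1)) has_integral 1) {0..1}"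
    by (rule has_integral_spike_finite[of "{0}", rotated 2]) auto
  then have "((\<lambda>t::real. \<theta> * (1 - t) powr (\<theta> - 1) * indicator {0..1} t) has_integral 1) UNIV"
    by (subst (asm) has_integral_restrict_UNIV[symmetric])
       (simp add: indicator_def of_bool_def if_distrib cong: if_cong)
  then have "(\<integral>\<^sup>+t. ennreal (\<theta> * (1 - t) powr (\<theta> - 1) * indicator {0..1} t) \<partial>lborel) = 1"
    using assms by (subst nn_integral_has_integral_lborel) auto
  moreover have "ennreal (\<theta> * (1 - t) powr (\<theta> - 1) * indicator {0..1} t)
      = ennreal (\<theta> * (1 - t) powr (\<theta> - 1)) * indicator {0..1} t" for t :: real
    by (simp split: split_indicator)
  ultimately show "emeasure (stick_law \<theta>) (space (stick_law \<theta>)) = 1"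
    by (simp add: stick_law_def emeasure_density)
qed

lemma prob_space_poisson_dirichlet:
  assumes "\<theta> > 0"
  shows "prob_space (poisson_dirichlet \<theta>)"
proof -
  interpret product_prob_space "\<lambda>_::nat. stick_law \<theta>" UNIV
    using prob_space_stick_law[OF assms]
    by (simp add: product_prob_space_def product_prob_space_axioms_def product_sigma_finite_def
        prob_space_imp_sigma_finite)
  have [measurable_cong, simp]: "sets (stick_law \<theta>) = sets borel" by (simp add: stick_law_def)
  have "(\<lambda>w. order_stat (stick_breaking w))
      \<in> (\<Pi>\<^sub>M i\<in>(UNIV :: nat set). stick_law \<theta>) \<rightarrow>\<^sub>M (\<Pi>\<^sub>M i\<in>(UNIV :: nat set). borel)"
    by (rule measurable_compose[OF _ measurable_order_stat], rule measurable_PiM_single')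
       (auto simp: stick_breaking_def space_PiM)
  then show ?thesis unfolding poisson_dirichlet_def by (rule prob_space_distr)
qed


section \<open>Irrationality measure\<close>

definition irrationality_measure :: "real \<Rightarrow> ereal" where
  "irrationality_measure \<alpha> = Inf {ereal l | l.
     finite {(p :: int, q :: int). q > 0 \<and> \<bar>\<alpha> - of_int p / of_int q\<bar> < 1 / of_int q powr l}}"


section \<open>Point processes on the real line\<close>

text \<open>\<open>dirac_sum I w x\<close> is the measure \<open>\<Sum>i\<in>I. w i \<cdot> \<delta>(x i)\<close>.\<close>

definition dirac_sum :: "'i set \<Rightarrow> ('i \<Rightarrow> ennreal) \<Rightarrow> ('i \<Rightarrow> real) \<Rightarrow> real measure" where
  "dirac_sum I w x = distr (point_measure I w) borel x"

lemma emeasure_dirac_sum: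
  assumes "B \<in> sets borel"
  shows "emeasure (dirac_sum I w x) B = (\<integral>\<^sup>+i. w i * indicator B (x i) \<partial>count_space I)"
proof -
  have "emeasure (dirac_sum I w x) B = emeasure (point_measure I w) (x -` B \<inter> I)"
    using assms by (simp add: dirac_sum_def emeasure_distr space_point_measure measurable_def
        sets_point_measure)
  also have "\<dots> = (\<integral>\<^sup>+i. w i * indicator (x -` B \<inter> I) i \<partial>count_space I)"
    by (simp add: point_measure_def emeasure_density)
  also have "\<dots> = (\<integral>\<^sup>+i. w i * indicator B (x i) \<partial>count_space I)"
    by (intro nn_integral_cong) (auto split: split_indicator)
  finally show ?thesis .
qed

definition locally_finite_counting :: "real measure \<Rightarrow> bool" where
  "locally_finite_counting \<mu> \<longleftrightarrow> sets \<mu> = sets borel \<and>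
     (\<forall>B\<in>sets borel. bounded B \<longrightarrow> (\<exists>k :: nat. emeasure \<mu> B = of_nat k))"

definition point_process :: "'a measure \<Rightarrow> ('a \<Rightarrow> real measure) \<Rightarrow> bool" where
  "point_process M \<xi> \<longleftrightarrow> prob_space M \<and> (AE \<omega> in M. locally_finite_counting (\<xi> \<omega>)) \<and>
     (\<forall>B\<in>sets borel. (\<lambda>\<omega>. emeasure (\<xi> \<omega>) B) \<in> borel_measurable M)"

text \<open>Being a point process is part of the definition, so that the Bochner integrals below are
  almost surely genuine finite sums and never the default value 0 of a non-integrable function.\<close>

definition point_processes_converge ::
  "(nat \<Rightarrow> 'a measure) \<Rightarrow> (nat \<Rightarrow> 'a \<Rightarrow> real measure) \<Rightarrow> 'b measure \<Rightarrow> ('b \<Rightarrow> real measure) \<Rightarrow> bool"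
where
  "point_processes_converge P \<xi> Q \<eta> \<longleftrightarrow>
     (\<forall>n. point_process (P n) (\<xi> n)) \<and> point_process Q \<eta> \<and>
     (\<forall>f :: real \<Rightarrow> real. continuous_on UNIV f \<longrightarrow> compact (closure {x. f x \<noteq> 0}) \<longrightarrow>
        weak_conv_m (\<lambda>n. distr (P n) borel (\<lambda>\<omega>. \<integral>x. f x \<partial>\<xi> n \<omega>))
                    (distr Q borel (\<lambda>\<omega>. \<integral>x. f x \<partial>\<eta> \<omega>)))"

definition ewens_point_process :: "real \<Rightarrow> nat \<Rightarrow> (nat \<Rightarrow> nat) \<Rightarrow> real measure" where
  "ewens_point_process \<alpha> n \<sigma> =
     dirac_sum ({1..n} \<times> (UNIV :: int set)) (\<lambda>(j, i). of_nat (cycle_count n \<sigma> j))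
       (\<lambda>(j, i). real n * (of_int i / real j - \<alpha>))"

definition limit_point_process ::
  "(nat \<Rightarrow> 'a \<Rightarrow> real) \<Rightarrow> (nat \<Rightarrow> 'a \<Rightarrow> real) \<Rightarrow> 'a \<Rightarrow> real measure" where
  "limit_point_process L U \<omega> =
     dirac_sum ((UNIV :: nat set) \<times> (UNIV :: int set)) (\<lambda>_. 1)
       (\<lambda>(i, q). (U i \<omega> + of_int q) / L i \<omega>)"

end

(* The point process of a permutation is a sum over its cycles: with F u y the sum of f ((u + q) / y)
   over all integers q, a cycle of length j contributes F (- j alpha) (j / n) to the integral of f,
   whereas L i contributes F (U i) (L i) to the limit. Characteristic functions therefore become
   means of products over cycles, and these can be computed by removing the cycle of a marked
   element: its relative length is asymptotically distributed as a stick W, the rest is again an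
   Ewens permutation, and, as alpha is irrational, j alpha is equidistributed modulo 1 along short
   runs of j. Iterating this yields the stick-breaking products, which do not change when the sticks
   are put into decreasing order. Only cycles of length at most delta n need care: they contribute
   only if j alpha is within c j / n of an integer, and finiteness of the irrationality measure makes
   the j with this property sparse enough for their expected number to vanish as delta tends to 0. *)

theory Submission
  imports Defs "HOL-Real_Asymp.Real_Asymp"
begin

section \<open>Cycles of Ewens permutations\<close>

text \<open>Three limits are nested: first n, then the number k of removed cycles, then the cutoff
  \<delta> below which cycles are ignored. The errors of the last two are uniform in n. Ignoring
  short cycles costs a constant times \<delta>^s, with s from the Diophantine bound |q \<alpha> - p|
  >= c q^(-1/s); stopping after k cycles costs at most (2/\<delta>) (\<theta>/(\<theta>+1))^k,
  because each removal leaves on average at most the fraction \<theta>/(\<theta>+1) of the elements.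
  The cutoff also makes every product over lengths finite, which is what allows the sticks to be
  reordered. The obstacle in the limit n is that the phase -j \<alpha> never settles: the factor of
  a single cycle does not converge, only averages over runs of consecutive j do. A run must become
  long, for equidistribution, yet be negligible against the number m of remaining elements, so that
  the relative length of the cycle, its probability and the factor of the rest are asymptotically
  constant on the run; about sqrt m values serve. As the runs start at varying j, equidistribution
  is needed uniformly in the starting point.\<close>

definition cycle_sum :: "(nat \<Rightarrow> 'b::comm_semiring_1) \<Rightarrow> nat set \<Rightarrow> 'b" where
  "cycle_sum g S = (\<Sum>\<sigma> | \<sigma> permutes S. \<Prod>c\<in>orbit \<sigma> ` S. g (card c))"

text \<open>The cycle of \<open>x\<close> has its own weight \<open>h\<close> so that an induction
  can delete \<open>x\<close>: the length of this one cycle drops by one, which shifts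
  \<open>h\<close> and leaves \<open>g\<close> alone.\<close>

definition marked_cycle_sum ::
  "(nat \<Rightarrow> 'b::comm_semiring_1) \<Rightarrow> (nat \<Rightarrow> 'b) \<Rightarrow> nat set \<Rightarrow> nat \<Rightarrow> 'b" where
  "marked_cycle_sum g h S x = (\<Sum>\<sigma> | \<sigma> permutes S.
     h (card (orbit \<sigma> x)) * (\<Prod>c\<in>orbit \<sigma> ` S - {orbit \<sigma> x}. g (card c)))"

lemma orbit_agree:
  assumes "\<And>z. z \<in> insert y (orbit p y) \<Longrightarrow> q z = p z"
  shows "orbit q y = orbit p y"
proof (intro set_eqI iffI)
  have y: "q y = p y" by (rule assms) simp
  fix z
  {
    assume "z \<in> orbit p y"
    then show "z \<in> orbit q y"
    proof induction
      case base
      show ?case using orbit.base[of q y] y by simp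
    next
      case (step z)
      then show ?case using orbit.step[of z q y] assms[of z] by simp
    qed
  next
    assume "z \<in> orbit q y"
    then show "z \<in> orbit p y"
    proof induction
      case base
      show ?case using orbit.base[of p y] y by simp
    next
      case (step z)
      then show ?case using orbit.step[of z p y] assms[of z] by simp
    qed
  }
qed

context
  fixes p :: "nat \<Rightarrow> nat" and S :: "nat set" and x b :: nat
  assumes p: "p permutes S" and S: "finite S" and x: "x \<notin> S" and b: "b \<in> S"
begin

text \<open>As \<open>p\<close> fixes \<open>x\<close>, this map sends \<open>x\<close> to
  \<open>b\<close> and the \<open>p\<close>-preimage of \<open>b\<close> to \<open>x\<close>: the
  new element is inserted into the cycle of \<open>b\<close> just in front of
  \<open>b\<close>.\<close>

abbreviation "spliced \<equiv> Transposition.transpose x b \<circ> p"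

lemma perm_p: "permutation p" and perm_spliced: "permutation spliced" and "spliced permutes insert x S"
proof -
  show "permutation p" using p S by (auto simp: permutation_permutes)
  show "spliced permutes insert x S"
    by (intro permutes_compose[OF permutes_subset[OF p]] permutes_swap_id) (use b in auto)
  then show "permutation spliced" using S by (auto simp: permutation_permutes)
qed

lemma p_x: "p x = x" using p x by (simp add: permutes_def)

lemma orbit_p_subset: "y \<in> S \<Longrightarrow> orbit p y \<subseteq> S"
  using p by (simp add: permutes_orbit_subset)

lemma orbit_insert_marked: "orbit spliced x = insert x (orbit p b)"
proof
  show "orbit spliced x \<subseteq> insert x (orbit p b)"
  proof
    fix z assume "z \<in> orbit spliced x"
    then show "z \<in> insert x (orbit p b)"
    proof induction
      case base
      then show ?case using p_x permutation_self_in_orbit[OF perm_p] by simp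
    next
      case (step z)
      then consider "z = x" | "z \<in> orbit p b" by auto
      then show ?case
      proof cases
        case 1
        then show ?thesis using p_x permutation_self_in_orbit[OF perm_p] by simp
      next
        case 2
        then have "p z \<in> orbit p b" by (rule orbit.step)
        then show ?thesis using orbit_p_subset[OF b] x by (auto simp: Transposition.transpose_def)
      qed
    qed
  qed
  have b_in: "b \<in> orbit spliced x" using orbit.base[of spliced x] p_x by simp
  have "z \<in> orbit spliced x" if "z \<in> orbit p b" for z
    using that
  proof induction
    case base
    have "p b \<noteq> x" using orbit_p_subset[OF b] orbit.base[of p b] x by auto
    then have "p b = b \<or> spliced b = p b" by (simp add: Transposition.transpose_def)
    then show ?case using b_in orbit.step[OF b_in] by (elim disjE) (simp_all only:)
  next
    case (step z)
    have "p z \<noteq> x" using orbit_p_subset[OF b] orbit.step[OF step(1)] x by auto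
    then have "p z = b \<or> spliced z = p z" by (simp add: Transposition.transpose_def)
    then show ?case using b_in orbit.step[OF step(2)] by (elim disjE) (simp_all only:)
  qed
  then show "insert x (orbit p b) \<subseteq> orbit spliced x"
    using permutation_self_in_orbit[OF perm_spliced, of x] by blast
qed

text \<open>The transposition changes only the values \<open>x\<close> and \<open>b\<close> of
  \<open>p\<close>, and neither is met on an orbit away from that of \<open>b\<close>.\<close>

lemma orbit_insert_other:
  assumes "y \<in> S" "y \<notin> orbit p b"
  shows "orbit spliced y = orbit p y"
proof (rule orbit_agree)
  fix z assume "z \<in> insert y (orbit p y)"
  then have z: "z \<in> orbit p y" using permutation_self_in_orbit[OF perm_p] by auto
  then have pz: "p z \<in> orbit p y" by (rule orbit.step)
  have "p z \<noteq> b"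
  proof
    assume "p z = b"
    then have "y \<in> orbit p b"
      using orbit_swap[OF permutation_self_in_orbit[OF perm_p] pz] by simp
    then show False using assms by simp
  qed
  moreover have "p z \<noteq> x" using pz orbit_p_subset[OF assms(1)] x by auto
  ultimately show "spliced z = p z" by (simp add: Transposition.transpose_def)
qed

lemma orbits_insert: "orbit spliced ` insert x S - {orbit spliced x} = orbit p ` S - {orbit p b}"
proof -
  have same: "orbit p y = orbit p b" if "y \<in> orbit p b" for y
    using orbit_cyclic_eq3[OF cyclic_on_orbit'[OF perm_p] that] .
  have same': "orbit spliced y = orbit spliced x" if "y \<in> orbit p b" for y
  proof -
    have "y \<in> orbit spliced x" using that orbit_insert_marked by auto
    then show ?thesis by (rule orbit_cyclic_eq3[OF cyclic_on_orbit'[OF perm_spliced]])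
  qed
  have self: "y \<in> orbit p y" for y by (rule permutation_self_in_orbit[OF perm_p])
  have ne: "orbit p y \<noteq> insert x (orbit p b)" if "y \<in> S" for y
    using orbit_p_subset[OF that] x by auto
  show ?thesis
  proof (intro set_eqI iffI)
    fix c assume "c \<in> orbit spliced ` insert x S - {orbit spliced x}"
    then obtain y where y: "y \<in> S" "c = orbit spliced y" "c \<noteq> orbit spliced x" by auto
    then have "y \<notin> orbit p b" using same' by auto
    then show "c \<in> orbit p ` S - {orbit p b}"
      using y orbit_insert_other[OF y(1)] self[of y] by auto
  next
    fix c assume "c \<in> orbit p ` S - {orbit p b}"
    then obtain y where y: "y \<in> S" "c = orbit p y" "c \<noteq> orbit p b" by auto
    then have "y \<notin> orbit p b" using same by auto
    then have "c = orbit spliced y" using orbit_insert_other y by simp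
    then show "c \<in> orbit spliced ` insert x S - {orbit spliced x}"
      using y ne[OF y(1)] orbit_insert_marked by auto
  qed
qed

lemma card_orbit_insert: "card (orbit spliced x) = Suc (card (orbit p b))"
proof -
  have "finite (orbit p b)" using orbit_p_subset[OF b] S by (rule finite_subset)
  moreover have "x \<notin> orbit p b" using orbit_p_subset[OF b] x by auto
  ultimately show ?thesis unfolding orbit_insert_marked by (rule card_insert_disjoint)
qed

end

text \<open>Permutations of \<open>insert x S\<close> correspond to pairs of \<open>b\<close> in
  \<open>insert x S\<close> and a permutation of \<open>S\<close>. For \<open>b = x\<close> the new
  element is a fixed point; otherwise it lengthens the cycle of \<open>b\<close> by one, so
  \<open>b\<close> becomes the marked element and \<open>h\<close> is shifted.\<close>

lemma marked_cycle_sum_insert: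
  assumes S: "finite S" and x: "x \<notin> S"
  shows "marked_cycle_sum g h (insert x S) x
    = h 1 * cycle_sum g S + (\<Sum>b\<in>S. marked_cycle_sum g (\<lambda>j. h (Suc j)) S b)"
proof -
  let ?f = "\<lambda>\<sigma>. h (card (orbit \<sigma> x)) * (\<Prod>c\<in>orbit \<sigma> ` insert x S - {orbit \<sigma> x}. g (card c))"
  have fixed: "?f p = h 1 * (\<Prod>c\<in>orbit p ` S. g (card c))" if p: "p permutes S" for p
  proof -
    have "p x = x" using p x by (simp add: permutes_def)
    then have ox: "orbit p x = {x}" by (simp add: orbit_eq_singleton_iff)
    have "orbit p y \<subseteq> S" if "y \<in> S" for y using p that by (simp add: permutes_orbit_subset)
    then have "{x} \<notin> orbit p ` S" using x by auto
    then have "orbit p ` insert x S - {orbit p x} = orbit p ` S" using ox by auto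
    then show ?thesis using ox by simp
  qed
  have "marked_cycle_sum g h (insert x S) x
      = (\<Sum>b\<in>insert x S. \<Sum>q | q permutes S. ?f (Transposition.transpose x b \<circ> q))"
    unfolding marked_cycle_sum_def using S x by (rule sum_over_permutations_insert)
  also have "\<dots> = (\<Sum>q | q permutes S. ?f (Transposition.transpose x x \<circ> q))
      + (\<Sum>b\<in>S. \<Sum>q | q permutes S. ?f (Transposition.transpose x b \<circ> q))"
    using S x by simp
  also have "(\<Sum>q | q permutes S. ?f (Transposition.transpose x x \<circ> q)) = h 1 * cycle_sum g S"
    unfolding cycle_sum_def sum_distrib_left using fixed by (intro sum.cong) auto
  also have "(\<Sum>b\<in>S. \<Sum>q | q permutes S. ?f (Transposition.transpose x b \<circ> q))
      = (\<Sum>b\<in>S. marked_cycle_sum g (\<lambda>j. h (Suc j)) S b)"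
    unfolding marked_cycle_sum_def
    by (intro sum.cong refl) (simp only: mem_Collect_eq orbits_insert[OF _ S x] card_orbit_insert[OF _ S x])
  finally show ?thesis .
qed

lemma cycle_sum_marked:
  assumes S: "finite S" and x: "x \<in> S"
  shows "cycle_sum g S = marked_cycle_sum g g S x"
  unfolding cycle_sum_def marked_cycle_sum_def
proof (intro sum.cong refl)
  fix \<sigma>
  show "(\<Prod>c\<in>orbit \<sigma> ` S. g (card c))
      = g (card (orbit \<sigma> x)) * (\<Prod>c\<in>orbit \<sigma> ` S - {orbit \<sigma> x}. g (card c))"
    using S x by (intro prod.remove) auto
qed

text \<open>The coefficients of the power series \<open>exp (\<Sum>j\<ge>1. g j * z ^ j / j)\<close>.\<close>

fun cycle_coeff :: "(nat \<Rightarrow> 'b::field_char_0) \<Rightarrow> nat \<Rightarrow> 'b" where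
  "cycle_coeff g n = (if n = 0 then 1
     else (\<Sum>j<n. g (Suc j) * cycle_coeff g (n - Suc j)) / of_nat n)"

declare cycle_coeff.simps [simp del]

lemma cycle_coeff_0 [simp]: "cycle_coeff g 0 = 1"
  by (subst cycle_coeff.simps) simp

text \<open>With F = exp G this compares coefficients in z F' = (z G') F. Unlike the defining
  equation it holds for n = 0 without a case distinction.\<close>

lemma cycle_coeff_rec:
  "of_nat n * cycle_coeff g n = (\<Sum>j=1..n. g j * cycle_coeff g (n - j))"
proof (cases "n = 0")
  case False
  then show ?thesis
    by (subst cycle_coeff.simps)
       (simp add: sum.atLeast1_atMost_eq)
qed simp

text \<open>Both statements go through one induction: the marked sum for n + 1 elements needs both
  of them for n, and the plain sum for n + 1 is the marked sum with \<open>h = g\<close> at any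
  element.\<close>

lemma cycle_sum_coeff:
  fixes g :: "nat \<Rightarrow> 'b::field_char_0"
  assumes "finite S"
  shows "cycle_sum g S = fact (card S) * cycle_coeff g (card S)"
    and "x \<in> S \<Longrightarrow> marked_cycle_sum g h S x
           = fact (card S - 1) * (\<Sum>j=1..card S. h j * cycle_coeff g (card S - j))"
  using assms
proof (induction "card S" arbitrary: S x h)
  case 0
  {
    case 1
    have "{\<sigma>. \<sigma> permutes ({} :: nat set)} = {id}" by auto
    then show ?case using 1 0 by (auto simp: cycle_sum_def)
  next
    case 2
    then show ?case using 0 by auto
  }
next
  case (Suc n)
  have marked: "marked_cycle_sum g h S x
           = fact (card S - 1) * (\<Sum>j=1..card S. h j * cycle_coeff g (card S - j))"
    if "x \<in> S" "finite S" "card S = Suc n" for S x h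
  proof -
    define T where "T = S - {x}"
    have T: "finite T" "x \<notin> T" "S = insert x T" "card T = n" using that by (auto simp: T_def)
    have "marked_cycle_sum g h S x
        = h 1 * cycle_sum g T + (\<Sum>b\<in>T. marked_cycle_sum g (\<lambda>j. h (Suc j)) T b)"
      unfolding T(3) by (rule marked_cycle_sum_insert[OF T(1,2)])
    also have "cycle_sum g T = fact n * cycle_coeff g n"
      using Suc.hyps(1)[of T] T by simp
    also have "(\<Sum>b\<in>T. marked_cycle_sum g (\<lambda>j. h (Suc j)) T b)
        = (\<Sum>b\<in>T. fact (n - 1) * (\<Sum>j=1..n. h (Suc j) * cycle_coeff g (n - j)))"
      using Suc.hyps(2)[of T _ "\<lambda>j. h (Suc j)"] T by (intro sum.cong refl) simp
    \<comment> \<open>By the induction hypothesis the summand does not depend on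
      \<open>b\<close>.\<close>
    also have "\<dots> = of_nat n * fact (n - 1) * (\<Sum>j=1..n. h (Suc j) * cycle_coeff g (n - j))"
      using T by simp
    \<comment> \<open>For n = 0 the two factors are 0 and 1, but the sum is empty.\<close>
    also have "\<dots> = fact n * (\<Sum>j=1..n. h (Suc j) * cycle_coeff g (n - j))"
      by (cases n) (simp_all)
    also have "(\<Sum>j=1..n. h (Suc j) * cycle_coeff g (n - j))
        = (\<Sum>j=2..Suc n. h j * cycle_coeff g (Suc n - j))"
      using sum.shift_bounds_cl_Suc_ivl[of "\<lambda>j. h j * cycle_coeff g (Suc n - j)" 1 n]
      by (simp add: numeral_2_eq_2)
    also have "h 1 * (fact n * cycle_coeff g n) + fact n * \<dots>
        = fact n * (\<Sum>j=1..Suc n. h j * cycle_coeff g (Suc n - j))"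
      by (subst (2) sum.atLeast_Suc_atMost) (simp_all add: algebra_simps numeral_2_eq_2)
    finally show ?thesis using that by simp
  qed
  {
    case 1
    obtain x where x: "x \<in> S" using Suc.hyps(3) by (metis card.empty equals0I nat.distinct(1))
    have "cycle_sum g S = marked_cycle_sum g g S x" using 1 x by (rule cycle_sum_marked)
    also have "\<dots> = fact n * (of_nat (Suc n) * cycle_coeff g (Suc n))"
      using marked[OF x 1 Suc.hyps(3)[symmetric], of g] Suc.hyps(3)[symmetric]
      by (simp only: cycle_coeff_rec) simp
    finally show ?case using Suc.hyps(3)[symmetric] by (simp add: algebra_simps)
  next
    case 2
    then show ?case using marked Suc.hyps(3) by simp
  }
qed

section \<open>The coefficients of (1 - z)^(-\<theta>), which normalise the Ewens measure\<close>

definition rising_coeff :: "real \<Rightarrow> nat \<Rightarrow> real" where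
  "rising_coeff \<theta> m = pochhammer \<theta> m / fact m"

lemma rising_coeff_0 [simp]: "rising_coeff \<theta> 0 = 1"
  by (simp add: rising_coeff_def)

lemma rising_coeff_Suc: "rising_coeff \<theta> (Suc m) = rising_coeff \<theta> m * (\<theta> + m) / Suc m"
  by (simp add: rising_coeff_def pochhammer_Suc)

lemma rising_coeff_pos: "\<theta> > 0 \<Longrightarrow> rising_coeff \<theta> m > 0"
  by (simp add: rising_coeff_def pochhammer_pos)

text \<open>Coefficients of z d/dz (1 - z)^(-\<theta>) = \<theta> z / (1 - z) * (1 - z)^(-\<theta>).
  This identity makes \<open>first_cycle_prob\<close> a probability.\<close>

lemma sum_rising_coeff: 
  "\<theta> * (\<Sum>i<m. rising_coeff \<theta> i) = m * rising_coeff \<theta> m"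
  by (induction m) (auto simp: rising_coeff_Suc field_simps)

text \<open>Index times coefficient is \<theta> times the preceding coefficient for \<theta> + 1, so
  this is the previous identity for \<theta> + 1. It yields the contraction factor in
  \<open>mean_first_cycle_prob\<close>.\<close>

lemma sum_index_rising_coeff:
  "(\<theta> + 1) * (\<Sum>i<m. real i * rising_coeff \<theta> i) = (real m - 1) * (m * rising_coeff \<theta> m)"
proof (induction m)
  case (Suc m)
  have "(\<theta> + 1) * (\<Sum>i<Suc m. real i * rising_coeff \<theta> i)
      = (real m - 1) * (m * rising_coeff \<theta> m) + (\<theta> + 1) * (real m * rising_coeff \<theta> m)"
    using Suc by (simp add: distrib_left)
  also have "\<dots> = real m * (rising_coeff \<theta> m * (\<theta> + m))" by (simp add: algebra_simps)
  also have "rising_coeff \<theta> m * (\<theta> + m) = Suc m * rising_coeff \<theta> (Suc m)"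
    by (simp add: rising_coeff_Suc)
  finally show ?case by simp
qed simp

text \<open>The coefficients themselves decrease when \<theta> < 1, but multiplied by the index they
  are \<theta> times partial sums of positive terms.\<close>

lemma index_rising_coeff_mono:
  assumes "\<theta> > 0" "i \<le> m"
  shows "real i * rising_coeff \<theta> i \<le> real m * rising_coeff \<theta> m"
proof -
  have "(\<Sum>k<i. rising_coeff \<theta> k) \<le> (\<Sum>k<m. rising_coeff \<theta> k)"
    using assms rising_coeff_pos[of \<theta>] by (intro sum_mono2) (auto intro: less_imp_le)
  then show ?thesis using assms by (simp flip: sum_rising_coeff)
qed

lemma sum_rev_1: "(\<Sum>j=1..m. f (m - j)) = (\<Sum>i<m. f i)" for f :: "nat \<Rightarrow> 'b::comm_monoid_add"
  by (rule sum.reindex_bij_witness[of _ "\<lambda>i. m - i" "\<lambda>j. m - j"]) auto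

lemma cycle_coeff_const:
  fixes \<theta> :: real
  shows "cycle_coeff (\<lambda>_. \<theta>) n = rising_coeff \<theta> n"
proof (induction n rule: less_induct)
  case (less n)
  show ?case
  proof (cases "n = 0")
    case False
    have "real n * cycle_coeff (\<lambda>_. \<theta>) n = (\<Sum>j=1..n. \<theta> * rising_coeff \<theta> (n - j))"
      unfolding cycle_coeff_rec using less by (intro sum.cong) auto
    also have "\<dots> = n * rising_coeff \<theta> n"
      by (simp only: sum_distrib_left[symmetric] sum_rev_1 sum_rising_coeff)
    finally show ?thesis using False by simp
  qed simp
qed

section \<open>Means of products and sums over the cycles of an Ewens permutation\<close>

lemma finite_cycle_sets: "finite (cycle_sets n \<sigma>)"
  by (simp add: cycle_sets_def)

lemma ewens_weight_sum:
  fixes X :: "(nat \<Rightarrow> nat) \<Rightarrow> 'b::{banach, second_countable_topology}"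
  assumes "\<theta> > 0"
  shows "(\<integral>\<sigma>. X \<sigma> \<partial>ewens n \<theta>) = (\<Sum>\<sigma> | \<sigma> permutes {1..n}. (\<theta> ^ num_cycles n \<sigma> / pochhammer \<theta> n) *\<^sub>R X \<sigma>)"
  unfolding ewens_def using assms
  by (intro lebesgue_integral_point_measure_finite)
     (auto simp: finite_permutations intro!: divide_nonneg_nonneg pochhammer_nonneg)

lemma space_ewens: "space (ewens n \<theta>) = {\<sigma>. \<sigma> permutes {1..n}}"
  by (simp add: ewens_def space_point_measure)

lemma measurable_ewens: "X \<in> borel_measurable (ewens n \<theta>)"
  by (simp add: ewens_def measurable_def sets_point_measure space_point_measure)

lemma prob_space_ewens:
  assumes "\<theta> > 0"
  shows "prob_space (ewens n \<theta>)"
proof (rule prob_spaceI)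
  have pos: "pochhammer \<theta> n > 0" using assms by (rule pochhammer_pos)
  have "(\<Sum>\<sigma> | \<sigma> permutes {1..n}. \<theta> ^ num_cycles n \<sigma>) = cycle_sum (\<lambda>_. \<theta>) {1..n}"
    by (simp add: cycle_sum_def num_cycles_def cycle_sets_def)
  also have "\<dots> = pochhammer \<theta> n"
    by (simp add: cycle_sum_coeff(1) cycle_coeff_const rising_coeff_def)
  finally have "(\<Sum>\<sigma> | \<sigma> permutes {1..n}. \<theta> ^ num_cycles n \<sigma> / pochhammer \<theta> n) = 1"
    using pos by (simp flip: sum_divide_distrib)
  then show "emeasure (ewens n \<theta>) (space (ewens n \<theta>)) = 1"
    unfolding space_ewens unfolding ewens_def using assms pos
    by (subst emeasure_point_measure_finite) (auto simp: finite_permutations sum_ennreal)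
qed

lemma ewens_cycle_prod:
  fixes g :: "nat \<Rightarrow> complex"
  assumes "\<theta> > 0"
  shows "(\<integral>\<sigma>. (\<Prod>c\<in>cycle_sets n \<sigma>. g (card c)) \<partial>ewens n \<theta>)
     = cycle_coeff (\<lambda>j. of_real \<theta> * g j) n / of_real (rising_coeff \<theta> n)"
proof -
  have "(\<integral>\<sigma>. (\<Prod>c\<in>cycle_sets n \<sigma>. g (card c)) \<partial>ewens n \<theta>)
      = (\<Sum>\<sigma> | \<sigma> permutes {1..n}. (\<Prod>c\<in>cycle_sets n \<sigma>. of_real \<theta> * g (card c)) / of_real (pochhammer \<theta> n))"
    unfolding ewens_weight_sum[OF assms]
    by (intro sum.cong refl) (simp add: prod.distrib num_cycles_def scaleR_conv_of_real)
  also have "\<dots> = cycle_sum (\<lambda>j. of_real \<theta> * g j) {1..n} / of_real (pochhammer \<theta> n)"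
    by (simp add: cycle_sum_def cycle_sets_def sum_divide_distrib)
  finally show ?thesis by (simp add: cycle_sum_coeff(1) rising_coeff_def)
qed

text \<open>Spread the value of each cycle evenly over its elements. Every element then contributes
  a marked cycle sum with \<open>h j / j\<close> in place of \<open>h j\<close>, and all n
  contributions agree. With \<open>h\<close> an indicator this gives expected cycle counts.\<close>

lemma ewens_cycle_sum:
  fixes h :: "nat \<Rightarrow> real"
  assumes "\<theta> > 0"
  shows "(\<integral>\<sigma>. (\<Sum>c\<in>cycle_sets n \<sigma>. h (card c)) \<partial>ewens n \<theta>)
     = (\<Sum>j=1..n. \<theta> * h j / j * (rising_coeff \<theta> (n - j) / rising_coeff \<theta> n))"
proof -
  have double: "(\<Sum>c\<in>cycle_sets n \<sigma>. h (card c)) = (\<Sum>x=1..n. h (card (orbit \<sigma> x)) / card (orbit \<sigma> x))"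
    if \<sigma>: "\<sigma> permutes {1..n}" for \<sigma>
  proof -
    have perm: "permutation \<sigma>" using \<sigma> by (auto simp: permutation_permutes)
    have "(\<Sum>x=1..n. h (card (orbit \<sigma> x)) / card (orbit \<sigma> x))
        = (\<Sum>c\<in>cycle_sets n \<sigma>. \<Sum>x\<in>{x\<in>{1..n}. orbit \<sigma> x = c}. h (card (orbit \<sigma> x)) / card (orbit \<sigma> x))"
      unfolding cycle_sets_def by (rule sum.image_gen) simp
    also have "\<dots> = (\<Sum>c\<in>cycle_sets n \<sigma>. h (card c))"
    proof (intro sum.cong refl)
      fix c assume "c \<in> cycle_sets n \<sigma>"
      then obtain y where y: "y \<in> {1..n}" "c = orbit \<sigma> y" by (auto simp: cycle_sets_def)
      have sub: "c \<subseteq> {1..n}" using permutes_orbit_subset[OF \<sigma> y(1)] y(2) by simp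
      have self: "x \<in> orbit \<sigma> x" for x by (rule permutation_self_in_orbit[OF perm])
      have "orbit \<sigma> x = c" if "x \<in> c" for x
        using orbit_cyclic_eq3[OF cyclic_on_orbit'[OF perm]] that y(2) by simp
      then have "{x\<in>{1..n}. orbit \<sigma> x = c} = c" using self sub by auto
      moreover have "card c > 0"
        using self[of y] y sub finite_subset[OF sub] by (auto simp: card_gt_0_iff)
      ultimately show "(\<Sum>x\<in>{x\<in>{1..n}. orbit \<sigma> x = c}. h (card (orbit \<sigma> x)) / card (orbit \<sigma> x)) = h (card c)"
        using sum.cong[of c c "\<lambda>x. h (card (orbit \<sigma> x)) / card (orbit \<sigma> x)" "\<lambda>_. h (card c) / card c"]
          \<open>\<And>x. x \<in> c \<Longrightarrow> orbit \<sigma> x = c\<close> by simp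
    qed
    finally show ?thesis by simp
  qed
  have marked: "(\<Sum>\<sigma> | \<sigma> permutes {1..n}. \<theta> ^ num_cycles n \<sigma> * (h (card (orbit \<sigma> x)) / card (orbit \<sigma> x)))
     = fact (n - 1) * (\<Sum>j=1..n. \<theta> * h j / j * rising_coeff \<theta> (n - j))" if x: "x \<in> {1..n}" for x
  proof -
    have "\<theta> ^ num_cycles n \<sigma> = \<theta> * (\<Prod>c\<in>orbit \<sigma> ` {1..n} - {orbit \<sigma> x}. \<theta>)" for \<sigma>
    proof -
      have "(\<Prod>c\<in>orbit \<sigma> ` {1..n}. \<theta>) = \<theta> * (\<Prod>c\<in>orbit \<sigma> ` {1..n} - {orbit \<sigma> x}. \<theta>)"
        using x by (intro prod.remove) auto
      then show ?thesis by (simp add: num_cycles_def cycle_sets_def)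
    qed
    then have "(\<Sum>\<sigma> | \<sigma> permutes {1..n}. \<theta> ^ num_cycles n \<sigma> * (h (card (orbit \<sigma> x)) / card (orbit \<sigma> x)))
       = marked_cycle_sum (\<lambda>_. \<theta>) (\<lambda>j. \<theta> * h j / j) {1..n} x"
      unfolding marked_cycle_sum_def by (intro sum.cong refl) simp
    then show ?thesis using x by (simp add: cycle_sum_coeff(2) cycle_coeff_const)
  qed
  have "(\<integral>\<sigma>. (\<Sum>c\<in>cycle_sets n \<sigma>. h (card c)) \<partial>ewens n \<theta>)
      = (\<Sum>\<sigma> | \<sigma> permutes {1..n}. \<Sum>x=1..n. \<theta> ^ num_cycles n \<sigma> / pochhammer \<theta> n * (h (card (orbit \<sigma> x)) / card (orbit \<sigma> x)))"
    unfolding ewens_weight_sum[OF assms]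
    by (intro sum.cong refl) (simp add: double sum_distrib_left)
  also have "\<dots> = (\<Sum>x=1..n. \<Sum>\<sigma> | \<sigma> permutes {1..n}. \<theta> ^ num_cycles n \<sigma> / pochhammer \<theta> n * (h (card (orbit \<sigma> x)) / card (orbit \<sigma> x)))"
    by (rule sum.swap)
  also have "\<dots> = (\<Sum>x=1..n. (fact (n - 1) * (\<Sum>j=1..n. \<theta> * h j / j * rising_coeff \<theta> (n - j))) / pochhammer \<theta> n)"
    by (intro sum.cong refl) (simp only: marked[symmetric] sum_divide_distrib, simp add: mult.commute)
  also have "\<dots> = real n * fact (n - 1) / pochhammer \<theta> n * (\<Sum>j=1..n. \<theta> * h j / j * rising_coeff \<theta> (n - j))"
    by simp
  also have "\<dots> = (\<Sum>j=1..n. \<theta> * h j / j * rising_coeff \<theta> (n - j)) / rising_coeff \<theta> n"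
    by (cases n) (simp_all add: rising_coeff_def)
  finally show ?thesis by (simp add: sum_divide_distrib)
qed

text \<open>\<open>Gamma_series'\<close> tends to the Gamma function, so the coefficients behave
  like m^(\<theta> - 1) / Gamma \<theta>. In ratios the Gamma factors cancel, and the remaining
  power becomes the density of a stick.\<close>

lemma rising_coeff_Gamma_series:
  assumes "\<theta> > 0" "m > 0"
  shows "rising_coeff \<theta> m = real m powr (\<theta> - 1) / Gamma_series' \<theta> m"
proof -
  have "fact m = real m * fact (m - 1)" using assms by (simp add: fact_reduce)
  moreover have "exp (\<theta> * ln (real m)) = real m powr (\<theta> - 1) * real m"
    using assms by (simp add: powr_diff) (simp add: powr_def)
  moreover have "pochhammer \<theta> m > 0" using assms by (simp add: pochhammer_pos)
  ultimately show ?thesis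
    using assms by (simp add: rising_coeff_def Gamma_series'_def field_simps)
qed

lemma rising_coeff_ratio_tendsto:
  fixes k m :: "nat \<Rightarrow> nat"
  assumes \<theta>: "\<theta> > 0" and m: "filterlim m at_top sequentially"
    and lim: "(\<lambda>n. real (k n) / real (m n)) \<longlonglongrightarrow> y" and y: "y > 0"
  shows "(\<lambda>n. rising_coeff \<theta> (k n) / rising_coeff \<theta> (m n)) \<longlonglongrightarrow> y powr (\<theta> - 1)"
proof -
  have m_real: "filterlim (\<lambda>n. real (m n)) at_top sequentially"
    by (rule filterlim_compose[OF filterlim_real_sequentially m])
  have m_pos: "\<forall>\<^sub>F n in sequentially. m n > 0"
    by (rule eventually_compose_filterlim[OF eventually_gt_at_top m])
  have "filterlim (\<lambda>n. real (k n) / real (m n) * real (m n)) at_top sequentially"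
    by (rule filterlim_tendsto_pos_mult_at_top[OF lim y m_real])
  moreover have "\<forall>\<^sub>F n in sequentially. real (k n) / real (m n) * real (m n) = real (k n)"
    using m_pos by eventually_elim simp
  ultimately have k_real: "filterlim (\<lambda>n. real (k n)) at_top sequentially"
    by (rule filterlim_mono_eventually[OF _ order_refl order_refl])
  then have k: "filterlim k at_top sequentially"
    by (simp add: filterlim_sequentially_iff_filterlim_real)
  have k_pos: "\<forall>\<^sub>F n in sequentially. k n > 0"
    by (rule eventually_compose_filterlim[OF eventually_gt_at_top k])
  have G: "Gamma_series' \<theta> \<longlonglongrightarrow> Gamma \<theta>" by (rule Gamma_series'_LIMSEQ)
  have "Gamma \<theta> \<noteq> 0" using Gamma_real_pos[OF \<theta>] by linarith
  then have "(\<lambda>n. (real (k n) / real (m n)) powr (\<theta> - 1) * (Gamma_series' \<theta> (m n) / Gamma_series' \<theta> (k n)))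
      \<longlonglongrightarrow> y powr (\<theta> - 1) * (Gamma \<theta> / Gamma \<theta>)"
    using y by (intro tendsto_intros lim filterlim_compose[OF G m] filterlim_compose[OF G k]) auto
  moreover have "\<forall>\<^sub>F n in sequentially.
      (real (k n) / real (m n)) powr (\<theta> - 1) * (Gamma_series' \<theta> (m n) / Gamma_series' \<theta> (k n))
      = rising_coeff \<theta> (k n) / rising_coeff \<theta> (m n)"
    using k_pos m_pos
    by eventually_elim (simp add: rising_coeff_Gamma_series \<theta> powr_divide)
  ultimately show ?thesis
    using \<open>Gamma \<theta> \<noteq> 0\<close> by (simp add: tendsto_cong)
qed

text \<open>Since n - j is at least n / 2, monotonicity of index times coefficient costs only a
  factor 2. Hence the expected number of cycles of length j <= n / 2 is at most 2 \<theta> /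
  j.\<close>

lemma rising_coeff_ratio_le:
  assumes "\<theta> > 0" "2 * j \<le> n" "n > 0"
  shows "rising_coeff \<theta> (n - j) / rising_coeff \<theta> n \<le> 2"
proof -
  have pos: "rising_coeff \<theta> n > 0" "rising_coeff \<theta> (n - j) > 0" using rising_coeff_pos assms by auto
  have "real n / 2 * rising_coeff \<theta> (n - j) \<le> real (n - j) * rising_coeff \<theta> (n - j)"
    using assms pos by (intro mult_right_mono) auto
  also have "\<dots> \<le> real n * rising_coeff \<theta> n"
    using assms by (intro index_rising_coeff_mono) auto
  finally show ?thesis using assms pos by (simp add: field_simps)
qed

section \<open>Equidistribution of rotations\<close>

lemma periodic_int:
  fixes \<Gamma> :: "real \<Rightarrow> 'b"
  assumes "\<And>u. \<Gamma> (u + 1) = \<Gamma> u"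
  shows "\<Gamma> (u + of_int k) = \<Gamma> u"
proof (induction k rule: int_induct[where k = 0])
  case (step1 i)
  then show ?case using assms[of "u + of_int i"] by (simp add: add.assoc)
next
  case (step2 i)
  then show ?case using assms[of "u + of_int (i - 1)"] by simp
qed simp

lemma integral_periodic_shift:
  fixes \<Gamma> :: "real \<Rightarrow> complex"
  assumes per: "\<And>u. \<Gamma> (u + 1) = \<Gamma> u" and cont: "continuous_on UNIV \<Gamma>"
  shows "integral {0..1} (\<lambda>s. \<Gamma> (s + a)) = integral {0..1} \<Gamma>"
proof -
  define b where "b = frac a"
  have b: "0 \<le> b" "b \<le> 1" by (auto simp: b_def frac_lt_1 less_imp_le)
  have cont': "continuous_on X \<Gamma>" for X using cont continuous_on_subset by blast
  have int: "\<Gamma> integrable_on {p..q}" for p q by (intro integrable_continuous_real cont')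
  have shift: "integral {p..q} (\<lambda>s. \<Gamma> (s + c)) = integral {p + c..q + c} \<Gamma>" for p q c
    using integral_shift[of p c q \<Gamma>] cont' by (simp add: o_def)
  have "\<Gamma> (s + a) = \<Gamma> (s + b)" for s
    using periodic_int[of \<Gamma> "s + b" "\<lfloor>a\<rfloor>", OF per] by (simp add: b_def frac_def)
  then have "integral {0..1} (\<lambda>s. \<Gamma> (s + a)) = integral {b..1 + b} \<Gamma>"
    using shift[of 0 1 b] by simp
  also have "\<dots> = integral {b..1} \<Gamma> + integral {1..1 + b} \<Gamma>"
    using b int by (intro Henstock_Kurzweil_Integration.integral_combine[symmetric]) auto
  also have "integral {1..1 + b} \<Gamma> = integral {0..b} \<Gamma>"
    using shift[of 0 b 1] by (simp add: per add.commute)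
  also have "integral {b..1} \<Gamma> + integral {0..b} \<Gamma> = integral {0..1} \<Gamma>"
    using Henstock_Kurzweil_Integration.integral_combine[of 0 b 1 \<Gamma>] b int by (simp add: add.commute)
  finally show ?thesis .
qed

text \<open>An integer translation brings x into [0, 1) and a point y at distance less than 1 into
  [-1, 2], so compactness of that interval suffices.\<close>

lemma periodic_uniformly_continuous:
  fixes \<Gamma> :: "real \<Rightarrow> complex"
  assumes per: "\<And>u. \<Gamma> (u + 1) = \<Gamma> u" and cont: "continuous_on UNIV \<Gamma>" and e: "e > 0"
  obtains d where "d > 0" "\<And>x y. \<bar>x - y\<bar> < d \<Longrightarrow> norm (\<Gamma> x - \<Gamma> y) < e"
proof -
  have "uniformly_continuous_on {-1..2} \<Gamma>"
    using cont continuous_on_subset by (intro compact_uniformly_continuous) blast+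
  then obtain d where d: "d > 0"
    "\<And>x y. x \<in> {-1..2} \<Longrightarrow> y \<in> {-1..2} \<Longrightarrow> dist y x < d \<Longrightarrow> dist (\<Gamma> y) (\<Gamma> x) < e"
    using e unfolding uniformly_continuous_on_def by metis
  have "norm (\<Gamma> x - \<Gamma> y) < e" if "\<bar>x - y\<bar> < min d 1" for x y
  proof -
    have x: "frac x \<in> {0..<1}" by (auto simp: frac_lt_1)
    have "\<Gamma> (frac x) = \<Gamma> x" "\<Gamma> (y - of_int \<lfloor>x\<rfloor>) = \<Gamma> y"
      using periodic_int[of \<Gamma> "frac x" "\<lfloor>x\<rfloor>", OF per]
        periodic_int[of \<Gamma> "y - of_int \<lfloor>x\<rfloor>" "\<lfloor>x\<rfloor>", OF per] by (simp_all add: frac_def)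
    moreover have "dist (\<Gamma> (frac x)) (\<Gamma> (y - of_int \<lfloor>x\<rfloor>)) < e"
    proof (rule d(2))
      have "\<bar>frac x - (y - of_int \<lfloor>x\<rfloor>)\<bar> < min d 1" using that by (simp add: frac_def)
      then show "y - of_int \<lfloor>x\<rfloor> \<in> {-1..2}" "frac x \<in> {-1..2}"
        and "dist (frac x) (y - of_int \<lfloor>x\<rfloor>) < d"
        using x unfolding dist_real_def atLeastAtMost_iff atLeastLessThan_iff by linarith+
    qed
    ultimately show ?thesis by (simp add: dist_norm)
  qed
  then show thesis using that[of "min d 1"] d(1) by auto
qed

text \<open>The point is that \<open>K\<close> does not depend on \<open>r\<close>. Kronecker's
  theorem is applied only to the finitely many points l / M of a grid, half of \<eta> being spent on
  the mesh and half on the approximation.\<close>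

lemma irrational_multiples_dense:
  fixes \<beta> :: real
  assumes \<beta>: "\<beta> \<notin> \<rat>" and \<eta>: "\<eta> > 0"
  obtains K where "\<And>r. \<exists>k\<le>K. \<exists>p::int. \<bar>r - (real k * \<beta> + p)\<bar> < \<eta>"
proof -
  obtain M :: nat where M: "M > 0" "1 / M < \<eta> / 2"
    using \<eta> by (metis half_gt_zero real_arch_invD inverse_eq_divide of_nat_0_less_iff zero_less_iff_neq_zero)
  have "\<exists>k>0. \<bar>frac (real k * \<beta>) - real l / M\<bar> < \<eta> / 2" if l: "l \<in> {..M}" for l
  proof -
    obtain k where "k > 0" "\<bar>frac (real k * \<beta>) - real l / M\<bar> < \<eta> / 2"
      using Kronecker_approx_1_explicit[OF \<beta>, of "real l / M" "\<eta> / 2"] l M \<eta> by auto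
    then show ?thesis by blast
  qed
  then obtain k where k: "\<And>l. l \<in> {..M} \<Longrightarrow> \<bar>frac (real (k l) * \<beta>) - real l / M\<bar> < \<eta> / 2"
    by metis
  have "\<exists>k'\<le>Max (k ` {..M}). \<exists>p::int. \<bar>r - (real k' * \<beta> + p)\<bar> < \<eta>" for r
  proof -
    define l where "l = nat \<lfloor>M * frac r\<rfloor>"
    have fr: "0 \<le> frac r" "frac r < 1" by (auto simp: frac_lt_1)
    have "M * frac r \<le> M" using fr by (simp add: mult_left_le)
    then have l: "l \<in> {..M}" by (simp add: l_def) linarith
    have "real l \<le> M * frac r" "M * frac r < real l + 1" using fr M by (auto simp: l_def)
    then have "\<bar>M * frac r - real l\<bar> \<le> 1" by linarith
    moreover have "frac r - real l / M = (M * frac r - real l) / M" using M by (simp add: field_simps)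
    ultimately have "\<bar>frac r - real l / M\<bar> \<le> 1 / M" using M by (simp add: divide_right_mono)
    then have "\<bar>frac r - frac (real (k l) * \<beta>)\<bar> < \<eta>" using k[OF l] M by linarith
    then have "\<bar>r - (real (k l) * \<beta> + of_int (\<lfloor>r\<rfloor> - \<lfloor>real (k l) * \<beta>\<rfloor>))\<bar> < \<eta>"
      by (simp add: frac_def algebra_simps)
    moreover have "k l \<le> Max (k ` {..M})" using l by (intro Max_ge) auto
    ultimately show ?thesis by blast
  qed
  then show thesis by (rule that)
qed

text \<open>The averages vary little along the orbit of the rotation, hence by density of the orbit and
  uniform continuity on the whole circle, and their mean over the circle is the integral.\<close>

lemma rotation_equidistribution:
  fixes \<Gamma> :: "real \<Rightarrow> complex"
  assumes \<beta>: "\<beta> \<notin> \<rat>" and per: "\<And>u. \<Gamma> (u + 1) = \<Gamma> u" and cont: "continuous_on UNIV \<Gamma>"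
    and bound: "\<And>u. norm (\<Gamma> u) \<le> B" and e: "e > 0"
  shows "\<exists>N0. \<forall>N\<ge>N0. \<forall>s. norm ((\<Sum>i<N. \<Gamma> (s + real i * \<beta>)) / of_nat N - integral {0..1} \<Gamma>) \<le> e"
proof -
  have B: "B \<ge> 0" using bound[of 0] norm_ge_zero order_trans by blast
  obtain d where d: "d > 0" "\<And>x y. \<bar>x - y\<bar> < d \<Longrightarrow> norm (\<Gamma> x - \<Gamma> y) < e / 2"
    using periodic_uniformly_continuous[of \<Gamma> "e / 2"] per cont e by auto
  obtain K where K: "\<And>r. \<exists>k\<le>K. \<exists>p::int. \<bar>r - (real k * \<beta> + p)\<bar> < d"
    using irrational_multiples_dense[OF \<beta> d(1)] by blast
  define A where "A = (\<lambda>N s. \<Sum>i<N. \<Gamma> (s + real i * \<beta>))"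
  \<comment> \<open>Moving the start by one rotation step exchanges a single term of the sum,
    whatever N is.\<close>
  have A_step: "norm (A N (s + real k * \<beta>) - A N s) \<le> real k * (2 * B)" for N s k
  proof (induction k)
    case (Suc k)
    let ?t = "s + real k * \<beta>"
    have "A N (?t + \<beta>) - A N ?t = (\<Sum>i<N. \<Gamma> (?t + real (Suc i) * \<beta>) - \<Gamma> (?t + real i * \<beta>))"
      by (simp add: A_def sum_subtractf algebra_simps)
    also have "\<dots> = \<Gamma> (?t + real N * \<beta>) - \<Gamma> (?t + real 0 * \<beta>)"
      by (rule sum_lessThan_telescope)
    finally have "norm (A N (?t + \<beta>) - A N ?t) \<le> 2 * B"
      using norm_triangle_le_diff[of "\<Gamma> (?t + real N * \<beta>)" "\<Gamma> (?t + real 0 * \<beta>)" "2 * B"]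
        bound[of "?t + real N * \<beta>"] bound[of "?t + real 0 * \<beta>"] by simp
    then have "norm (A N (?t + \<beta>) - A N s) \<le> real k * (2 * B) + 2 * B"
      using Suc norm_triangle_le[of "A N (?t + \<beta>) - A N ?t" "A N ?t - A N s"] by simp
    then show ?case by (simp add: algebra_simps)
  qed simp
  have osc: "norm (A N s' - A N s) \<le> real N * (e / 2) + real K * (2 * B)" for N s s'
  proof -
    obtain k p where k: "k \<le> K" "\<bar>s' - s - (real k * \<beta> + of_int p)\<bar> < d"
      using K[of "s' - s"] by blast
    have "\<Gamma> (s + real k * \<beta> + real i * \<beta>) = \<Gamma> (s + real k * \<beta> + real i * \<beta> + of_int p)" for i
      by (rule periodic_int[of \<Gamma>, OF per, symmetric])
    then have "A N s' - A N (s + real k * \<beta>)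
        = (\<Sum>i<N. \<Gamma> (s' + real i * \<beta>) - \<Gamma> (s + real k * \<beta> + real i * \<beta> + of_int p))"
      by (simp add: A_def sum_subtractf)
    also have "norm \<dots> \<le> (\<Sum>i<N. e / 2)"
      using k(2) by (intro sum_norm_le less_imp_le[OF d(2)]) (simp add: algebra_simps)
    finally have "norm (A N s' - A N (s + real k * \<beta>)) \<le> real N * (e / 2)" by simp
    moreover have "norm (A N (s + real k * \<beta>) - A N s) \<le> real K * (2 * B)"
      using A_step[of N s k] k(1) B by (meson mult_right_mono of_nat_mono order_trans mult_nonneg_nonneg zero_le_numeral)
    ultimately show ?thesis
      using norm_triangle_le[of "A N s' - A N (s + real k * \<beta>)" "A N (s + real k * \<beta>) - A N s"] by simp
  qed
  have shift_cont: "continuous_on X (\<lambda>s. \<Gamma> (s + c))" for X c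
    by (rule continuous_on_compose2[OF cont]) (auto intro!: continuous_intros)
  have A_int: "integral {0..1} (A N) = of_nat N * integral {0..1} \<Gamma>" for N
  proof -
    have "integral {0..1} (A N) = (\<Sum>i<N. integral {0..1} (\<lambda>s. \<Gamma> (s + real i * \<beta>)))"
      unfolding A_def
      by (intro integral_sum integrable_continuous_real shift_cont) auto
    then show ?thesis by (simp add: integral_periodic_shift[OF per cont])
  qed
  have A_cont: "continuous_on X (A N)" for X N
    unfolding A_def by (intro continuous_on_sum shift_cont)
  have dev: "norm (A N s - of_nat N * integral {0..1} \<Gamma>) \<le> real N * (e / 2) + real K * (2 * B)" for N s
  proof -
    have "integral {0..1} (\<lambda>s'. A N s' - A N s) = of_nat N * integral {0..1} \<Gamma> - A N s"
      by (subst Henstock_Kurzweil_Integration.integral_diff)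
         (auto intro!: integrable_continuous_real A_cont simp: A_int)
    moreover have "norm (integral {0..1} (\<lambda>s'. A N s' - A N s)) \<le> (real N * (e / 2) + real K * (2 * B)) * (1 - 0)"
      using osc by (intro integral_bound) (auto intro!: continuous_intros A_cont)
    ultimately show ?thesis by (simp add: norm_minus_commute)
  qed
  \<comment> \<open>From here on the fixed cost 2 B K of at most K rotation steps is below N e / 2;
    the other half of e comes from uniform continuity.\<close>
  obtain N0 :: nat where N0: "real N0 > real K * (4 * B) / e" using reals_Archimedean2 by blast
  have "norm (A N s / of_nat N - integral {0..1} \<Gamma>) \<le> e" if N: "N \<ge> Suc N0" for N s
  proof -
    have "real K * (4 * B) / e \<le> real N" using N N0 by linarith
    then have "real K * (2 * B) \<le> real N * (e / 2)" using e by (simp add: field_simps)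
    then have "norm (A N s - of_nat N * integral {0..1} \<Gamma>) \<le> real N * e" using dev[of N s] by linarith
    moreover have "A N s / of_nat N - integral {0..1} \<Gamma> = (A N s - of_nat N * integral {0..1} \<Gamma>) / of_nat N"
      using N by (simp add: field_simps)
    ultimately show ?thesis using N by (simp add: norm_divide field_simps)
  qed
  then show ?thesis unfolding A_def by blast
qed

section \<open>Multiples close to integers\<close>

text \<open>The finitely many exceptional fractions are absorbed into \<open>c\<close>, the least of
  1 and their normalised distances, which are positive because \<alpha> is irrational. The exponent
  is l - 1 after multiplication by q; taking the maximum with 1 gives s <= 1, so that t^s is concave
  in \<open>powr_diff_ge\<close>.\<close>

lemma finite_irrationality_measure:
  fixes \<alpha> :: real
  assumes irr: "\<alpha> \<notin> \<rat>" and fin: "irrationality_measure \<alpha> < \<infinity>"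
  obtains c s where "c > 0" "0 < s" "s \<le> 1"
    "\<And>(q::nat) (p::int). q > 0 \<Longrightarrow> \<bar>real q * \<alpha> - of_int p\<bar> \<ge> c * real q powr (- (1 / s))"
proof -
  obtain l where l: "finite {(p :: int, q :: int). q > 0 \<and> \<bar>\<alpha> - of_int p / of_int q\<bar> < 1 / of_int q powr l}"
    using fin unfolding irrationality_measure_def Inf_less_iff by blast
  define X where "X = {(p :: int, q :: int). q > 0 \<and> \<bar>\<alpha> - of_int p / of_int q\<bar> < 1 / of_int q powr l}"
  define Y where "Y = insert 1 ((\<lambda>(p, q). \<bar>\<alpha> - of_int p / of_int q\<bar> * of_int q powr l) ` X)"
  define c where "c = Min Y"
  have fin: "finite Y" using l by (simp add: Y_def X_def)
  have "\<alpha> - of_int p / of_int q \<noteq> 0" for p q :: int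
    using irr by (metis Rats_divide Rats_of_int eq_iff_diff_eq_0)
  then have "\<forall>y\<in>Y. y > 0" by (auto simp: Y_def X_def)
  then have c: "c > 0" using fin by (simp add: c_def Y_def)
  have "\<bar>real q * \<alpha> - of_int p\<bar> \<ge> c * real q powr (- max 1 (l - 1))" if q: "q > 0" for q :: nat and p :: int
  proof -
    have "\<bar>\<alpha> - p / q\<bar> * q powr l \<ge> c"
    proof (cases "(p, int q) \<in> X")
      case True
      then show ?thesis using fin by (auto simp: c_def Y_def intro!: Min_le image_eqI[of _ _ "(p, int q)"])
    next
      case False
      then have "\<bar>\<alpha> - p / q\<bar> * q powr l \<ge> 1" using q by (simp add: X_def field_simps)
      moreover have "c \<le> 1" using fin by (auto simp: c_def Y_def intro!: Min_le)
      ultimately show ?thesis by linarith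
    qed
    then have "c * q powr (1 - l) \<le> (\<bar>\<alpha> - p / q\<bar> * q powr l) * q powr (1 - l)"
      by (intro mult_right_mono) auto
    also have "\<dots> = \<bar>\<alpha> - p / q\<bar> * q" using q by (simp add: powr_diff)
    also have "\<dots> = \<bar>q * \<alpha> - p\<bar>" using q by (simp add: abs_mult_pos' field_simps flip: abs_mult_pos)
    finally have "c * q powr (1 - l) \<le> \<bar>q * \<alpha> - p\<bar>" .
    moreover have "q powr (- max 1 (l - 1)) \<le> q powr (1 - l)" using q by (intro powr_mono) auto
    ultimately show ?thesis using c by (meson mult_left_mono less_imp_le order_trans)
  qed
  then show thesis using that[of c "1 / max 1 (l - 1)"] c by simp
qed

text \<open>The graph of the concave function t^s lies below its tangent at y. Scaling y to 1 leaves
  r^s <= 1 - s (1 - r), which is convexity of exp between 0 and ln r; r = 0 has no logarithm and is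
  treated apart.\<close>

lemma powr_diff_ge:
  fixes x y s :: real
  assumes "0 < s" "s \<le> 1" "0 \<le> x" "x < y"
  shows "s * (y powr s / y) * (y - x) \<le> y powr s - x powr s"
proof -
  define r where "r = x / y"
  have r: "0 \<le> r" "x = r * y" using assms by (auto simp: r_def)
  have "r powr s \<le> 1 - s * (1 - r)"
  proof (cases "r = 0")
    case False
    then have "exp ((1 - s) *\<^sub>R 0 + s *\<^sub>R ln r) \<le> (1 - s) * exp 0 + s * exp (ln r)"
      using assms by (intro convex_onD[OF exp_convex]) auto
    then show ?thesis using False r by (simp add: powr_def algebra_simps)
  qed (use assms in auto)
  then have "y powr s * (s * (1 - r)) \<le> y powr s * (1 - r powr s)"
    by (intro mult_left_mono) auto
  moreover have "x powr s = r powr s * y powr s" using r assms by (simp add: powr_mult)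
  moreover have "s * (y powr s / y) * (y - x) = y powr s * (s * (1 - r))"
    using assms r by (simp add: field_simps)
  ultimately show ?thesis by (simp add: algebra_simps)
qed

text \<open>Two elements of \<open>H\<close> not exceeding \<open>m\<close> differ by a number \<open>d\<close> for which \<open>d * \<alpha>\<close> is within
  \<open>2 * \<epsilon> * m\<close> of an integer, so \<open>d\<close> is large; comparing \<open>1 / m\<close> with the integral of \<open>x powr (s - 1)\<close>
  over the gap below \<open>m\<close> makes the sum telescope.\<close>

lemma sum_near_integer_multiples:
  fixes \<alpha> c \<epsilon> :: real
  assumes c: "c > 0" and s: "0 < s" "s \<le> 1" and \<epsilon>: "\<epsilon> > 0"
    and dioph: "\<And>(q::nat) (p::int). q > 0 \<Longrightarrow> \<bar>real q * \<alpha> - of_int p\<bar> \<ge> c * real q powr (- (1 / s))"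
    and H: "\<And>j. j \<in> H \<Longrightarrow> j > 0 \<and> (\<exists>p::int. \<bar>j * \<alpha> - p\<bar> \<le> \<epsilon> * j)"
  shows "(\<Sum>j\<in>H \<inter> {1..m}. 1 / real j) \<le> (2 * \<epsilon> / c) powr s / s * real m powr s"
proof (induction m rule: less_induct)
  case (less m)
  define \<kappa> where "\<kappa> = (2 * \<epsilon> / c) powr s"
  have \<kappa>: "\<kappa> > 0" using c \<epsilon> by (simp add: \<kappa>_def)
  consider "m = 0" | "m > 0" "m \<notin> H" | "m > 0" "m \<in> H" by blast
  then show ?case
  proof cases
    case 2
    then have "H \<inter> {1..m} = H \<inter> {1..m - 1}"
      by (auto simp: le_diff_conv2) (metis One_nat_def Suc_leI le_neq_implies_less less_Suc_eq_le Suc_pred)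
    then have "(\<Sum>j\<in>H \<inter> {1..m}. 1 / real j) \<le> \<kappa> / s * real (m - 1) powr s"
      using less[of "m - 1"] 2 by (simp add: \<kappa>_def)
    also have "\<dots> \<le> \<kappa> / s * real m powr s"
      using \<kappa> s by (intro mult_left_mono powr_mono2) auto
    finally show ?thesis by (simp add: \<kappa>_def)
  next
    case 3
    \<comment> \<open>The predecessor of \<open>m\<close> in \<open>H\<close>, or 0 if there is
      none. The value 0 serves as well as an element of \<open>H\<close>, since 0 * \<alpha> is an
      integer.\<close>
    define m' where "m' = Max (insert 0 (H \<inter> {1..<m}))"
    have fin: "finite (insert 0 (H \<inter> {1..<m}))" by simp
    have m': "m' \<in> insert 0 (H \<inter> {1..<m})" unfolding m'_def by (rule Max_in[OF fin]) simp
    have upper: "j \<le> m'" if "j \<in> H \<inter> {1..<m}" for j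
      using that unfolding m'_def by (intro Max_ge[OF fin]) auto
    have m'_less: "m' < m" using m' 3 by auto
    have split: "H \<inter> {1..m} = insert m (H \<inter> {1..m'})"
      using 3 upper m'_less by (auto simp: nat_less_le)
    obtain p :: int where p: "\<bar>m * \<alpha> - p\<bar> \<le> \<epsilon> * m" using H[OF 3(2)] by blast
    obtain p' :: int where p': "\<bar>m' * \<alpha> - p'\<bar> \<le> \<epsilon> * m'"
    proof (cases "m' = 0")
      case True
      then show ?thesis using that[of 0] by simp
    next
      case False
      then show ?thesis using H[of m'] m' that by auto
    qed
    define d where "d = m - m'"
    have d: "d > 0" "real d = real m - real m'" using m'_less by (auto simp: d_def)
    have "c * d powr (- (1 / s)) \<le> \<bar>d * \<alpha> - of_int (p - p')\<bar>" using d by (intro dioph)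
    also have "d * \<alpha> - of_int (p - p') = (m * \<alpha> - p) - (m' * \<alpha> - p')" by (simp add: d algebra_simps)
    also have "\<bar>\<dots>\<bar> \<le> \<epsilon> * m + \<epsilon> * m'" using p p' by linarith
    also have "\<dots> \<le> 2 * \<epsilon> * m" using m'_less \<epsilon> by (simp add: algebra_simps)
    finally have "d powr (- (1 / s)) \<le> 2 * \<epsilon> / c * m" using c by (simp add: field_simps)
    \<comment> \<open>The power s isolates the gap: 1 / d <= \<kappa> * m^s, so the gap
      \<open>d\<close> below \<open>m\<close> cannot be short.\<close>
    then have "(d powr (- (1 / s))) powr s \<le> (2 * \<epsilon> / c * m) powr s" using s by (intro powr_mono2) auto
    moreover have "(d powr (- (1 / s))) powr s = 1 / d"
    proof -
      have "(d powr (- (1 / s))) powr s = d powr (- 1)" unfolding powr_powr using s by simp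
      then show ?thesis using d(1) by (simp add: powr_minus_divide)
    qed
    moreover have "(2 * \<epsilon> / c * m) powr s = \<kappa> * m powr s" unfolding \<kappa>_def by (rule powr_mult)
    ultimately have "1 / d \<le> \<kappa> * m powr s" by simp
    then have "1 \<le> \<kappa> * m powr s * d" using d(1) by (simp add: field_simps del: of_nat_diff)
    then have "1 / m \<le> (\<kappa> * m powr s * d) / m" by (intro divide_right_mono) auto
    also have "\<dots> = \<kappa> / s * (s * (real m powr s / m) * (real m - real m'))"
      using 3 s by (simp add: d(2))
    also have "\<dots> \<le> \<kappa> / s * (real m powr s - real m' powr s)"
      using s \<kappa> m'_less by (intro mult_left_mono powr_diff_ge) auto
    finally have "1 / m \<le> \<kappa> / s * (real m powr s - real m' powr s)" .
    moreover have "(\<Sum>j\<in>H \<inter> {1..m'}. 1 / real j) \<le> \<kappa> / s * real m' powr s"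
      using less[OF m'_less] by (simp add: \<kappa>_def)
    moreover have "(\<Sum>j\<in>H \<inter> {1..m}. 1 / real j) = 1 / m + (\<Sum>j\<in>H \<inter> {1..m'}. 1 / real j)"
      unfolding split using m'_less by (subst sum.insert) auto
    ultimately have "(\<Sum>j\<in>H \<inter> {1..m}. 1 / real j) \<le> \<kappa> / s * real m powr s"
      by (simp add: right_diff_distrib)
    then show ?thesis by (simp add: \<kappa>_def)
  qed simp
qed

section \<open>The cycle containing a marked element\<close>

definition stick_density :: "real \<Rightarrow> real \<Rightarrow> real" where
  "stick_density \<theta> w = \<theta> * (1 - w) powr (\<theta> - 1) * indicator {0..1} w"

lemma stick_density_measurable [measurable]: "stick_density \<theta> \<in> borel_measurable borel"
  unfolding stick_density_def by measurable

lemma stick_density_nonneg: "\<theta> > 0 \<Longrightarrow> stick_density \<theta> w \<ge> 0"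
  by (simp add: stick_density_def)

lemma stick_law_eq_density: "stick_law \<theta> = density lborel (\<lambda>w. ennreal (stick_density \<theta> w))"
  unfolding stick_law_def stick_density_def by (intro arg_cong2[where f = density] refl ext)
    (simp split: split_indicator)

lemma nn_integral_stick_density:
  assumes "\<theta> > 0" shows "(\<integral>\<^sup>+w. ennreal (stick_density \<theta> w) \<partial>lborel) = 1"
  using prob_space.emeasure_space_1[OF prob_space_stick_law[OF assms]]
  by (simp add: stick_law_eq_density emeasure_density)

lemma integrable_stick_density:
  assumes "\<theta> > 0" shows "integrable lborel (stick_density \<theta>)"
  using nn_integral_stick_density[OF assms] stick_density_nonneg[OF assms]
  by (intro integrableI_nonneg) auto

lemma integral_stick_law:
  fixes f :: "real \<Rightarrow> complex"
  assumes "\<theta> > 0" "f \<in> borel_measurable borel"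
  shows "(\<integral>w. f w \<partial>stick_law \<theta>) = (\<integral>w. stick_density \<theta> w *\<^sub>R f w \<partial>lborel)"
  unfolding stick_law_eq_density using assms stick_density_nonneg[OF assms(1)]
  by (intro integral_density) auto

text \<open>The probability that the cycle of a fixed element has length j in an Ewens permutation
  of m elements, for 1 <= j <= m.\<close>

definition first_cycle_prob :: "real \<Rightarrow> nat \<Rightarrow> nat \<Rightarrow> real" where
  "first_cycle_prob \<theta> m j = \<theta> / m * (rising_coeff \<theta> (m - j) / rising_coeff \<theta> m)"

lemma first_cycle_prob_nonneg: "\<theta> > 0 \<Longrightarrow> first_cycle_prob \<theta> m j \<ge> 0"
  using rising_coeff_pos[of \<theta>] by (simp add: first_cycle_prob_def less_imp_le)

lemma sum_first_cycle_prob: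
  assumes "\<theta> > 0" "m > 0"
  shows "(\<Sum>j=1..m. first_cycle_prob \<theta> m j) = 1"
proof -
  have "(\<Sum>j=1..m. first_cycle_prob \<theta> m j)
      = (\<theta> * (\<Sum>j=1..m. rising_coeff \<theta> (m - j))) / (m * rising_coeff \<theta> m)"
    by (simp add: first_cycle_prob_def sum_distrib_left sum_divide_distrib)
  then show ?thesis
    using assms rising_coeff_pos[of \<theta> m] by (simp only: sum_rev_1 sum_rising_coeff) simp
qed

text \<open>The mean number of elements outside the first cycle is exactly \<theta> / (\<theta> + 1)
  * (m - 1); the bound is linear in m so that it can be iterated.\<close>

lemma mean_first_cycle_prob:
  assumes "\<theta> > 0" "m > 0"
  shows "(\<Sum>j=1..m. first_cycle_prob \<theta> m j * real (m - j)) \<le> \<theta> / (\<theta> + 1) * m"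
proof -
  have pos: "rising_coeff \<theta> m > 0" using assms rising_coeff_pos by auto
  have "(\<Sum>j=1..m. first_cycle_prob \<theta> m j * real (m - j))
      = \<theta> / (m * rising_coeff \<theta> m) * (\<Sum>j=1..m. real (m - j) * rising_coeff \<theta> (m - j))"
    by (simp add: first_cycle_prob_def sum_distrib_left mult_ac)
  also have "(\<Sum>j=1..m. real (m - j) * rising_coeff \<theta> (m - j)) = (\<Sum>i<m. real i * rising_coeff \<theta> i)"
    by (rule sum_rev_1)
  also have "\<dots> = (real m - 1) * (m * rising_coeff \<theta> m) / (\<theta> + 1)"
    using sum_index_rising_coeff[of \<theta> m] assms by (simp add: field_simps)
  also have "\<theta> / (m * rising_coeff \<theta> m) * \<dots> = \<theta> / (\<theta> + 1) * (real m - 1)"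
    using assms pos by simp
  also have "\<dots> \<le> \<theta> / (\<theta> + 1) * m" using assms by (intro mult_left_mono) auto
  finally show ?thesis .
qed

text \<open>The law of \<open>j / m\<close> with \<open>j\<close> drawn from \<open>first_cycle_prob \<theta> m\<close>, smeared out over an interval of
  length \<open>1 / m\<close> and moved to the left by \<open>i / m\<close>; the point \<open>w\<close> then stands for
  \<open>j = step_index m i w\<close>. Averaging over \<open>i\<close> turns a sum over \<open>j\<close> into averages over runs of
  consecutive \<open>j\<close>.\<close>

definition step_index :: "nat \<Rightarrow> nat \<Rightarrow> real \<Rightarrow> nat" where
  "step_index m i w = nat \<lceil>real m * w + real i\<rceil>"

definition step_density :: "real \<Rightarrow> nat \<Rightarrow> nat \<Rightarrow> real \<Rightarrow> real" where
  "step_density \<theta> m i w = (if step_index m i w \<in> {1..m}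
     then real m * first_cycle_prob \<theta> m (step_index m i w) else 0)"

lemma step_index_measurable [measurable]: "step_index m i \<in> measurable borel (count_space UNIV)"
  unfolding step_index_def
  by (rule measurable_compose[where g = nat and N = "count_space UNIV"]) measurable

lemma step_density_measurable [measurable]: "step_density \<theta> m i \<in> borel_measurable borel"
  unfolding step_density_def by (rule measurable_compose[OF step_index_measurable]) simp

lemma step_density_nonneg: "\<theta> > 0 \<Longrightarrow> step_density \<theta> m i w \<ge> 0"
  by (simp add: step_density_def first_cycle_prob_nonneg)

text \<open>Positivity of \<open>j\<close> matters: \<open>nat\<close> sends every nonpositive
  ceiling to 0.\<close>

lemma step_index_eq_iff:
  assumes "m > 0" "j > 0"
  shows "step_index m i w = j \<longleftrightarrow> w \<in> {(real j - 1 - real i) / m <.. (real j - real i) / m}"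
proof -
  have "step_index m i w = j \<longleftrightarrow> \<lceil>real m * w + real i\<rceil> = int j"
    using assms by (auto simp: step_index_def)
  also have "\<dots> \<longleftrightarrow> real j - 1 < real m * w + real i \<and> real m * w + real i \<le> real j"
    by (simp add: ceiling_eq_iff)
  also have "\<dots> \<longleftrightarrow> w \<in> {(real j - 1 - real i) / m <.. (real j - real i) / m}"
    using assms by (auto simp: field_simps)
  finally show ?thesis .
qed

text \<open>Every j owns an interval of length 1 / m, on which the density is m times its
  probability. The identity is exact for each shift \<open>i\<close>, so one and the same sum has
  many integral representations, and these can be averaged over \<open>i\<close>.\<close>

lemma has_integral_step_density:
  fixes b :: "nat \<Rightarrow> 'b::{banach, second_countable_topology}"
  shows "has_bochner_integral lborel (\<lambda>w. step_density \<theta> m i w *\<^sub>R b (step_index m i w))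
     (\<Sum>j=1..m. first_cycle_prob \<theta> m j *\<^sub>R b j)"
proof (cases "m = 0")
  case True
  then show ?thesis by (simp add: step_density_def has_bochner_integral_zero)
next
  case False
  let ?I = "\<lambda>j. {(real j - 1 - real i) / m <.. (real j - real i) / m}"
  have "has_bochner_integral lborel (\<lambda>w. \<Sum>j=1..m. indicator (?I j) w *\<^sub>R ((real m * first_cycle_prob \<theta> m j) *\<^sub>R b j))
      (\<Sum>j=1..m. measure lborel (?I j) *\<^sub>R ((real m * first_cycle_prob \<theta> m j) *\<^sub>R b j))"
    by (intro has_bochner_integral_sum has_bochner_integral_scaleR_left
        has_bochner_integral_real_indicator) (auto simp: emeasure_lborel_Ioc divide_right_mono)
  moreover have "(\<Sum>j=1..m. indicator (?I j) w *\<^sub>R ((real m * first_cycle_prob \<theta> m j) *\<^sub>R b j))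
      = step_density \<theta> m i w *\<^sub>R b (step_index m i w)" for w
  proof -
    have "(\<Sum>j=1..m. indicator (?I j) w *\<^sub>R ((real m * first_cycle_prob \<theta> m j) *\<^sub>R b j))
        = (\<Sum>j=1..m. if j = step_index m i w then (real m * first_cycle_prob \<theta> m j) *\<^sub>R b j else 0)"
    proof (intro sum.cong refl)
      fix j assume "j \<in> {1..m}"
      then have "w \<in> ?I j \<longleftrightarrow> step_index m i w = j"
        using False by (subst step_index_eq_iff) auto
      then show "indicator (?I j) w *\<^sub>R ((real m * first_cycle_prob \<theta> m j) *\<^sub>R b j)
          = (if j = step_index m i w then (real m * first_cycle_prob \<theta> m j) *\<^sub>R b j else 0)"
        by (auto simp: indicator_def)
    qed
    then show ?thesis by (simp add: step_density_def)
  qed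
  moreover have "measure lborel (?I j) *\<^sub>R ((real m * first_cycle_prob \<theta> m j) *\<^sub>R b j)
      = first_cycle_prob \<theta> m j *\<^sub>R b j" for j
    using False by (simp add: divide_right_mono flip: diff_divide_distrib)
  ultimately show ?thesis by (simp only:)
qed

lemma nn_integral_step_density_le:
  assumes "\<theta> > 0"
  shows "(\<integral>\<^sup>+w. ennreal (step_density \<theta> m i w) \<partial>lborel) \<le> 1"
proof -
  have "has_bochner_integral lborel (step_density \<theta> m i) (\<Sum>j=1..m. first_cycle_prob \<theta> m j)"
    using has_integral_step_density[of \<theta> m i "\<lambda>_. 1 :: real"] by simp
  then have "(\<integral>\<^sup>+w. ennreal (step_density \<theta> m i w) \<partial>lborel) = ennreal (\<Sum>j=1..m. first_cycle_prob \<theta> m j)"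
    using step_density_nonneg[OF assms]
    by (simp add: has_bochner_integral_iff nn_integral_eq_integral)
  also have "\<dots> \<le> 1"
    using sum_first_cycle_prob[OF assms] by (cases "m = 0") auto
  finally show ?thesis .
qed

lemma step_index_tendsto:
  fixes m i :: "nat \<Rightarrow> nat"
  assumes m: "filterlim m at_top sequentially" and i: "(\<lambda>n. real (i n) / real (m n)) \<longlonglongrightarrow> 0" and w: "w > 0"
  shows "(\<lambda>n. real (step_index (m n) (i n) w) / real (m n)) \<longlonglongrightarrow> w"
proof -
  have m_real: "filterlim (\<lambda>n. real (m n)) at_top sequentially"
    by (rule filterlim_compose[OF filterlim_real_sequentially m])
  have m_pos: "\<forall>\<^sub>F n in sequentially. m n > 0"
    by (rule eventually_compose_filterlim[OF eventually_gt_at_top m])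
  have inv: "(\<lambda>n. 1 / real (m n)) \<longlonglongrightarrow> 0"
    by (rule tendsto_divide_0[OF tendsto_const filterlim_at_top_imp_at_infinity[OF m_real]])
  have lower: "(\<lambda>n. w + real (i n) / real (m n)) \<longlonglongrightarrow> w"
    using tendsto_add[OF tendsto_const i] by simp
  have upper: "(\<lambda>n. w + real (i n) / real (m n) + 1 / real (m n)) \<longlonglongrightarrow> w"
    using tendsto_add[OF lower inv] by simp
  have bounds: "real (m n) * w + real (i n) \<le> real (step_index (m n) (i n) w)"
    "real (step_index (m n) (i n) w) \<le> real (m n) * w + real (i n) + 1" for n
  proof -
    have "real (m n) * w + real (i n) \<ge> 0" using w by simp
    then have "\<lceil>real (m n) * w + real (i n)\<rceil> \<ge> 0" by linarith
    then have "real (step_index (m n) (i n) w) = of_int \<lceil>real (m n) * w + real (i n)\<rceil>"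
      by (simp add: step_index_def)
    then show "real (m n) * w + real (i n) \<le> real (step_index (m n) (i n) w)"
      "real (step_index (m n) (i n) w) \<le> real (m n) * w + real (i n) + 1" by linarith+
  qed
  show ?thesis
  proof (rule tendsto_sandwich[OF _ _ lower upper])
    show "\<forall>\<^sub>F n in sequentially. w + real (i n) / real (m n) \<le> real (step_index (m n) (i n) w) / real (m n)"
      using m_pos
    proof eventually_elim
      case (elim n)
      then have "w + real (i n) / real (m n) = (real (m n) * w + real (i n)) / real (m n)"
        by (simp add: field_simps)
      then show ?case using bounds(1)[of n] by (simp only: divide_right_mono of_nat_0_le_iff)
    qed
    show "\<forall>\<^sub>F n in sequentially. real (step_index (m n) (i n) w) / real (m n) \<le> w + real (i n) / real (m n) + 1 / real (m n)"
      using m_pos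
    proof eventually_elim
      case (elim n)
      then have "w + real (i n) / real (m n) + 1 / real (m n) = (real (m n) * w + real (i n) + 1) / real (m n)"
        by (simp add: field_simps)
      then show ?case using bounds(2)[of n] by (simp only: divide_right_mono of_nat_0_le_iff)
    qed
  qed
qed

text \<open>Inside (0, 1) the density is \<theta> times a ratio of coefficients whose indices have
  the asymptotic ratio 1 - w. The endpoints form a null set; the asymptotics of the ratio require 1
  - w > 0.\<close>

lemma step_density_tendsto:
  fixes m i :: "nat \<Rightarrow> nat"
  assumes \<theta>: "\<theta> > 0" and m: "filterlim m at_top sequentially"
    and i: "(\<lambda>n. real (i n) / real (m n)) \<longlonglongrightarrow> 0" and w: "w \<noteq> 0" "w \<noteq> 1"
  shows "(\<lambda>n. step_density \<theta> (m n) (i n) w) \<longlonglongrightarrow> stick_density \<theta> w"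
proof -
  have m_pos: "\<forall>\<^sub>F n in sequentially. m n > 0"
    by (rule eventually_compose_filterlim[OF eventually_gt_at_top m])
  consider "w < 0" | "w > 1" | "0 < w" "w < 1" using w by linarith
  then show ?thesis
  proof cases
    case 1
    have "\<forall>\<^sub>F n in sequentially. real (i n) / real (m n) < - w"
      using order_tendstoD(2)[OF i, of "- w"] 1 by simp
    then have "\<forall>\<^sub>F n in sequentially. step_density \<theta> (m n) (i n) w = 0"
      using m_pos
    proof eventually_elim
      case (elim n)
      then have "real (m n) * w + real (i n) \<le> 0" by (simp add: field_simps)
      then have "step_index (m n) (i n) w = 0" by (simp add: step_index_def)
      then show ?case by (simp add: step_density_def)
    qed
    then show ?thesis using 1 by (simp add: stick_density_def tendsto_eventually)
  next
    case 2
    have "\<forall>\<^sub>F n in sequentially. 1 < real (step_index (m n) (i n) w) / real (m n)"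
      using order_tendstoD(1)[OF step_index_tendsto[OF m i], of w 1] 2 by simp
    then have "\<forall>\<^sub>F n in sequentially. step_density \<theta> (m n) (i n) w = 0"
      using m_pos by eventually_elim (simp add: step_density_def)
    then show ?thesis using 2 by (simp add: stick_density_def tendsto_eventually)
  next
    case 3
    let ?J = "\<lambda>n. step_index (m n) (i n) w"
    note lim = step_index_tendsto[OF m i 3(1)]
    have "\<forall>\<^sub>F n in sequentially. 0 < real (?J n) / real (m n)" "\<forall>\<^sub>F n in sequentially. real (?J n) / real (m n) < 1"
      using order_tendstoD[OF lim] 3 by auto
    then have ev: "\<forall>\<^sub>F n in sequentially. ?J n \<in> {1..m n}"
      using m_pos
    proof eventually_elim
      case (elim n)
      then show ?case by (cases "?J n = 0") auto
    qed
    have "(\<lambda>n. 1 - real (?J n) / real (m n)) \<longlonglongrightarrow> 1 - w" by (intro tendsto_intros lim)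
    moreover have "\<forall>\<^sub>F n in sequentially. 1 - real (?J n) / real (m n) = real (m n - ?J n) / real (m n)"
      using ev m_pos by eventually_elim (simp add: field_simps)
    ultimately have "(\<lambda>n. real (m n - ?J n) / real (m n)) \<longlonglongrightarrow> 1 - w" by (rule Lim_transform_eventually)
    then have "(\<lambda>n. \<theta> * (rising_coeff \<theta> (m n - ?J n) / rising_coeff \<theta> (m n))) \<longlonglongrightarrow> \<theta> * (1 - w) powr (\<theta> - 1)"
      using 3 by (intro tendsto_intros rising_coeff_ratio_tendsto \<theta> m) auto
    moreover have "\<forall>\<^sub>F n in sequentially. \<theta> * (rising_coeff \<theta> (m n - ?J n) / rising_coeff \<theta> (m n))
        = step_density \<theta> (m n) (i n) w"
      using ev m_pos by eventually_elim (simp add: step_density_def first_cycle_prob_def)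
    ultimately have "(\<lambda>n. step_density \<theta> (m n) (i n) w) \<longlonglongrightarrow> \<theta> * (1 - w) powr (\<theta> - 1)"
      by (rule Lim_transform_eventually)
    then show ?thesis using 3 by (simp add: stick_density_def)
  qed
qed

lemma integrable_step_density: "integrable lborel (step_density \<theta> m i)"
  using has_integral_step_density[of \<theta> m i "\<lambda>_. 1 :: real"] by (simp add: has_bochner_integral_iff)

lemma AE_lborel_neq: "AE w in lborel. w \<noteq> (c :: real)"
  by (rule AE_I'[of "{c}"]) auto

text \<open>Scheffe's lemma: the densities converge almost everywhere, have mass at most 1, and
  their limit has mass 1. This avoids a dominating function near w = 1, where the limit is unbounded
  for \<theta> < 1.\<close>

lemma step_density_L1:
  fixes m i :: "nat \<Rightarrow> nat"
  assumes \<theta>: "\<theta> > 0" and m: "filterlim m at_top sequentially" and i: "(\<lambda>n. real (i n) / real (m n)) \<longlonglongrightarrow> 0"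
  shows "(\<lambda>n. \<integral>w. \<bar>step_density \<theta> (m n) (i n) w - stick_density \<theta> w\<bar> \<partial>lborel) \<longlonglongrightarrow> 0"
proof -
  have "(\<lambda>n. \<integral>\<^sup>+ w. norm (step_density \<theta> (m n) (i n) w - stick_density \<theta> w) \<partial>lborel) \<longlonglongrightarrow> 0"
  proof (rule Scheffe_lemma2)
    show "AE w in lborel. (\<lambda>n. step_density \<theta> (m n) (i n) w) \<longlonglongrightarrow> stick_density \<theta> w"
      using AE_lborel_neq[of 0] AE_lborel_neq[of 1]
      by eventually_elim (rule step_density_tendsto[OF \<theta> m i])
    show "(\<integral>\<^sup>+ w. norm (step_density \<theta> (m n) (i n) w) \<partial>lborel) \<le> (\<integral>\<^sup>+ w. norm (stick_density \<theta> w) \<partial>lborel)" for n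
      using nn_integral_step_density_le[OF \<theta>, of "m n" "i n"] nn_integral_stick_density[OF \<theta>]
        step_density_nonneg[OF \<theta>] stick_density_nonneg[OF \<theta>] by simp
  qed (simp_all add: integrable_stick_density[OF \<theta>])
  moreover have "(\<integral>\<^sup>+ w. norm (step_density \<theta> (m n) (i n) w - stick_density \<theta> w) \<partial>lborel)
      = ennreal (\<integral>w. \<bar>step_density \<theta> (m n) (i n) w - stick_density \<theta> w\<bar> \<partial>lborel)" for n
    using integrable_step_density integrable_stick_density[OF \<theta>]
    by (subst nn_integral_eq_integral) auto
  ultimately have "(\<lambda>n. ennreal (\<integral>w. \<bar>step_density \<theta> (m n) (i n) w - stick_density \<theta> w\<bar> \<partial>lborel)) \<longlonglongrightarrow> ennreal 0"
    by simp
  then show ?thesis by (rule tendsto_ennrealD) (simp_all add: integral_nonneg_AE)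
qed

text \<open>Convergence along every choice of indices is uniform convergence: the choice that
  maximises the norm bounds the whole average.\<close>

lemma average_tendsto_0:
  fixes x :: "nat \<Rightarrow> nat \<Rightarrow> 'b::real_normed_field"
  assumes N: "\<And>n. N n > 0" and lim: "\<And>i. (\<And>n. i n < N n) \<Longrightarrow> (\<lambda>n. x n (i n)) \<longlonglongrightarrow> 0"
  shows "(\<lambda>n. (\<Sum>i<N n. x n i) / of_nat (N n)) \<longlonglongrightarrow> 0"
proof -
  have "\<exists>i<N n. \<forall>k<N n. norm (x n k) \<le> norm (x n i)" for n
  proof -
    let ?X = "(\<lambda>k. norm (x n k)) ` {..<N n}"
    have fin: "finite ?X" "?X \<noteq> {}" using N[of n] by auto
    obtain i where "i < N n" "norm (x n i) = Max ?X"
      using Max_in[OF fin] by auto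
    moreover have "norm (x n k) \<le> Max ?X" if "k < N n" for k
      using that by (intro Max_ge[OF fin(1)]) auto
    ultimately show ?thesis by (intro exI[of _ i]) simp
  qed
  then obtain i where i: "\<And>n. i n < N n" "\<And>n k. k < N n \<Longrightarrow> norm (x n k) \<le> norm (x n (i n))" by metis
  have "norm ((\<Sum>i<N n. x n i) / of_nat (N n)) \<le> norm (x n (i n))" for n
  proof -
    have "norm (\<Sum>k<N n. x n k) \<le> (\<Sum>k<N n. norm (x n (i n)))" using i(2) by (intro sum_norm_le) auto
    then show ?thesis using N[of n] by (simp add: norm_divide pos_divide_le_eq mult.commute)
  qed
  then show ?thesis
    by (rule Lim_null_comparison[OF always_eventually[OF allI] tendsto_norm_zero[OF lim[OF i(1)]]])
qed

text \<open>The terms \<open>b n j\<close> need not converge, only their averages over runs of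
  \<open>N n\<close> consecutive indices. Averaging the shifted integral representations of the sum,
  and replacing each step density by the stick density at a cost measured in L1, brings exactly
  these run averages under a fixed integral, to which dominated convergence applies.\<close>

lemma first_cycle_sum_tendsto:
  fixes b :: "nat \<Rightarrow> nat \<Rightarrow> complex"
  assumes \<theta>: "\<theta> > 0" and m: "filterlim m at_top sequentially"
    and N: "\<And>n. N n > 0" "(\<lambda>n. real (N n) / real (m n)) \<longlonglongrightarrow> 0"
    and b: "\<And>n j. norm (b n j) \<le> 1" and B: "B \<in> borel_measurable borel"
    and lim: "AE w in lborel. 0 < w \<and> w < 1 \<longrightarrow>
      (\<lambda>n. (\<Sum>i<N n. b n (step_index (m n) i w)) / of_nat (N n)) \<longlonglongrightarrow> B w"
  shows "(\<lambda>n. \<Sum>j=1..m n. first_cycle_prob \<theta> (m n) j *\<^sub>R b n j) \<longlonglongrightarrow> (\<integral>w. B w \<partial>stick_law \<theta>)"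
proof -
  define avg where "avg = (\<lambda>n w. (\<Sum>i<N n. b n (step_index (m n) i w)) / of_nat (N n))"
  have avg_meas [measurable]: "avg n \<in> borel_measurable borel" for n
    unfolding avg_def by measurable
  have avg_le: "norm (avg n w) \<le> 1" for n w
  proof -
    have "norm (\<Sum>i<N n. b n (step_index (m n) i w)) \<le> (\<Sum>i<N n. 1)" using b by (intro sum_norm_le) auto
    then show ?thesis using N(1)[of n] by (simp add: avg_def norm_divide field_simps)
  qed
  have "(\<lambda>n. \<integral>w. stick_density \<theta> w *\<^sub>R avg n w \<partial>lborel) \<longlonglongrightarrow> (\<integral>w. stick_density \<theta> w *\<^sub>R B w \<partial>lborel)"
  proof (rule integral_dominated_convergence[where w = "stick_density \<theta>"])
    show "AE w in lborel. (\<lambda>n. stick_density \<theta> w *\<^sub>R avg n w) \<longlonglongrightarrow> stick_density \<theta> w *\<^sub>R B w"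
      using lim AE_lborel_neq[of 0] AE_lborel_neq[of 1]
    proof eventually_elim
      case (elim w)
      show ?case
      proof (cases "0 < w \<and> w < 1")
        case True
        then show ?thesis using elim by (intro tendsto_intros) (simp add: avg_def)
      qed (use elim in \<open>auto simp: stick_density_def\<close>)
    qed
    show "AE w in lborel. norm (stick_density \<theta> w *\<^sub>R avg n w) \<le> stick_density \<theta> w" for n
      using stick_density_nonneg[OF \<theta>] avg_le by (intro AE_I2) (simp add: mult_left_le)
  qed (use B integrable_stick_density[OF \<theta>] in auto)
  then have main: "(\<lambda>n. \<integral>w. stick_density \<theta> w *\<^sub>R avg n w \<partial>lborel) \<longlonglongrightarrow> (\<integral>w. B w \<partial>stick_law \<theta>)"
    using integral_stick_law[OF \<theta> B] by simp
  define L where "L = (\<lambda>n i. \<integral>w. \<bar>step_density \<theta> (m n) i w - stick_density \<theta> w\<bar> \<partial>lborel)"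
  have lim_L: "(\<lambda>n. (\<Sum>i<N n. L n i) / of_nat (N n)) \<longlonglongrightarrow> 0"
  proof (rule average_tendsto_0[OF N(1)])
    fix i :: "nat \<Rightarrow> nat" assume i: "\<And>n. i n < N n"
    have "(\<lambda>n. real (i n) / real (m n)) \<longlonglongrightarrow> 0"
      by (rule tendsto_sandwich[OF _ _ tendsto_const N(2)])
         (use i in \<open>auto intro!: always_eventually divide_right_mono simp: less_imp_le\<close>)
    then show "(\<lambda>n. L n (i n)) \<longlonglongrightarrow> 0" unfolding L_def by (rule step_density_L1[OF \<theta> m])
  qed
  have bound: "norm ((\<Sum>j=1..m n. first_cycle_prob \<theta> (m n) j *\<^sub>R b n j) - (\<integral>w. stick_density \<theta> w *\<^sub>R avg n w \<partial>lborel))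
      \<le> (\<Sum>i<N n. L n i) / of_nat (N n)" for n
  proof -
    let ?T = "\<Sum>j=1..m n. first_cycle_prob \<theta> (m n) j *\<^sub>R b n j"
    let ?b = "\<lambda>i w. b n (step_index (m n) i w)"
    have int_b: "integrable lborel (\<lambda>w. stick_density \<theta> w *\<^sub>R ?b i w)" for i
      by (rule Bochner_Integration.integrable_bound[OF integrable_stick_density[OF \<theta>]])
         (use b stick_density_nonneg[OF \<theta>] in \<open>auto simp: mult_left_le\<close>)
    have each: "norm (?T - (\<integral>w. stick_density \<theta> w *\<^sub>R ?b i w \<partial>lborel)) \<le> L n i" for i
    proof -
      note T = has_integral_step_density[of \<theta> "m n" i "b n"]
      have "?T - (\<integral>w. stick_density \<theta> w *\<^sub>R ?b i w \<partial>lborel)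
          = (\<integral>w. (step_density \<theta> (m n) i w - stick_density \<theta> w) *\<^sub>R ?b i w \<partial>lborel)"
        using T int_b[of i] by (simp add: has_bochner_integral_iff scaleR_diff_left)
      also have "norm \<dots> \<le> L n i"
        unfolding L_def
      proof (rule Bochner_Integration.integral_norm_bound_integral)
        show "integrable lborel (\<lambda>w. (step_density \<theta> (m n) i w - stick_density \<theta> w) *\<^sub>R ?b i w)"
          using T int_b[of i] by (simp add: has_bochner_integral_iff scaleR_diff_left)
        show "integrable lborel (\<lambda>w. \<bar>step_density \<theta> (m n) i w - stick_density \<theta> w\<bar>)"
          by (intro integrable_abs Bochner_Integration.integrable_diff integrable_step_density integrable_stick_density \<theta>)
        show "norm ((step_density \<theta> (m n) i w - stick_density \<theta> w) *\<^sub>R ?b i w)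
            \<le> \<bar>step_density \<theta> (m n) i w - stick_density \<theta> w\<bar>" for w
          using b by (simp add: mult_left_le)
      qed
      finally show ?thesis .
    qed
    have "(\<integral>w. stick_density \<theta> w *\<^sub>R avg n w \<partial>lborel)
        = (\<integral>w. (\<Sum>i<N n. stick_density \<theta> w *\<^sub>R ?b i w) / of_nat (N n) \<partial>lborel)"
      by (intro Bochner_Integration.integral_cong refl) (simp add: avg_def scaleR_sum_right scaleR_conv_of_real sum_distrib_left)
    also have "\<dots> = (\<Sum>i<N n. \<integral>w. stick_density \<theta> w *\<^sub>R ?b i w \<partial>lborel) / of_nat (N n)"
      using int_b by simp
    finally have avg: "(\<integral>w. stick_density \<theta> w *\<^sub>R avg n w \<partial>lborel)
        = (\<Sum>i<N n. \<integral>w. stick_density \<theta> w *\<^sub>R ?b i w \<partial>lborel) / of_nat (N n)" .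
    have diff: "T - (\<Sum>i<N n. a i) / of_nat (N n) = (\<Sum>i<N n. T - a i) / of_nat (N n)" for T and a :: "nat \<Rightarrow> complex"
      using N(1)[of n] by (simp add: sum_subtractf diff_divide_distrib)
    have "norm (?T - (\<integral>w. stick_density \<theta> w *\<^sub>R avg n w \<partial>lborel))
        = norm (\<Sum>i<N n. ?T - (\<integral>w. stick_density \<theta> w *\<^sub>R ?b i w \<partial>lborel)) / real (N n)"
      by (simp only: avg diff norm_divide norm_of_nat)
    also have "\<dots> \<le> (\<Sum>i<N n. L n i) / of_nat (N n)"
      by (rule divide_right_mono[OF sum_norm_le[OF each]]) simp
    finally show ?thesis .
  qed
  have "(\<lambda>n. (\<Sum>j=1..m n. first_cycle_prob \<theta> (m n) j *\<^sub>R b n j) - (\<integral>w. stick_density \<theta> w *\<^sub>R avg n w \<partial>lborel)) \<longlonglongrightarrow> 0"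
    by (rule Lim_null_comparison[OF always_eventually[OF allI[OF bound]] lim_L])
  from tendsto_add[OF this main] show ?thesis by (simp only: diff_add_cancel add_0)
qed

text \<open>The mean of the product of \<open>g\<close> over the first \<open>k\<close> cycles when
  the cycles of marked elements are removed one after the other; all later cycles count as
  1.\<close>

primrec truncated_cycle_mean :: "real \<Rightarrow> (nat \<Rightarrow> complex) \<Rightarrow> nat \<Rightarrow> nat \<Rightarrow> complex" where
  "truncated_cycle_mean \<theta> g 0 m = 1"
| "truncated_cycle_mean \<theta> g (Suc k) m = (if m = 0 then 1 else
     \<Sum>j=1..m. first_cycle_prob \<theta> m j *\<^sub>R (g j * truncated_cycle_mean \<theta> g k (m - j)))"

text \<open>The continuous counterpart: \<open>x\<close> is the length still unbroken, of which the
  fraction \<open>w\<close> is broken off next.\<close>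

primrec stick_mean :: "real \<Rightarrow> (real \<Rightarrow> complex) \<Rightarrow> nat \<Rightarrow> real \<Rightarrow> complex" where
  "stick_mean \<theta> \<phi> 0 x = 1"
| "stick_mean \<theta> \<phi> (Suc k) x = (\<integral>w. \<phi> (x * w) * stick_mean \<theta> \<phi> k (x * (1 - w)) \<partial>stick_law \<theta>)"

text \<open>By \<open>ewens_cycle_prod\<close> this is the Ewens mean of the product of
  \<open>g\<close> over all cycles. Unlike that mean it satisfies a recursion in m for a fixed
  \<open>g\<close>, even when \<open>g\<close> itself depends on the original n.\<close>

definition cycle_mean :: "real \<Rightarrow> (nat \<Rightarrow> complex) \<Rightarrow> nat \<Rightarrow> complex" where
  "cycle_mean \<theta> g m = cycle_coeff (\<lambda>j. of_real \<theta> * g j) m / of_real (rising_coeff \<theta> m)"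

lemma cycle_mean_0 [simp]: "cycle_mean \<theta> g 0 = 1"
  by (simp add: cycle_mean_def)

lemma cycle_mean_rec:
  assumes "\<theta> > 0" "m > 0"
  shows "cycle_mean \<theta> g m = (\<Sum>j=1..m. first_cycle_prob \<theta> m j *\<^sub>R (g j * cycle_mean \<theta> g (m - j)))"
proof -
  let ?c = "cycle_coeff (\<lambda>j. of_real \<theta> * g j)"
  have pos: "rising_coeff \<theta> i > 0" for i using assms rising_coeff_pos by auto
  have "of_nat m * ?c m = (\<Sum>j=1..m. of_real \<theta> * g j * ?c (m - j))"
    by (rule cycle_coeff_rec)
  moreover have "cycle_mean \<theta> g m = of_nat m * ?c m / (of_nat m * of_real (rising_coeff \<theta> m))"
    using assms by (simp add: cycle_mean_def)
  ultimately have "cycle_mean \<theta> g m = (\<Sum>j=1..m. of_real \<theta> * g j * ?c (m - j)) / (of_nat m * of_real (rising_coeff \<theta> m))"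
    by (simp only:)
  also have "\<dots> = (\<Sum>j=1..m. first_cycle_prob \<theta> m j *\<^sub>R (g j * cycle_mean \<theta> g (m - j)))"
    unfolding sum_divide_distrib
  proof (intro sum.cong refl)
    fix j
    have "of_real (rising_coeff \<theta> (m - j)) \<noteq> (0 :: complex)" using pos[of "m - j"] by simp
    then show "of_real \<theta> * g j * ?c (m - j) / (of_nat m * of_real (rising_coeff \<theta> m))
        = first_cycle_prob \<theta> m j *\<^sub>R (g j * cycle_mean \<theta> g (m - j))"
      by (simp add: scaleR_conv_of_real first_cycle_prob_def cycle_mean_def)
  qed
  finally show ?thesis .
qed

lemma norm_first_cycle_sum_le:
  assumes "\<theta> > 0" "m > 0" "\<And>j. j \<in> {1..m} \<Longrightarrow> norm (b j) \<le> c j"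
  shows "norm (\<Sum>j=1..m. first_cycle_prob \<theta> m j *\<^sub>R b j) \<le> (\<Sum>j=1..m. first_cycle_prob \<theta> m j * c j)"
  using assms first_cycle_prob_nonneg[OF assms(1), of m]
  by (intro sum_norm_le) (simp add: mult_left_mono)

lemma norm_first_cycle_sum_le_1:
  assumes "\<theta> > 0" "m > 0" "\<And>j. j \<in> {1..m} \<Longrightarrow> norm (b j) \<le> 1"
  shows "norm (\<Sum>j=1..m. first_cycle_prob \<theta> m j *\<^sub>R b j) \<le> 1"
  using norm_first_cycle_sum_le[OF assms(1,2), of b "\<lambda>_. 1"] assms(3) sum_first_cycle_prob[OF assms(1,2)]
  by simp

lemma norm_truncated_cycle_mean_le:
  assumes "\<theta> > 0" "\<And>j. norm (g j) \<le> 1"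
  shows "norm (truncated_cycle_mean \<theta> g k m) \<le> 1"
proof (induction k arbitrary: m)
  case (Suc k)
  show ?case
  proof (cases "m = 0")
    case False
    have "norm (g j * truncated_cycle_mean \<theta> g k (m - j)) \<le> 1" for j
      using assms(2)[of j] Suc[of "m - j"] by (simp add: norm_mult mult_le_one)
    then have "norm (\<Sum>j=1..m. first_cycle_prob \<theta> m j *\<^sub>R (g j * truncated_cycle_mean \<theta> g k (m - j))) \<le> 1"
      using False by (intro norm_first_cycle_sum_le_1 assms) auto
    then show ?thesis using False by simp
  qed simp
qed simp

lemma norm_cycle_mean_le:
  assumes "\<theta> > 0" "\<And>j. norm (g j) \<le> 1"
  shows "norm (cycle_mean \<theta> g m) \<le> 1"
proof (induction m rule: less_induct)
  case (less m)
  show ?case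
  proof (cases "m = 0")
    case False
    have "norm (g j * cycle_mean \<theta> g (m - j)) \<le> 1" if "j \<in> {1..m}" for j
      using assms(2)[of j] less[of "m - j"] that by (simp add: norm_mult mult_le_one)
    then have "norm (\<Sum>j=1..m. first_cycle_prob \<theta> m j *\<^sub>R (g j * cycle_mean \<theta> g (m - j))) \<le> 1"
      using False by (intro norm_first_cycle_sum_le_1 assms) auto
    then show ?thesis using False by (subst cycle_mean_rec[OF assms(1)]) auto
  qed simp
qed

lemma cycle_mean_eq_1:
  assumes "\<theta> > 0" "\<And>j. j \<le> m \<Longrightarrow> g j = 1"
  shows "cycle_mean \<theta> g m = 1"
  using assms(2)
proof (induction m rule: less_induct)
  case (less m)
  show ?case
  proof (cases "m = 0")
    case False
    then have "cycle_mean \<theta> g m = (\<Sum>j=1..m. first_cycle_prob \<theta> m j *\<^sub>R 1)"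
      using less by (subst cycle_mean_rec[OF assms(1)]) (auto intro!: sum.cong)
    also have "\<dots> = of_real (\<Sum>j=1..m. first_cycle_prob \<theta> m j)"
      by (simp add: scaleR_conv_of_real)
    also have "(\<Sum>j=1..m. first_cycle_prob \<theta> m j) = 1"
      using False by (intro sum_first_cycle_prob assms(1)) simp
    finally show ?thesis by simp
  qed simp
qed

text \<open>Stopping after \<open>k\<close> cycles only matters if more than \<open>D\<close> elements remain; the mean number of
  remaining elements decreases geometrically.\<close>

lemma cycle_mean_truncation:
  assumes \<theta>: "\<theta> > 0" and g: "\<And>j. norm (g j) \<le> 1" and D: "D > 0" and small: "\<And>j. real j \<le> D \<Longrightarrow> g j = 1"
  shows "norm (cycle_mean \<theta> g m - truncated_cycle_mean \<theta> g k m) \<le> 2 / D * (\<theta> / (\<theta> + 1)) ^ k * m"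
proof (induction k arbitrary: m)
  case 0
  show ?case
  proof (cases "real m \<le> D")
    case True
    then have "cycle_mean \<theta> g m = 1" by (intro cycle_mean_eq_1 \<theta> small) simp
    then show ?thesis using D by simp
  next
    case False
    \<comment> \<open>The trivial distance 2 of two numbers of norm at most 1 is the origin of the
      factor 2 / D.\<close>
    then have "2 \<le> 2 / D * m" using D by (simp add: field_simps)
    moreover have "norm (cycle_mean \<theta> g m - 1) \<le> 2"
      using norm_triangle_ineq4[of "cycle_mean \<theta> g m" 1] norm_cycle_mean_le[of \<theta> g m, OF \<theta> g] by simp
    ultimately show ?thesis by simp
  qed
next
  case (Suc k)
  show ?case
  proof (cases "m = 0")
    case False
    let ?d = "\<lambda>j. cycle_mean \<theta> g (m - j) - truncated_cycle_mean \<theta> g k (m - j)"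
    let ?C = "2 / D * (\<theta> / (\<theta> + 1)) ^ k"
    have "cycle_mean \<theta> g m - truncated_cycle_mean \<theta> g (Suc k) m
        = (\<Sum>j=1..m. first_cycle_prob \<theta> m j *\<^sub>R (g j * ?d j))"
      using False \<theta> by (simp add: cycle_mean_rec sum_subtractf algebra_simps)
    also have "norm \<dots> \<le> (\<Sum>j=1..m. first_cycle_prob \<theta> m j * (?C * real (m - j)))"
    proof (rule norm_first_cycle_sum_le[OF \<theta>])
      fix j
      have "norm (g j) * norm (?d j) \<le> 1 * (?C * real (m - j))"
        using g Suc[of "m - j"] by (intro mult_mono) auto
      then show "norm (g j * ?d j) \<le> ?C * real (m - j)" by (simp add: norm_mult)
    qed (use False in auto)
    also have "\<dots> = ?C * (\<Sum>j=1..m. first_cycle_prob \<theta> m j * real (m - j))"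
      by (simp add: sum_distrib_left mult_ac)
    also have "\<dots> \<le> ?C * (\<theta> / (\<theta> + 1) * m)"
      using D \<theta> False by (intro mult_left_mono mean_first_cycle_prob) auto
    finally show ?thesis by (simp add: mult_ac)
  qed simp
qed

section \<open>Uniform marks, and cycle weights that depend on a rotating phase\<close>

abbreviation unit_uniform :: "real measure" where
  "unit_uniform \<equiv> uniform_measure lborel {0..1}"

lemma prob_space_unit_uniform: "prob_space unit_uniform"
  by (rule prob_space_uniform_measure) auto

lemma unit_uniform_eq_density: "unit_uniform = density lborel (\<lambda>u. ennreal (indicator {0..1} u))"
  unfolding uniform_measure_def
  by (intro arg_cong2[where f = density] refl ext) (auto simp: indicator_def divide_ennreal_def)

lemma integral_unit_uniform:
  fixes f :: "real \<Rightarrow> complex"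
  assumes "continuous_on UNIV f"
  shows "(\<integral>u. f u \<partial>unit_uniform) = integral {0..1} f"
proof -
  have cont: "continuous_on {0..1} f" using assms continuous_on_subset by blast
  have [measurable]: "f \<in> borel_measurable borel" by (rule borel_measurable_continuous_onI[OF assms])
  have "(\<integral>u. f u \<partial>unit_uniform) = (\<integral>u. indicator {0..1} u *\<^sub>R f u \<partial>lborel)"
    unfolding unit_uniform_eq_density by (rule integral_density) auto
  also have "\<dots> = integral {0..1} f"
    using set_borel_integral_eq_integral(2)[of "{0..1}" f] borel_integrable_atLeastAtMost'[OF cont]
    by (simp add: set_lebesgue_integral_def)
  finally show ?thesis .
qed

text \<open>Here \<gamma> u y is the factor of a cycle with phase u and relative length y.
  Continuity in y has to be uniform in the phase, which moves with n; arbitrary sequences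
  \<open>s\<close> express this. The length \<delta> is exempt because the kernels used later jump
  there, and a single value of y has probability zero.\<close>

locale rotation_kernel =
  fixes \<theta> \<alpha> \<delta> :: real and \<gamma> :: "real \<Rightarrow> real \<Rightarrow> complex"
  assumes \<theta>: "\<theta> > 0" and \<alpha>: "\<alpha> \<notin> \<rat>"
    and norm_\<gamma>: "\<And>u y. norm (\<gamma> u y) \<le> 1"
    and periodic: "\<And>u y. \<gamma> (u + 1) y = \<gamma> u y"
    and cont: "\<And>y. 0 < y \<Longrightarrow> y \<le> 1 \<Longrightarrow> y \<noteq> \<delta> \<Longrightarrow> continuous_on UNIV (\<lambda>u. \<gamma> u y)"
    and uniform: "\<And>y s r. 0 < y \<Longrightarrow> y \<le> 1 \<Longrightarrow> y \<noteq> \<delta> \<Longrightarrow> r \<longlonglongrightarrow> y \<Longrightarrow>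
          (\<lambda>n::nat. \<gamma> (s n) (r n) - \<gamma> (s n) y) \<longlonglongrightarrow> 0"
    and \<gamma>_measurable [measurable]: "(\<lambda>(u, y). \<gamma> u y) \<in> borel_measurable (borel \<Otimes>\<^sub>M borel)"
begin

definition \<phi> :: "real \<Rightarrow> complex" where
  "\<phi> y = (\<integral>u. \<gamma> u y \<partial>unit_uniform)"

definition g :: "nat \<Rightarrow> nat \<Rightarrow> complex" where
  "g n j = \<gamma> (- (real j * \<alpha>)) (real j / real n)"

lemma norm_g: "norm (g n j) \<le> 1"
  by (simp add: g_def norm_\<gamma>)

lemma \<phi>_measurable [measurable]: "\<phi> \<in> borel_measurable borel"
proof -
  interpret prob_space unit_uniform by (rule prob_space_unit_uniform)
  have "(\<lambda>(y, u). \<gamma> u y) \<in> borel_measurable (borel \<Otimes>\<^sub>M unit_uniform)"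
    using measurable_compose[OF _ \<gamma>_measurable, of "\<lambda>(y, u). (u, y)" "borel \<Otimes>\<^sub>M unit_uniform"]
    by (simp add: split_beta')
  then show ?thesis unfolding \<phi>_def by (rule borel_measurable_lebesgue_integral)
qed

lemma norm_\<phi>: "norm (\<phi> y) \<le> 1"
proof -
  interpret prob_space unit_uniform by (rule prob_space_unit_uniform)
  have "norm (\<phi> y) \<le> (\<integral>u. 1 \<partial>unit_uniform)"
    unfolding \<phi>_def using norm_\<gamma>
    by (intro order_trans[OF integral_norm_bound] integral_mono_AE') auto
  then show ?thesis by (simp add: prob_space)
qed

lemma stick_mean_measurable [measurable]: "stick_mean \<theta> \<phi> k \<in> borel_measurable borel"
proof (induction k)
  case (Suc k)
  note [measurable] = Suc
  interpret prob_space "stick_law \<theta>" by (rule prob_space_stick_law[OF \<theta>])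
  have [measurable_cong]: "sets (stick_law \<theta>) = sets borel" by (simp add: stick_law_def)
  show ?case unfolding stick_mean.simps
    by (rule borel_measurable_lebesgue_integral) measurable
qed (simp add: stick_mean.simps(1)[abs_def])

text \<open>The starting index \<open>k n\<close> is arbitrary, which is why
  \<open>rotation_equidistribution\<close> is uniform in the starting point.\<close>

lemma average_along_run:
  assumes y: "0 < y" "y \<le> 1" "y \<noteq> \<delta>" and N: "filterlim N at_top sequentially"
  shows "(\<lambda>n. (\<Sum>i<N n. \<gamma> (- (real (k n + i) * \<alpha>)) y) / of_nat (N n)) \<longlonglongrightarrow> \<phi> y"
proof (rule LIMSEQ_I)
  fix e :: real assume e: "e > 0"
  have "- \<alpha> \<notin> \<rat>" using \<alpha> by simp
  then have "\<exists>N0. \<forall>N\<ge>N0. \<forall>s.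
      norm ((\<Sum>i<N. \<gamma> (s + real i * (- \<alpha>)) y) / of_nat N - integral {0..1} (\<lambda>u. \<gamma> u y)) \<le> e / 2"
    by (rule rotation_equidistribution[OF _ periodic cont[OF y] norm_\<gamma>]) (use e in simp)
  then obtain N0 where N0: "\<And>N s. N \<ge> N0 \<Longrightarrow>
      norm ((\<Sum>i<N. \<gamma> (s + real i * (- \<alpha>)) y) / of_nat N - integral {0..1} (\<lambda>u. \<gamma> u y)) \<le> e / 2"
    by blast
  obtain n0 where n0: "\<And>n. n \<ge> n0 \<Longrightarrow> N n \<ge> N0"
    using N unfolding filterlim_at_top eventually_sequentially by blast
  have "norm ((\<Sum>i<N n. \<gamma> (- (real (k n + i) * \<alpha>)) y) / of_nat (N n) - \<phi> y) < e" if "n \<ge> n0" for n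
  proof -
    have "- (real (k n + i) * \<alpha>) = - (real (k n) * \<alpha>) + real i * (- \<alpha>)" for i
      by (simp add: algebra_simps)
    then show ?thesis
      using N0[OF n0[OF that], of "- (real (k n) * \<alpha>)"] e integral_unit_uniform[OF cont[OF y]]
      by (simp only: \<phi>_def)
  qed
  then show "\<exists>n0. \<forall>n\<ge>n0. norm ((\<Sum>i<N n. \<gamma> (- (real (k n + i) * \<alpha>)) y) / of_nat (N n) - \<phi> y) < e" by blast
qed

text \<open>Induction on the number of cycles, for all sequences \<open>m\<close> at once. Along a
  run the relative length tends to y = x w and the relative size of the rest to z = x (1 - w), so
  only the phase still varies; its average turns the kernel into \<phi> y, and the induction
  hypothesis handles the rest.\<close>

lemma truncated_cycle_mean_tendsto:
  assumes "\<And>n. m n \<le> n" "(\<lambda>n. real (m n) / real n) \<longlonglongrightarrow> x" "0 < x" "x \<le> 1"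
  shows "(\<lambda>n. truncated_cycle_mean \<theta> (g n) k (m n)) \<longlonglongrightarrow> stick_mean \<theta> \<phi> k x"
  using assms
proof (induction k arbitrary: m x)
  case (Suc k)
  note mn = Suc.prems(1,2) and x = Suc.prems(3,4)
  let ?G = "\<lambda>n. truncated_cycle_mean \<theta> (g n) k"
  have "filterlim (\<lambda>n. real (m n) / real n * real n) at_top sequentially"
    by (rule filterlim_tendsto_pos_mult_at_top[OF mn(2) x(1) filterlim_real_sequentially])
  moreover have "\<forall>\<^sub>F n in sequentially. real (m n) / real n * real n = real (m n)"
    using eventually_gt_at_top[of 0] by eventually_elim simp
  ultimately have m_real: "filterlim (\<lambda>n. real (m n)) at_top sequentially"
    by (rule filterlim_mono_eventually[OF _ order_refl order_refl])
  then have m: "filterlim m at_top sequentially"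
    by (simp add: filterlim_sequentially_iff_filterlim_real)
  have m_pos: "\<forall>\<^sub>F n in sequentially. m n > 0"
    by (rule eventually_compose_filterlim[OF eventually_gt_at_top m])
  \<comment> \<open>The run length: unbounded, but negligible against \<open>m n\<close>. The
    successor keeps it positive.\<close>
  define N where "N = (\<lambda>n. Suc (nat \<lfloor>sqrt (real (m n))\<rfloor>))"
  have N_pos: "N n > 0" for n by (simp add: N_def)
  have "filterlim (\<lambda>k::nat. Suc (nat \<lfloor>sqrt (real k)\<rfloor>)) at_top sequentially"
    by real_asymp
  then have N_top: "filterlim N at_top sequentially"
    unfolding N_def by (rule filterlim_compose[OF _ m])
  have "(\<lambda>k::nat. real (Suc (nat \<lfloor>sqrt (real k)\<rfloor>)) / real k) \<longlonglongrightarrow> 0"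
    by real_asymp
  then have N_small: "(\<lambda>n. real (N n) / real (m n)) \<longlonglongrightarrow> 0"
    unfolding N_def by (rule filterlim_compose[OF _ m])
  define b where "b = (\<lambda>n j. g n j * ?G n (m n - j))"
  define B where "B = (\<lambda>w. \<phi> (x * w) * stick_mean \<theta> \<phi> k (x * (1 - w)))"
  have "(\<lambda>n. \<Sum>j=1..m n. first_cycle_prob \<theta> (m n) j *\<^sub>R b n j) \<longlonglongrightarrow> (\<integral>w. B w \<partial>stick_law \<theta>)"
  proof (rule first_cycle_sum_tendsto[OF \<theta> m N_pos N_small])
    show "norm (b n j) \<le> 1" for n j
      unfolding b_def norm_mult
      by (intro mult_le_one norm_g norm_ge_zero norm_truncated_cycle_mean_le \<theta>)
    show "B \<in> borel_measurable borel" unfolding B_def by measurable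
    show "AE w in lborel. 0 < w \<and> w < 1 \<longrightarrow>
      (\<lambda>n. (\<Sum>i<N n. b n (step_index (m n) i w)) / of_nat (N n)) \<longlonglongrightarrow> B w"
      \<comment> \<open>Only this w makes the limiting length y = x w hit the exempt value
        \<delta>.\<close>
      using AE_lborel_neq[of "\<delta> / x"]
    proof eventually_elim
      case (elim w)
      show ?case
      proof (rule impI)
        assume w: "0 < w \<and> w < 1"
        define y where "y = x * w"
        have y: "0 < y" "y \<le> 1" "y \<noteq> \<delta>"
        proof -
          show "0 < y" using w x by (simp add: y_def)
          show "y \<le> 1" unfolding y_def using w x by (intro mult_le_one) auto
          show "y \<noteq> \<delta>"
          proof
            assume "y = \<delta>"
            then have "w = \<delta> / x" using x by (auto simp: y_def)
            then show False using elim by simp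
          qed
        qed
        define z where "z = x * (1 - w)"
        have z: "0 < z" "z \<le> 1"
        proof -
          show "0 < z" using w x by (simp add: z_def)
          show "z \<le> 1" unfolding z_def using w x by (intro mult_le_one) auto
        qed
        let ?J = "\<lambda>n i. step_index (m n) i w"
        let ?G' = "stick_mean \<theta> \<phi> k z"
        let ?a = "\<lambda>n i. \<gamma> (- (real (?J n i) * \<alpha>)) y"
        \<comment> \<open>Length and remaining factor are replaced by their limits, while the phase
          is kept.\<close>
        have "(\<lambda>n. (\<Sum>i<N n. b n (?J n i) - ?a n i * ?G') / of_nat (N n)) \<longlonglongrightarrow> 0"
        proof (rule average_tendsto_0[OF N_pos])
          fix i :: "nat \<Rightarrow> nat" assume i: "\<And>n. i n < N n"
          have i_small: "(\<lambda>n. real (i n) / real (m n)) \<longlonglongrightarrow> 0"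
            by (rule tendsto_sandwich[OF _ _ tendsto_const N_small])
               (use i in \<open>auto intro!: always_eventually divide_right_mono simp: less_imp_le\<close>)
          have J_m: "(\<lambda>n. real (?J n (i n)) / real (m n)) \<longlonglongrightarrow> w"
            using w by (intro step_index_tendsto[OF m i_small]) auto
          have "(\<lambda>n. real (?J n (i n)) / real (m n) * (real (m n) / real n)) \<longlonglongrightarrow> w * x"
            by (intro tendsto_mult J_m mn(2))
          moreover have "\<forall>\<^sub>F n in sequentially. real (?J n (i n)) / real (m n) * (real (m n) / real n) = real (?J n (i n)) / real n"
            using m_pos by eventually_elim simp
          ultimately have "(\<lambda>n. real (?J n (i n)) / real n) \<longlonglongrightarrow> w * x" by (rule Lim_transform_eventually)
          then have J_n: "(\<lambda>n. real (?J n (i n)) / real n) \<longlonglongrightarrow> y" by (simp add: y_def mult.commute)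
          have "\<forall>\<^sub>F n in sequentially. real (?J n (i n)) / real (m n) < 1"
            using order_tendstoD(2)[OF J_m] w by simp
          then have "\<forall>\<^sub>F n in sequentially. real (m n) / real n - real (?J n (i n)) / real n = real (m n - ?J n (i n)) / real n"
            using m_pos by eventually_elim (simp add: diff_divide_distrib)
          moreover have "(\<lambda>n. real (m n) / real n - real (?J n (i n)) / real n) \<longlonglongrightarrow> x - y"
            by (intro tendsto_diff J_n mn(2))
          ultimately have "(\<lambda>n. real (m n - ?J n (i n)) / real n) \<longlonglongrightarrow> x - y"
            by (rule Lim_transform_eventually[rotated])
          then have rest: "(\<lambda>n. real (m n - ?J n (i n)) / real n) \<longlonglongrightarrow> z"
            by (simp add: y_def z_def algebra_simps)
          have G: "(\<lambda>n. ?G n (m n - ?J n (i n))) \<longlonglongrightarrow> ?G'"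
            by (rule Suc.IH[OF _ rest z]) (rule order_trans[OF diff_le_self mn(1)])
          have "(\<lambda>n. g n (?J n (i n)) - ?a n (i n)) \<longlonglongrightarrow> 0"
            unfolding g_def by (rule uniform[OF y J_n])
          from tendsto_mult[OF this G]
          have "(\<lambda>n. (g n (?J n (i n)) - ?a n (i n)) * ?G n (m n - ?J n (i n))) \<longlonglongrightarrow> 0" by simp
          moreover have "(\<lambda>n. ?a n (i n) * (?G n (m n - ?J n (i n)) - ?G')) \<longlonglongrightarrow> 0"
          proof (rule Lim_null_comparison)
            show "(\<lambda>n. norm (?G n (m n - ?J n (i n)) - ?G')) \<longlonglongrightarrow> 0"
              using tendsto_norm_zero[OF LIM_zero[OF G]] .
            show "\<forall>\<^sub>F n in sequentially. norm (?a n (i n) * (?G n (m n - ?J n (i n)) - ?G')) \<le> norm (?G n (m n - ?J n (i n)) - ?G')"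
              using norm_\<gamma> by (intro always_eventually allI) (simp add: norm_mult mult_left_le_one_le)
          qed
          ultimately have "(\<lambda>n. (g n (?J n (i n)) - ?a n (i n)) * ?G n (m n - ?J n (i n))
              + ?a n (i n) * (?G n (m n - ?J n (i n)) - ?G')) \<longlonglongrightarrow> 0 + 0"
            by (rule tendsto_add)
          then show "(\<lambda>n. b n (?J n (i n)) - ?a n (i n) * ?G') \<longlonglongrightarrow> 0"
            by (simp add: b_def algebra_simps)
        qed
        moreover have "(\<lambda>n. (\<Sum>i<N n. ?a n i) / of_nat (N n) * ?G') \<longlonglongrightarrow> \<phi> y * ?G'"
        proof (rule tendsto_mult_right)
          \<comment> \<open>Successive shifts give successive integers, so the phases along a run
            form an orbit of the rotation by -\<alpha>.\<close>
          have J: "?J n i = ?J n 0 + i" for n i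
          proof -
            have "\<lceil>real (m n) * w + real i\<rceil> = \<lceil>real (m n) * w\<rceil> + int i" by linarith
            moreover have "\<lceil>real (m n) * w\<rceil> \<ge> 0"
            proof -
              have "real (m n) * w \<ge> 0" using w by simp
              then show ?thesis by linarith
            qed
            ultimately show ?thesis by (simp add: step_index_def nat_add_distrib)
          qed
          have "?a n i = \<gamma> (- (real (?J n 0 + i) * \<alpha>)) y" for n i
            by (rule arg_cong[where f = "\<lambda>k. \<gamma> (- (real k * \<alpha>)) y", OF J])
          then have "(\<Sum>i<N n. ?a n i) = (\<Sum>i<N n. \<gamma> (- (real (?J n 0 + i) * \<alpha>)) y)" for n
            by (rule sum.cong[OF refl])
          then show "(\<lambda>n. (\<Sum>i<N n. ?a n i) / of_nat (N n)) \<longlonglongrightarrow> \<phi> y"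
            using average_along_run[OF y N_top, of "\<lambda>n. ?J n 0"] by (simp only:)
        qed
        ultimately have "(\<lambda>n. (\<Sum>i<N n. b n (?J n i) - ?a n i * ?G') / of_nat (N n)
            + (\<Sum>i<N n. ?a n i) / of_nat (N n) * ?G') \<longlonglongrightarrow> 0 + \<phi> y * ?G'"
          by (rule tendsto_add)
        moreover have "(\<Sum>i<N n. b n (?J n i) - ?a n i * ?G') / of_nat (N n)
            + (\<Sum>i<N n. ?a n i) / of_nat (N n) * ?G' = (\<Sum>i<N n. b n (?J n i)) / of_nat (N n)" for n
          by (simp only: sum_subtractf diff_divide_distrib sum_distrib_right[symmetric] times_divide_eq_left diff_add_cancel)
        ultimately show "(\<lambda>n. (\<Sum>i<N n. b n (?J n i)) / of_nat (N n)) \<longlonglongrightarrow> B w"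
          by (simp add: B_def y_def z_def)
      qed
    qed
  qed
  moreover have "\<forall>\<^sub>F n in sequentially. (\<Sum>j=1..m n. first_cycle_prob \<theta> (m n) j *\<^sub>R b n j)
      = truncated_cycle_mean \<theta> (g n) (Suc k) (m n)"
    using m_pos by eventually_elim (simp add: b_def)
  ultimately show ?case unfolding stick_mean.simps B_def by (rule Lim_transform_eventually)
qed simp

end

section \<open>Stick breaking and its rearrangement\<close>

text \<open>Rank the indices by decreasing value, ties broken by the index. Only finitely many
  indices precede a given one, as \<open>v\<close> tends to 0 and is positive. The rank is injective
  and its range contains everything below each of its values, so it is a bijection of the naturals;
  its inverse sorts \<open>v\<close>.\<close>

lemma decreasing_rearrangement:
  fixes v :: "nat \<Rightarrow> real"
  assumes pos: "\<And>i. v i > 0" and lim: "v \<longlonglongrightarrow> 0"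
  obtains \<pi> where "bij \<pi>" "decseq (v \<circ> \<pi>)"
proof -
  define before where "before = (\<lambda>i j. v j < v i \<or> v i = v j \<and> i < j)"
  define r where "r = (\<lambda>j. card {i. before i j})"
  have fin: "finite {i. before i j}" for j
  proof -
    have "\<forall>\<^sub>F i in sequentially. v i < v j" using order_tendstoD(2)[OF lim pos] .
    then obtain n where "\<And>i. i \<ge> n \<Longrightarrow> v i < v j" unfolding eventually_sequentially by blast
    then have "\<not> before i j" if "i \<ge> n" for i using that by (fastforce simp: before_def)
    then have "{i. before i j} \<subseteq> {..n}" using nat_le_linear by blast
    then show ?thesis by (rule finite_subset) simp
  qed
  have r_less: "r i < r j" if "before i j" for i j
    unfolding r_def
  proof (rule psubset_card_mono[OF fin])
    show "{k. before k i} \<subset> {k. before k j}" using that by (auto simp: before_def)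
  qed
  have total: "before i j \<or> before j i" if "i \<noteq> j" for i j using that by (auto simp: before_def)
  have inj: "inj r"
  proof (rule injI)
    fix i j assume "r i = r j"
    then show "i = j" using total[of i j] r_less[of i j] r_less[of j i] by auto
  qed
  have initial: "{..<r j} \<subseteq> range r" for j
  proof -
    have "r ` {i. before i j} = {..<r j}"
    proof (rule card_subset_eq)
      show "card (r ` {i. before i j}) = card {..<r j}"
        using inj by (subst card_image) (auto intro: inj_on_subset simp: r_def)
    qed (use r_less in auto)
    then show ?thesis by blast
  qed
  have "surj r"
  proof -
    have "k \<in> range r" for k
    proof -
      have "infinite (range r)" using inj by (rule range_inj_infinite)
      then obtain j where "r j > k" unfolding infinite_nat_iff_unbounded by blast
      then show ?thesis using initial[of j] by auto
    qed
    then show ?thesis by blast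
  qed
  with inj have bij: "bij r" by (rule bijI)
  have "decseq (v \<circ> inv r)"
    unfolding decseq_def
  proof (intro allI impI)
    fix m n :: nat assume "m \<le> n"
    then have "\<not> r (inv r n) < r (inv r m)" using \<open>surj r\<close> by (simp add: surj_f_inv_f)
    then have "\<not> before (inv r n) (inv r m)" using r_less by blast
    then show "(v \<circ> inv r) n \<le> (v \<circ> inv r) m" by (auto simp: before_def)
  qed
  then show thesis using that bij_imp_bij_inv[OF bij] by blast
qed

lemma sum_stick_breaking: "(\<Sum>i<k. stick_breaking w i) = 1 - (\<Prod>i<k. 1 - w i)"
  by (induction k) (simp_all add: stick_breaking_def algebra_simps)

lemma stick_breaking_0: "stick_breaking w 0 = w 0"
  by (simp add: stick_breaking_def)

lemma stick_breaking_case_nat: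
  "stick_breaking (case_nat a w) (Suc i) = (1 - a) * stick_breaking w i"
  by (simp add: stick_breaking_def prod.lessThan_Suc_shift del: prod.lessThan_Suc)

text \<open>Bounding all partial sums, rather than naming the total, gives a condition that is
  visibly measurable and easy to transfer to a rearrangement.\<close>

definition mass_partition :: "(nat \<Rightarrow> real) \<Rightarrow> bool" where
  "mass_partition v \<longleftrightarrow> (\<forall>i. v i > 0) \<and> (\<forall>k. (\<Sum>i<k. v i) \<le> 1)"

lemma mass_partition_stick_breaking:
  assumes "\<And>i. 0 < w i" "\<And>i. w i < 1"
  shows "mass_partition (stick_breaking w)"
  unfolding mass_partition_def sum_stick_breaking
  using assms by (auto simp: stick_breaking_def intro!: mult_pos_pos prod_pos prod_nonneg less_imp_le)

lemma mass_partition_summable: "mass_partition v \<Longrightarrow> summable v"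
  unfolding mass_partition_def by (intro summableI_nonneg_bounded[where x = 1]) (auto intro: less_imp_le)

lemma mass_partition_tendsto: "mass_partition v \<Longrightarrow> v \<longlonglongrightarrow> 0"
  by (intro summable_LIMSEQ_zero mass_partition_summable)

lemma mass_partition_finite:
  assumes "mass_partition v" "\<delta> > 0"
  shows "finite {i. v i > \<delta>}"
proof -
  have "\<forall>\<^sub>F i in sequentially. v i < \<delta>"
    using order_tendstoD(2)[OF mass_partition_tendsto] assms by blast
  then obtain n where "\<And>i. i \<ge> n \<Longrightarrow> v i < \<delta>" unfolding eventually_sequentially by blast
  then have "\<not> v i > \<delta>" if "i \<ge> n" for i using that by fastforce
  then have "{i. v i > \<delta>} \<subseteq> {..n}" using nat_le_linear by blast
  then show ?thesis by (rule finite_subset) simp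
qed

lemma mass_partition_sorted:
  assumes v: "mass_partition v"
  obtains \<pi> where "bij \<pi>" "order_stat v = v \<circ> \<pi>" "mass_partition (order_stat v)"
proof -
  obtain \<pi> where \<pi>: "bij \<pi>" "decseq (v \<circ> \<pi>)"
    using decreasing_rearrangement[of v] v mass_partition_tendsto[OF v] by (auto simp: mass_partition_def)
  have eq: "order_stat v = v \<circ> \<pi>" using order_stat_sorted[OF \<pi>] by auto
  have inj: "inj_on \<pi> A" for A using \<pi>(1) bij_is_inj inj_on_subset by blast
  have "(\<Sum>i<k. (v \<circ> \<pi>) i) \<le> 1" for k
  proof -
    have "(\<Sum>i<k. (v \<circ> \<pi>) i) = (\<Sum>i\<in>\<pi> ` {..<k}. v i)" by (simp add: sum.reindex[OF inj])
    \<comment> \<open>Finitely many rearranged indices lie in one initial segment, whose sum is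
      bounded.\<close>
    also have "\<dots> \<le> (\<Sum>i<Suc (Max (insert 0 (\<pi> ` {..<k}))). v i)"
      using v by (intro sum_mono2) (auto simp: mass_partition_def less_Suc_eq_le less_imp_le intro!: Max_ge)
    also have "\<dots> \<le> 1" using v by (simp only: mass_partition_def)
    finally show ?thesis .
  qed
  then have "mass_partition (order_stat v)" using v by (auto simp: eq mass_partition_def)
  with \<pi>(1) eq show thesis by (rule that)
qed

lemma prod_finite_support_tendsto:
  fixes a :: "nat \<Rightarrow> complex"
  assumes fin: "finite I" and one: "\<And>i. i \<notin> I \<Longrightarrow> a i = 1"
  shows "(\<lambda>k. \<Prod>i<k. a i) \<longlonglongrightarrow> (\<Prod>i\<in>I. a i)"
proof (rule tendsto_eventually)
  show "\<forall>\<^sub>F k in sequentially. (\<Prod>i<k. a i) = (\<Prod>i\<in>I. a i)"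
    using eventually_gt_at_top[of "Max (insert 0 I)"]
  proof eventually_elim
    case (elim k)
    have "i < k" if "i \<in> I" for i
    proof -
      have "i \<le> Max (insert 0 I)" using that fin by (intro Max_ge) auto
      then show ?thesis using elim by simp
    qed
    then show ?case using one by (intro prod.mono_neutral_right) auto
  qed
qed

lemma prod_eventually_const:
  fixes \<phi> :: "real \<Rightarrow> complex"
  assumes "finite {i. v i > \<delta>}" and \<phi>: "\<And>y. y \<le> \<delta> \<Longrightarrow> \<phi> y = 1"
  shows "(\<lambda>k. \<Prod>i<k. \<phi> (v i)) \<longlonglongrightarrow> (\<Prod>i\<in>{i. v i > \<delta>}. \<phi> (v i))"
  using assms(1) by (rule prod_finite_support_tendsto) (simp add: \<phi>)

section \<open>Infinite products of stick laws and the passage to order statistics\<close>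

abbreviation sticks :: "real \<Rightarrow> (nat \<Rightarrow> real) measure" where
  "sticks \<theta> \<equiv> \<Pi>\<^sub>M i\<in>(UNIV :: nat set). stick_law \<theta>"

lemma sets_stick_law [measurable_cong, simp]: "sets (stick_law \<theta>) = sets borel"
  by (simp add: stick_law_def)

lemma sets_sticks [measurable_cong]: "sets (sticks \<theta>) = sets (\<Pi>\<^sub>M i\<in>(UNIV :: nat set). borel)"
  by (intro sets_PiM_cong) auto

lemma stick_breaking_measurable [measurable]:
  "(\<lambda>w. stick_breaking w i) \<in> borel_measurable (\<Pi>\<^sub>M i\<in>(UNIV :: nat set). borel)"
  unfolding stick_breaking_def by measurable

lemma stick_breaking_measurable':
  "stick_breaking \<in> (\<Pi>\<^sub>M i\<in>(UNIV :: nat set). borel) \<rightarrow>\<^sub>M (\<Pi>\<^sub>M i\<in>(UNIV :: nat set). borel)"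
  by (rule measurable_PiM_single') (auto simp: space_PiM)

context
  fixes \<theta> :: real
  assumes \<theta>: "\<theta> > 0"
begin

interpretation stick: prob_space "stick_law \<theta>" by (rule prob_space_stick_law[OF \<theta>])
interpretation sticks: sequence_space "stick_law \<theta>" by standard

lemma AE_stick_law: "AE x in stick_law \<theta>. 0 < x \<and> x < 1"
proof -
  have "AE x in lborel. 0 < ennreal (stick_density \<theta> x) \<longrightarrow> 0 < x \<and> x < 1"
    using AE_lborel_neq[of 0] AE_lborel_neq[of 1]
    by eventually_elim (auto simp: stick_density_def indicator_def split: if_splits)
  then show ?thesis unfolding stick_law_eq_density by (subst AE_density) auto
qed

lemma AE_sticks_mass_partition: "AE w in sticks \<theta>. mass_partition (stick_breaking w)"
proof -
  have "AE w in sticks \<theta>. \<forall>i. 0 < w i \<and> w i < 1"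
    unfolding AE_all_countable
    by (intro allI AE_PiM_component AE_stick_law prob_space_stick_law \<theta>) simp
  then show ?thesis by eventually_elim (simp add: mass_partition_stick_breaking)
qed

text \<open>Split the first coordinate off the infinite product measure. If the first stick is
  \<open>a\<close>, the others form a stick breaking of the remaining length
  \<open>x * (1 - a)\<close>, which is the recursion of \<open>stick_mean\<close>.\<close>

lemma stick_mean_eq_integral:
  fixes \<phi> :: "real \<Rightarrow> complex"
  assumes \<phi> [measurable]: "\<phi> \<in> borel_measurable borel" and norm: "\<And>y. norm (\<phi> y) \<le> 1"
  shows "stick_mean \<theta> \<phi> k x = (\<integral>w. (\<Prod>i<k. \<phi> (x * stick_breaking w i)) \<partial>sticks \<theta>)"
proof (induction k arbitrary: x)
  case 0
  show ?case by (simp add: sticks.P.prob_space)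
next
  case (Suc k)
  let ?h = "\<lambda>w. \<Prod>i<Suc k. \<phi> (x * stick_breaking w i)"
  interpret pair: pair_prob_space "stick_law \<theta>" "sticks \<theta>" by standard
  have h [measurable]: "?h \<in> borel_measurable (sticks \<theta>)" by measurable
  have c [measurable]: "(\<lambda>(a, w). case_nat a w) \<in> stick_law \<theta> \<Otimes>\<^sub>M sticks \<theta> \<rightarrow>\<^sub>M sticks \<theta>"
    by measurable
  have h_case: "?h (case_nat a w) = \<phi> (x * a) * (\<Prod>i<k. \<phi> (x * (1 - a) * stick_breaking w i))" for a w
    by (simp add: prod.lessThan_Suc_shift stick_breaking_0 stick_breaking_case_nat mult.assoc del: prod.lessThan_Suc)
  have bound: "norm (?h w) \<le> 1" for w
    unfolding prod_norm[symmetric] using norm by (intro prod_le_1) auto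
  have "(\<integral>w. ?h w \<partial>sticks \<theta>) = (\<integral>w. ?h w \<partial>distr (stick_law \<theta> \<Otimes>\<^sub>M sticks \<theta>) (sticks \<theta>) (\<lambda>(a, w). case_nat a w))"
    by (simp only: sticks.PiM_iter)
  also have "\<dots> = (\<integral>p. ?h (case p of (a, w) \<Rightarrow> case_nat a w) \<partial>(stick_law \<theta> \<Otimes>\<^sub>M sticks \<theta>))"
    by (rule integral_distr[OF c h])
  also have "\<dots> = (\<integral>a. \<integral>w. ?h (case_nat a w) \<partial>sticks \<theta> \<partial>stick_law \<theta>)"
  proof -
    have "integrable (stick_law \<theta> \<Otimes>\<^sub>M sticks \<theta>) (\<lambda>p. ?h (case p of (a, w) \<Rightarrow> case_nat a w))"
      by (rule pair.P.integrable_const_bound[where B = 1]) (use bound in \<open>auto intro!: measurable_compose[OF c h]\<close>)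
    from pair.integral_fst'[OF this] show ?thesis by simp
  qed
  also have "\<dots> = (\<integral>a. \<phi> (x * a) * stick_mean \<theta> \<phi> k (x * (1 - a)) \<partial>stick_law \<theta>)"
    unfolding h_case by (simp add: Suc)
  finally show ?case by simp
qed

text \<open>For fixed k the first k sticks and the k largest ones differ, so only the limits can
  agree. As \<phi> is 1 up to \<delta>, both products are eventually constant, equal to the finite
  product over all sticks longer than \<delta>, and that product ignores the order. Dominated
  convergence with bound 1 finishes.\<close>

lemma stick_mean_tendsto:
  fixes \<phi> :: "real \<Rightarrow> complex"
  assumes \<phi> [measurable]: "\<phi> \<in> borel_measurable borel" and norm: "\<And>y. norm (\<phi> y) \<le> 1"
    and \<delta>: "\<delta> > 0" "\<And>y. y \<le> \<delta> \<Longrightarrow> \<phi> y = 1"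
  shows "\<exists>A. (\<lambda>k. stick_mean \<theta> \<phi> k 1) \<longlonglongrightarrow> A \<and>
    (\<lambda>k. \<integral>l. (\<Prod>i<k. \<phi> (l i)) \<partial>poisson_dirichlet \<theta>) \<longlonglongrightarrow> A"
proof -
  let ?B = "\<Pi>\<^sub>M i\<in>(UNIV :: nat set). (borel :: real measure)"
  \<comment> \<open>A total measurable function; its values count only at mass partitions, where the
    limit exists.\<close>
  let ?A = "\<lambda>v. lim (\<lambda>k. \<Prod>i<k. \<phi> (v i))"
  have A [measurable]: "?A \<in> borel_measurable ?B" by measurable
  have sb [measurable]: "stick_breaking \<in> sticks \<theta> \<rightarrow>\<^sub>M ?B"
    using stick_breaking_measurable' by (simp add: measurable_cong_sets[OF sets_sticks refl])
  have os [measurable]: "(\<lambda>w. order_stat (stick_breaking w)) \<in> sticks \<theta> \<rightarrow>\<^sub>M ?B"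
    by (rule measurable_compose[OF sb measurable_order_stat])
  have bound: "norm (\<Prod>i<k. \<phi> (v i)) \<le> 1" for v :: "nat \<Rightarrow> real" and k
    unfolding prod_norm[symmetric] using norm by (intro prod_le_1) auto
  have lim1: "(\<lambda>k. \<Prod>i<k. \<phi> (v i)) \<longlonglongrightarrow> ?A v" if "mass_partition v" for v
    using prod_eventually_const[where v = v and \<delta> = \<delta> and \<phi> = \<phi>, OF mass_partition_finite[OF that \<delta>(1)] \<delta>(2)]
    by (simp add: limI)
  have lim2: "(\<lambda>k. \<Prod>i<k. \<phi> (order_stat v i)) \<longlonglongrightarrow> ?A v" if v: "mass_partition v" for v
  proof -
    obtain \<pi> where \<pi>: "bij \<pi>" "order_stat v = v \<circ> \<pi>" "mass_partition (order_stat v)"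
      using mass_partition_sorted[OF v] .
    have "(\<lambda>k. \<Prod>i<k. \<phi> (order_stat v i)) \<longlonglongrightarrow> (\<Prod>i\<in>{i. order_stat v i > \<delta>}. \<phi> (order_stat v i))"
      by (intro prod_eventually_const mass_partition_finite \<pi> \<delta>)
    also have "(\<Prod>i\<in>{i. order_stat v i > \<delta>}. \<phi> (order_stat v i)) = (\<Prod>i\<in>{i. v i > \<delta>}. \<phi> (v i))"
    proof -
      have "{i. v i > \<delta>} = \<pi> ` {i. (v \<circ> \<pi>) i > \<delta>}"
        using bij_is_surj[OF \<pi>(1)] by (auto simp: image_iff)
      moreover have "inj_on \<pi> {i. (v \<circ> \<pi>) i > \<delta>}" using bij_is_inj[OF \<pi>(1)] inj_on_subset by blast
      ultimately show ?thesis unfolding \<pi>(2) by (simp only: prod.reindex o_def)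
    qed
    also have "\<dots> = ?A v"
      using prod_eventually_const[where v = v and \<delta> = \<delta> and \<phi> = \<phi>, OF mass_partition_finite[OF v \<delta>(1)] \<delta>(2)]
      by (simp add: limI)
    finally show ?thesis .
  qed
  let ?I = "\<integral>w. ?A (stick_breaking w) \<partial>sticks \<theta>"
  have "(\<lambda>k. \<integral>w. (\<Prod>i<k. \<phi> (stick_breaking w i)) \<partial>sticks \<theta>) \<longlonglongrightarrow> ?I"
    by (rule integral_dominated_convergence[where w = "\<lambda>_. 1"])
       (use AE_sticks_mass_partition lim1 bound in \<open>auto intro: eventually_mono\<close>)
  then have 1: "(\<lambda>k. stick_mean \<theta> \<phi> k 1) \<longlonglongrightarrow> ?I"
    by (simp add: stick_mean_eq_integral[OF \<phi> norm])
  have "(\<lambda>k. \<integral>w. (\<Prod>i<k. \<phi> (order_stat (stick_breaking w) i)) \<partial>sticks \<theta>) \<longlonglongrightarrow> ?I"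
  proof (rule integral_dominated_convergence[where w = "\<lambda>_. 1"])
    show "(\<lambda>w. \<Prod>i<k. \<phi> (order_stat (stick_breaking w) i)) \<in> borel_measurable (sticks \<theta>)" for k
      using measurable_compose[OF os, of "\<lambda>l. \<Prod>i<k. \<phi> (l i)" borel] by simp
  qed (use AE_sticks_mass_partition lim2 bound in \<open>auto intro: eventually_mono\<close>)
  moreover have "(\<integral>l. (\<Prod>i<k. \<phi> (l i)) \<partial>poisson_dirichlet \<theta>)
      = (\<integral>w. (\<Prod>i<k. \<phi> (order_stat (stick_breaking w) i)) \<partial>sticks \<theta>)" for k
    unfolding poisson_dirichlet_def by (rule integral_distr[OF os]) measurable
  ultimately show ?thesis using 1 by auto
qed

lemma AE_poisson_dirichlet: "AE l in poisson_dirichlet \<theta>. mass_partition l"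
proof -
  let ?B = "\<Pi>\<^sub>M i\<in>(UNIV :: nat set). (borel :: real measure)"
  have "(\<lambda>w. order_stat (stick_breaking w)) \<in> sticks \<theta> \<rightarrow>\<^sub>M ?B"
    by (rule measurable_compose[OF _ measurable_order_stat])
       (use stick_breaking_measurable' in \<open>simp add: measurable_cong_sets[OF sets_sticks refl]\<close>)
  moreover have "{l \<in> space ?B. mass_partition l} \<in> sets ?B"
    unfolding mass_partition_def by measurable
  moreover have "AE w in sticks \<theta>. mass_partition (order_stat (stick_breaking w))"
    using AE_sticks_mass_partition by eventually_elim (meson mass_partition_sorted)
  ultimately show ?thesis unfolding poisson_dirichlet_def by (subst AE_distr_iff) auto
qed

end

section \<open>The contribution of one cycle\<close>

text \<open>For compactly supported f and y > 0 only finitely many terms are nonzero. Summing over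
  all integers keeps the index set independent of u and y, so that periodicity in u is a mere
  reindexing.\<close>

definition periodized :: "(real \<Rightarrow> real) \<Rightarrow> real \<Rightarrow> real \<Rightarrow> real" where
  "periodized f u y = (\<Sum>\<^sub>\<infinity>q\<in>(UNIV :: int set). f ((u + of_int q) / y))"

lemma periodized_eq_sum:
  assumes "finite A" "\<And>q. q \<notin> A \<Longrightarrow> f ((u + of_int q) / y) = 0"
  shows "periodized f u y = (\<Sum>q\<in>A. f ((u + of_int q) / y))"
proof -
  have "periodized f u y = (\<Sum>\<^sub>\<infinity>q\<in>A. f ((u + of_int q) / y))"
    unfolding periodized_def using assms(2) by (intro infsum_cong_neutral) auto
  then show ?thesis using assms(1) by simp
qed

lemma periodized_periodic: "periodized f (u + 1) y = periodized f u y"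
proof -
  have "bij_betw (\<lambda>q::int. q + 1) UNIV UNIV"
    by (rule bij_betw_byWitness[where f' = "\<lambda>q. q - 1"]) auto
  from infsum_reindex_bij_betw[OF this, of "\<lambda>q. f ((u + of_int q) / y)"]
  show ?thesis by (simp add: periodized_def algebra_simps)
qed

lemma periodized_frac: "periodized f (frac u) y = periodized f u y"
  using periodic_int[of "\<lambda>u. periodized f u y" "frac u" "\<lfloor>u\<rfloor>", OF periodized_periodic]
  by (simp add: frac_def)

locale test_function =
  fixes f :: "real \<Rightarrow> real" and c :: real
  assumes f_cont: "continuous_on UNIV f" and c: "c > 0" and f_zero: "\<And>x. \<bar>x\<bar> > c \<Longrightarrow> f x = 0"
begin

lemma f_measurable [measurable]: "f \<in> borel_measurable borel"
  by (rule borel_measurable_continuous_onI[OF f_cont])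

lemma f_uniformly_continuous: "uniformly_continuous_on UNIV f"
  unfolding uniformly_continuous_on_def
proof (intro allI impI)
  fix e :: real assume e: "e > 0"
  have "uniformly_continuous_on {-c-1..c+1} f"
    using f_cont continuous_on_subset by (intro compact_uniformly_continuous) blast+
  then obtain d where d: "d > 0" "\<And>x y. x \<in> {-c-1..c+1} \<Longrightarrow> y \<in> {-c-1..c+1} \<Longrightarrow> dist y x < d \<Longrightarrow> dist (f y) (f x) < e"
    using e unfolding uniformly_continuous_on_def by metis
  have "dist (f y) (f x) < e" if xy: "dist y x < min d 1" for x y
  proof (cases "x \<in> {-c-1..c+1} \<and> y \<in> {-c-1..c+1}")
    case True
    then show ?thesis using d(2)[of x y] xy by simp
  next
    case False
    then have "\<bar>x\<bar> > c + 1 \<or> \<bar>y\<bar> > c + 1" unfolding atLeastAtMost_iff by linarith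
    moreover have "\<bar>x\<bar> \<le> \<bar>y\<bar> + 1" "\<bar>y\<bar> \<le> \<bar>x\<bar> + 1" using xy unfolding dist_real_def by linarith+
    ultimately have "\<bar>x\<bar> > c \<and> \<bar>y\<bar> > c" by linarith
    then show ?thesis using f_zero e by simp
  qed
  then show "\<exists>d>0. \<forall>x\<in>UNIV. \<forall>x'\<in>UNIV. dist x' x < d \<longrightarrow> dist (f x') (f x) < e"
    using d(1) by (intro exI[of _ "min d 1"]) auto
qed

text \<open>Chosen so that for |u| <= 2 and y <= 2 an integer q outside -Q..Q has |u + q| > 2 c >= c
  y and misses the support. Allowing |u| up to 2 covers a neighbourhood of a whole period.\<close>

definition Q :: int where "Q = \<lceil>2 * c\<rceil> + 3"

lemma periodized_near_0:
  assumes "\<bar>u\<bar> \<le> 2" "0 < y" "y \<le> 2"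
  shows "periodized f u y = (\<Sum>q\<in>{-Q..Q}. f ((u + of_int q) / y))"
proof (rule periodized_eq_sum)
  fix q assume "q \<notin> {-Q..Q}"
  then have "\<bar>q\<bar> \<ge> \<lceil>2 * c\<rceil> + 3" by (auto simp: Q_def)
  then have "\<bar>real_of_int q\<bar> \<ge> 2 * c + 3" by linarith
  then have "\<bar>u + of_int q\<bar> > 2 * c" using assms by linarith
  moreover have "c * y \<le> 2 * c" using assms c by simp
  ultimately have "\<bar>(u + of_int q) / y\<bar> > c" using assms by (simp add: abs_divide field_simps)
  then show "f ((u + of_int q) / y) = 0" by (rule f_zero)
qed simp

lemma periodized_frac_sum:
  assumes "0 < y" "y \<le> 2"
  shows "periodized f u y = (\<Sum>q\<in>{-Q..Q}. f ((frac u + of_int q) / y))"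
  using periodized_near_0[of "frac u" y] assms frac_lt_1[of u] by (simp add: periodized_frac)

text \<open>For |u| < 2 the series is one fixed finite sum; subtracting the floor of u carries
  continuity to the whole line.\<close>

lemma periodized_continuous:
  assumes y: "0 < y" "y \<le> 2"
  shows "continuous_on UNIV (\<lambda>u. periodized f u y)"
proof -
  have at: "isCont (\<lambda>u. periodized f u y) u" if "\<bar>u\<bar> < 2" for u
  proof -
    have "isCont (\<lambda>u. \<Sum>q\<in>{-Q..Q}. f ((u + of_int q) / y)) u"
    proof (rule continuous_sum)
      fix q
      have "isCont (\<lambda>u. (u + of_int q) / y) u" using y by (intro continuous_intros) auto
      moreover have "isCont f ((u + of_int q) / y)" using f_cont by (simp add: continuous_on_eq_continuous_at)
      ultimately show "isCont (\<lambda>u. f ((u + of_int q) / y)) u" by (rule isCont_o2)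
    qed
    moreover have "\<forall>\<^sub>F v in nhds u. periodized f v y = (\<Sum>q\<in>{-Q..Q}. f ((v + of_int q) / y))"
    proof -
      have "\<forall>\<^sub>F v in nhds u. v \<in> {-2<..<2}" using that by (intro eventually_nhds_in_open) auto
      then show ?thesis
      proof eventually_elim
        case (elim v)
        then have "\<bar>v\<bar> \<le> 2" by auto
        then show ?case by (rule periodized_near_0[OF _ y])
      qed
    qed
    ultimately show ?thesis by (simp add: isCont_cong)
  qed
  have "isCont (\<lambda>u. periodized f u y) u" for u
  proof -
    have "isCont (\<lambda>v. v - of_int \<lfloor>u\<rfloor>) u" by (intro continuous_intros)
    moreover have "isCont (\<lambda>u. periodized f u y) (u - of_int \<lfloor>u\<rfloor>)" by (rule at) linarith
    ultimately have "isCont (\<lambda>v. periodized f (v - of_int \<lfloor>u\<rfloor>) y) u" by (rule isCont_o2)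
    moreover have "periodized f (v - of_int \<lfloor>u\<rfloor>) y = periodized f v y" for v
      using periodic_int[of "\<lambda>u. periodized f u y" "v - of_int \<lfloor>u\<rfloor>" "\<lfloor>u\<rfloor>", OF periodized_periodic]
      by simp
    ultimately show ?thesis by simp
  qed
  then show ?thesis by (simp add: continuous_at_imp_continuous_on)
qed

text \<open>Only the fractional part of the phase enters, so the points with index q move by at most
  (1 + |q|) |1 / r n - 1 / y| for any phase, and only q in -Q..Q contribute. Uniform continuity of f
  does the rest.\<close>

lemma periodized_uniform:
  assumes y: "0 < y" "y < 2" and r: "r \<longlonglongrightarrow> y"
  shows "(\<lambda>n::nat. periodized f (s n) (r n) - periodized f (s n) y) \<longlonglongrightarrow> 0"
proof -
  have ev: "\<forall>\<^sub>F n in sequentially. 0 < r n" "\<forall>\<^sub>F n in sequentially. r n < 2"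
    using order_tendstoD[OF r] y by auto
  have each: "(\<lambda>n. f ((frac (s n) + of_int q) / r n) - f ((frac (s n) + of_int q) / y)) \<longlonglongrightarrow> 0" for q
  proof -
    have "(\<lambda>n. dist ((frac (s n) + of_int q) / r n) ((frac (s n) + of_int q) / y)) \<longlonglongrightarrow> 0"
    proof (rule Lim_null_comparison)
      have "(\<lambda>n. 1 / r n - 1 / y) \<longlonglongrightarrow> 1 / y - 1 / y" using y by (intro tendsto_intros r) auto
      then have "(\<lambda>n. (1 + \<bar>of_int q\<bar>) * \<bar>1 / r n - 1 / y\<bar>) \<longlonglongrightarrow> (1 + \<bar>of_int q\<bar>) * \<bar>1 / y - 1 / y\<bar>"
        by (intro tendsto_mult_left tendsto_rabs)
      then show "(\<lambda>n. (1 + \<bar>of_int q\<bar>) * \<bar>1 / r n - 1 / y\<bar>) \<longlonglongrightarrow> 0" by simp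
      show "\<forall>\<^sub>F n in sequentially. norm (dist ((frac (s n) + of_int q) / r n) ((frac (s n) + of_int q) / y))
          \<le> (1 + \<bar>of_int q\<bar>) * \<bar>1 / r n - 1 / y\<bar>"
      proof (intro always_eventually allI)
        fix n
        have "dist ((frac (s n) + of_int q) / r n) ((frac (s n) + of_int q) / y)
            = \<bar>(frac (s n) + of_int q) * (1 / r n - 1 / y)\<bar>"
          by (simp add: dist_real_def right_diff_distrib)
        also have "\<dots> = \<bar>frac (s n) + of_int q\<bar> * \<bar>1 / r n - 1 / y\<bar>" by (rule abs_mult)
        also have "\<dots> \<le> (1 + \<bar>of_int q\<bar>) * \<bar>1 / r n - 1 / y\<bar>"
        proof (rule mult_right_mono)
          show "\<bar>frac (s n) + of_int q\<bar> \<le> 1 + \<bar>of_int q\<bar>"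
            using frac_lt_1[of "s n"] frac_ge_0[of "s n"] by linarith
        qed simp
        finally show "norm (dist ((frac (s n) + of_int q) / r n) ((frac (s n) + of_int q) / y))
          \<le> (1 + \<bar>of_int q\<bar>) * \<bar>1 / r n - 1 / y\<bar>" by simp
      qed
    qed
    then have "(\<lambda>n. dist (f ((frac (s n) + of_int q) / r n)) (f ((frac (s n) + of_int q) / y))) \<longlonglongrightarrow> 0"
      using f_uniformly_continuous unfolding uniformly_continuous_on_sequentially by simp
    then show ?thesis by (simp add: dist_real_def tendsto_rabs_zero_iff)
  qed
  have "(\<lambda>n. \<Sum>q\<in>{-Q..Q}. f ((frac (s n) + of_int q) / r n) - f ((frac (s n) + of_int q) / y)) \<longlonglongrightarrow> (\<Sum>q\<in>{-Q..Q}. 0)"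
    by (intro tendsto_sum each)
  moreover have "\<forall>\<^sub>F n in sequentially. (\<Sum>q\<in>{-Q..Q}. f ((frac (s n) + of_int q) / r n) - f ((frac (s n) + of_int q) / y))
      = periodized f (s n) (r n) - periodized f (s n) y"
    using ev by eventually_elim (use y in \<open>simp add: periodized_frac_sum sum_subtractf\<close>)
  ultimately show ?thesis by (simp add: Lim_transform_eventually)
qed

text \<open>The bound \<open>2\<close> on \<open>y\<close> only serves to make this measurable.\<close>

definition cut_kernel :: "real \<Rightarrow> real \<Rightarrow> real \<Rightarrow> real \<Rightarrow> complex" where
  "cut_kernel t \<delta> u y = (if \<delta> < y \<and> y \<le> 2 then iexp (t * periodized f u y) else 1)"

lemma rotation_kernel_cut_kernel:
  assumes "\<theta> > 0" "\<alpha> \<notin> \<rat>" "\<delta> > 0"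
  shows "rotation_kernel \<theta> \<alpha> \<delta> (cut_kernel t \<delta>)"
proof
  show "(\<lambda>(u, y). cut_kernel t \<delta> u y) \<in> borel_measurable (borel \<Otimes>\<^sub>M borel)"
  proof -
    have "(\<lambda>(u, y). if \<delta> < y \<and> y \<le> 2 then iexp (t * (\<Sum>q\<in>{-Q..Q}. f ((frac u + of_int q) / y))) else 1)
        \<in> borel_measurable (borel \<Otimes>\<^sub>M borel)"
      unfolding frac_def by measurable
    also have "(\<lambda>(u, y). if \<delta> < y \<and> y \<le> 2 then iexp (t * (\<Sum>q\<in>{-Q..Q}. f ((frac u + of_int q) / y))) else 1)
        = (\<lambda>(u, y). cut_kernel t \<delta> u y)"
      using assms(3) by (auto simp: cut_kernel_def periodized_frac_sum fun_eq_iff)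
    finally show ?thesis .
  qed
next
  fix y assume y: "0 < y" "y \<le> 1" "y \<noteq> \<delta>"
  show "continuous_on UNIV (\<lambda>u. cut_kernel t \<delta> u y)"
    unfolding cut_kernel_def using y
    by (cases "\<delta> < y \<and> y \<le> 2") (auto intro!: continuous_intros periodized_continuous)
next
  fix y :: real and s r :: "nat \<Rightarrow> real" assume y: "0 < y" "y \<le> 1" "y \<noteq> \<delta>" and r: "r \<longlonglongrightarrow> y"
  show "(\<lambda>n. cut_kernel t \<delta> (s n) (r n) - cut_kernel t \<delta> (s n) y) \<longlonglongrightarrow> 0"
  proof (cases "\<delta> < y")
    case True
    have ev: "\<forall>\<^sub>F n in sequentially. \<delta> < r n" "\<forall>\<^sub>F n in sequentially. r n < 2"
      using order_tendstoD[OF r] y True by auto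
    show ?thesis
    proof (rule Lim_null_comparison)
      have "(\<lambda>n. \<bar>t\<bar> * \<bar>periodized f (s n) (r n) - periodized f (s n) y\<bar>) \<longlonglongrightarrow> \<bar>t\<bar> * \<bar>0\<bar>"
        using y by (intro tendsto_intros periodized_uniform r) auto
      then show "(\<lambda>n. \<bar>t\<bar> * \<bar>periodized f (s n) (r n) - periodized f (s n) y\<bar>) \<longlonglongrightarrow> 0" by simp
      show "\<forall>\<^sub>F n in sequentially. norm (cut_kernel t \<delta> (s n) (r n) - cut_kernel t \<delta> (s n) y)
          \<le> \<bar>t\<bar> * \<bar>periodized f (s n) (r n) - periodized f (s n) y\<bar>"
        using ev
      proof eventually_elim
        case (elim n)
        let ?a = "t * periodized f (s n) (r n)" and ?b = "t * periodized f (s n) y"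
        \<comment> \<open>Factoring out a number of norm 1 reduces the difference to |exp(i x) - 1|
          <= |x|.\<close>
        have "iexp ?a = iexp ?b * iexp (?a - ?b)"
          unfolding exp_add[symmetric] by (simp add: algebra_simps)
        then have "iexp ?a - iexp ?b = iexp ?b * (iexp (?a - ?b) - 1)" by (simp only: right_diff_distrib mult_1_right)
        then have "norm (iexp ?a - iexp ?b) = norm (iexp (?a - ?b) - 1)" by (simp add: norm_mult)
        also have "\<dots> \<le> \<bar>?a - ?b\<bar>"
          using iexp_approx1[of "?a - ?b" 0] by simp
        also have "\<dots> = \<bar>t\<bar> * \<bar>periodized f (s n) (r n) - periodized f (s n) y\<bar>"
          by (simp flip: right_diff_distrib abs_mult)
        finally show ?case using elim True y by (simp add: cut_kernel_def)
      qed
    qed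
  next
    case False
    then have "\<forall>\<^sub>F n in sequentially. r n < \<delta>" using order_tendstoD(2)[OF r] y by auto
    then have "\<forall>\<^sub>F n in sequentially. cut_kernel t \<delta> (s n) (r n) - cut_kernel t \<delta> (s n) y = 0"
      by eventually_elim (use False in \<open>simp add: cut_kernel_def\<close>)
    then show ?thesis by (rule tendsto_eventually)
  qed
qed (use assms in \<open>auto simp: cut_kernel_def periodized_periodic\<close>)

end

section \<open>The Ewens point process\<close>

lemma integral_dirac_sum_finite:
  fixes f :: "real \<Rightarrow> real"
  assumes f: "f \<in> borel_measurable borel" and A: "finite A" "A \<subseteq> I"
    and zero: "\<And>i. i \<in> I \<Longrightarrow> i \<notin> A \<Longrightarrow> f (x i) = 0"
  shows "(\<integral>z. f z \<partial>dirac_sum I (\<lambda>i. of_nat (k i)) x) = (\<Sum>i\<in>A. real (k i) * f (x i))"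
proof -
  have "(\<integral>z. f z \<partial>dirac_sum I (\<lambda>i. of_nat (k i)) x) = (\<integral>i. f (x i) \<partial>point_measure I (\<lambda>i. of_nat (k i)))"
    unfolding dirac_sum_def using f
    by (intro integral_distr) (simp_all add: measurable_def sets_point_measure space_point_measure)
  also have "\<dots> = (\<integral>i. f (x i) \<partial>density (count_space I) (\<lambda>i. ennreal (real (k i))))"
    by (simp add: point_measure_def ennreal_of_nat_eq_real_of_nat)
  also have "\<dots> = (\<integral>i. real (k i) *\<^sub>R f (x i) \<partial>count_space I)"
    by (intro integral_density) auto
  also have "\<dots> = (\<Sum>i | i \<in> I \<and> real (k i) *\<^sub>R f (x i) \<noteq> 0. real (k i) *\<^sub>R f (x i))"
    using A zero by (intro lebesgue_integral_count_space_finite_support finite_subset[OF _ A(1)]) auto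
  also have "\<dots> = (\<Sum>i\<in>A. real (k i) *\<^sub>R f (x i))"
    using A zero by (intro sum.mono_neutral_left) auto
  finally show ?thesis by simp
qed

lemma emeasure_dirac_sum_finite:
  assumes B: "B \<in> sets borel" and A: "finite A" "A \<subseteq> I"
    and out: "\<And>i. i \<in> I \<Longrightarrow> i \<notin> A \<Longrightarrow> x i \<notin> B"
  shows "\<exists>m::nat. emeasure (dirac_sum I (\<lambda>i. of_nat (k i)) x) B = of_nat m"
proof -
  have "emeasure (dirac_sum I (\<lambda>i. of_nat (k i)) x) B = (\<Sum>i\<in>A. of_nat (k i) * indicator B (x i))"
    unfolding emeasure_dirac_sum[OF B] using out A by (intro nn_integral_count_space') auto
  also have "\<dots> = of_nat (\<Sum>i\<in>A. k i * (if x i \<in> B then 1 else 0))"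
    by (simp add: indicator_def of_bool_def if_distrib cong: if_cong)
  finally show ?thesis by blast
qed

lemma sets_dirac_sum: "sets (dirac_sum I w x) = sets borel"
  by (simp add: dirac_sum_def)

lemma integrable_ewens:
  fixes X :: "(nat \<Rightarrow> nat) \<Rightarrow> 'b::{banach, second_countable_topology}"
  assumes "\<theta> > 0"
  shows "integrable (ewens n \<theta>) X"
  unfolding ewens_def using assms
  by (intro integrable_point_measure_finite)
     (auto simp: finite_permutations intro!: divide_nonneg_nonneg pochhammer_nonneg)

lemma point_process_ewens:
  assumes "\<theta> > 0"
  shows "point_process (ewens n \<theta>) (ewens_point_process \<alpha> n)"
  unfolding point_process_def
proof (intro conjI ballI prob_space_ewens assms measurable_ewens AE_I2)
  fix \<sigma>
  show "locally_finite_counting (ewens_point_process \<alpha> n \<sigma>)"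
    unfolding locally_finite_counting_def
  proof (intro conjI ballI impI)
    show "sets (ewens_point_process \<alpha> n \<sigma>) = sets borel"
      by (simp add: ewens_point_process_def sets_dirac_sum)
    fix B :: "real set" assume B: "B \<in> sets borel" "bounded B"
    obtain c where c: "\<And>x. x \<in> B \<Longrightarrow> \<bar>x\<bar> \<le> c" using B(2) unfolding bounded_iff real_norm_def by blast
    \<comment> \<open>Since n >= 1, a point of \<open>B\<close> satisfies |i / j - \<alpha>| <= c,
      hence |i| <= j (c + |\<alpha>|) <= n (c + |\<alpha>|).\<close>
    define K where "K = \<lceil>real n * (c + \<bar>\<alpha>\<bar>)\<rceil>"
    have "n > 0 \<Longrightarrow> \<bar>i\<bar> \<le> K" if "j \<in> {1..n}" "real n * (of_int i / real j - \<alpha>) \<in> B" for i j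
    proof -
      have n: "n > 0" "real n \<ge> 1" using that(1) by auto
      have "\<bar>real n * (of_int i / real j - \<alpha>)\<bar> \<le> c" by (rule c[OF that(2)])
      then have "real n * \<bar>of_int i / real j - \<alpha>\<bar> \<le> c" by (simp add: abs_mult)
      moreover have "\<bar>of_int i / real j - \<alpha>\<bar> \<le> real n * \<bar>of_int i / real j - \<alpha>\<bar>"
        using n(2) by (simp add: mult_right_le_one_le mult_le_cancel_right1)
      ultimately have "\<bar>of_int i / real j\<bar> \<le> c + \<bar>\<alpha>\<bar>" by linarith
      then have "\<bar>of_int i\<bar> \<le> real j * (c + \<bar>\<alpha>\<bar>)" using that(1) by (simp add: abs_divide field_simps)
      also have "\<dots> \<le> real n * (c + \<bar>\<alpha>\<bar>)"
      proof (rule mult_right_mono)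
        have "0 \<le> \<bar>real n * (of_int i / real j - \<alpha>)\<bar>" by simp
        also have "\<dots> \<le> c" by (rule c[OF that(2)])
        finally show "0 \<le> c + \<bar>\<alpha>\<bar>" by simp
      qed (use that(1) in auto)
      finally show "\<bar>i\<bar> \<le> K" unfolding K_def by linarith
    qed
    then show "\<exists>m::nat. emeasure (ewens_point_process \<alpha> n \<sigma>) B = of_nat m"
      using emeasure_dirac_sum_finite[OF B(1), of "{1..n} \<times> {-K..K}" "{1..n} \<times> UNIV"
          "\<lambda>(j, i). real n * (of_int i / real j - \<alpha>)" "\<lambda>(j, i). cycle_count n \<sigma> j"]
      unfolding ewens_point_process_def by (force simp: case_prod_unfold)
  qed
qed

lemma sum_cycle_count:
  fixes h :: "nat \<Rightarrow> real"
  assumes \<sigma>: "\<sigma> permutes {1..n}"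
  shows "(\<Sum>j=1..n. real (cycle_count n \<sigma> j) * h j) = (\<Sum>c\<in>cycle_sets n \<sigma>. h (card c))"
    and "c \<in> cycle_sets n \<sigma> \<Longrightarrow> card c \<in> {1..n}"
proof -
  have card: "card c \<in> {1..n}" if mem: "c \<in> cycle_sets n \<sigma>" for c
  proof -
    obtain x where x: "x \<in> {1..n}" "c = orbit \<sigma> x" using mem by (auto simp: cycle_sets_def)
    have sub: "c \<subseteq> {1..n}" using permutes_orbit_subset[OF \<sigma> x(1)] x(2) by simp
    then have "card c \<le> n" using card_mono[OF _ sub] by simp
    moreover have "c \<noteq> {}" using x orbit_nonempty by simp
    then have "card c > 0" using sub finite_subset by (fastforce simp: card_gt_0_iff)
    ultimately show ?thesis by simp
  qed
  then show "c \<in> cycle_sets n \<sigma> \<Longrightarrow> card c \<in> {1..n}" .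
  have "(\<Sum>c\<in>cycle_sets n \<sigma>. h (card c)) = (\<Sum>j=1..n. \<Sum>c\<in>{c\<in>cycle_sets n \<sigma>. card c = j}. h (card c))"
    using card by (intro sum.group[symmetric] finite_cycle_sets) auto
  also have "\<dots> = (\<Sum>j=1..n. real (cycle_count n \<sigma> j) * h j)"
    by (intro sum.cong refl) (simp add: cycle_count_def)
  finally show "(\<Sum>j=1..n. real (cycle_count n \<sigma> j) * h j) = (\<Sum>c\<in>cycle_sets n \<sigma>. h (card c))" by simp
qed

context test_function
begin

lemma integral_ewens_point_process:
  assumes \<sigma>: "\<sigma> permutes {1..n}"
  shows "(\<integral>x. f x \<partial>ewens_point_process \<alpha> n \<sigma>)
    = (\<Sum>b\<in>cycle_sets n \<sigma>. periodized f (- (real (card b) * \<alpha>)) (real (card b) / real n))"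
proof -
  \<comment> \<open>This puts the points of a cycle into the shape (u + q) / y of the limit
    points.\<close>
  have eq: "real n * (of_int i / real j - \<alpha>) = (- (real j * \<alpha>) + of_int i) / (real j / real n)" if "j \<in> {1..n}" for i j
    using that by (simp add: field_simps)
  define K where "K = \<lceil>real n * (c + \<bar>\<alpha>\<bar>)\<rceil>"
  have zero: "f (real n * (of_int i / real j - \<alpha>)) = 0" if j: "j \<in> {1..n}" and i: "i \<notin> {-K..K}" for i j
  proof (rule f_zero)
    have "\<bar>i\<bar> > K" using i by auto
    then have "\<bar>of_int i\<bar> > real n * (c + \<bar>\<alpha>\<bar>)" unfolding K_def by linarith
    moreover have "real n * (c + \<bar>\<alpha>\<bar>) \<ge> real j * (c + \<bar>\<alpha>\<bar>)" using j c by (intro mult_right_mono) auto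
    ultimately have "\<bar>of_int i\<bar> > real j * (c + \<bar>\<alpha>\<bar>)" by linarith
    then have "\<bar>of_int i / real j\<bar> > c + \<bar>\<alpha>\<bar>" using j by (simp add: abs_divide field_simps)
    then have "\<bar>of_int i / real j - \<alpha>\<bar> > c" by linarith
    moreover have "\<bar>of_int i / real j - \<alpha>\<bar> \<le> real n * \<bar>of_int i / real j - \<alpha>\<bar>"
      using j by (simp add: mult_le_cancel_right1)
    ultimately show "\<bar>real n * (of_int i / real j - \<alpha>)\<bar> > c" by (simp add: abs_mult)
  qed
  have "(\<integral>x. f x \<partial>ewens_point_process \<alpha> n \<sigma>)
      = (\<Sum>p\<in>{1..n} \<times> {-K..K}. real (cycle_count n \<sigma> (fst p)) * f (real n * (of_int (snd p) / real (fst p) - \<alpha>)))"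
    unfolding ewens_point_process_def case_prod_unfold
  proof (rule integral_dirac_sum_finite[OF f_measurable])
    fix p :: "nat \<times> int" assume "p \<in> {1..n} \<times> UNIV" "p \<notin> {1..n} \<times> {-K..K}"
    then show "f (real n * (of_int (snd p) / real (fst p) - \<alpha>)) = 0"
      by (intro zero) (auto simp: mem_Times_iff)
  qed auto
  also have "\<dots> = (\<Sum>j=1..n. real (cycle_count n \<sigma> j) * (\<Sum>i\<in>{-K..K}. f (real n * (of_int i / real j - \<alpha>))))"
    by (simp only: sum_distrib_left sum.cartesian_product case_prod_unfold)
  also have "\<dots> = (\<Sum>j=1..n. real (cycle_count n \<sigma> j) * periodized f (- (real j * \<alpha>)) (real j / real n))"
  proof (intro sum.cong refl)
    fix j assume j: "j \<in> {1..n}"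
    have "periodized f (- (real j * \<alpha>)) (real j / real n) = (\<Sum>i\<in>{-K..K}. f ((- (real j * \<alpha>) + of_int i) / (real j / real n)))"
      using zero[OF j] by (intro periodized_eq_sum) (simp_all only: eq[OF j, symmetric] finite_atLeastAtMost_int)
    then show "real (cycle_count n \<sigma> j) * (\<Sum>i\<in>{-K..K}. f (real n * (of_int i / real j - \<alpha>)))
        = real (cycle_count n \<sigma> j) * periodized f (- (real j * \<alpha>)) (real j / real n)"
      by (simp only: eq[OF j])
  qed
  finally show ?thesis by (simp only: sum_cycle_count(1)[OF \<sigma>])
qed

lemma ewens_char:
  assumes "\<theta> > 0"
  shows "(\<integral>\<sigma>. iexp (t * (\<integral>x. f x \<partial>ewens_point_process \<alpha> n \<sigma>)) \<partial>ewens n \<theta>)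
    = (\<integral>\<sigma>. (\<Prod>b\<in>cycle_sets n \<sigma>. iexp (t * periodized f (- (real (card b) * \<alpha>)) (real (card b) / real n))) \<partial>ewens n \<theta>)"
proof (intro Bochner_Integration.integral_cong refl)
  fix \<sigma> assume "\<sigma> \<in> space (ewens n \<theta>)"
  then have \<sigma>: "\<sigma> permutes {1..n}" by (simp add: space_ewens)
  show "iexp (t * (\<integral>x. f x \<partial>ewens_point_process \<alpha> n \<sigma>))
      = (\<Prod>b\<in>cycle_sets n \<sigma>. iexp (t * periodized f (- (real (card b) * \<alpha>)) (real (card b) / real n)))"
    unfolding integral_ewens_point_process[OF \<sigma>]
    by (simp add: exp_sum finite_cycle_sets sum_distrib_left)
qed

lemma periodized_nonzero:
  assumes "periodized f u y \<noteq> 0" "0 < y" "y \<le> 2"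
  obtains q :: int where "\<bar>u + of_int q\<bar> \<le> c * y"
proof -
  have "periodized f u y = 0" if "\<And>q. f ((u + of_int q) / y) = 0"
    using that by (simp add: periodized_def)
  then obtain q where "f ((u + of_int q) / y) \<noteq> 0" using assms(1) by blast
  then have "\<bar>(u + of_int q) / y\<bar> \<le> c" using f_zero not_le by blast
  then have "\<bar>u + of_int q\<bar> \<le> c * y" using assms(2) by (simp add: abs_divide field_simps)
  then show thesis by (rule that)
qed

text \<open>The two products differ only in cycles of length j <= \<delta> n that contribute at all,
  which forces j \<alpha> to be within c j / n of an integer. Each such cycle costs at most 2, and
  the expected number of those of length j is at most 2 \<theta> / j because j <= n / 2; this is the
  factor 4 \<theta>. The sum of 1 / j over these j is bounded by
  \<open>sum_near_integer_multiples\<close>.\<close>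

lemma ewens_char_cut:
  fixes \<alpha> :: real
  assumes \<theta>: "\<theta> > 0" and d: "d > 0" and s: "0 < s" "s \<le> 1"
    and dioph: "\<And>(q::nat) (p::int). q > 0 \<Longrightarrow> \<bar>real q * \<alpha> - of_int p\<bar> \<ge> d * real q powr (- (1 / s))"
    and \<delta>: "0 < \<delta>" "\<delta> \<le> 1 / 2" and n: "n > 0"
  shows "norm ((\<integral>\<sigma>. iexp (t * (\<integral>x. f x \<partial>ewens_point_process \<alpha> n \<sigma>)) \<partial>ewens n \<theta>)
      - cycle_mean \<theta> (\<lambda>j. cut_kernel t \<delta> (- (real j * \<alpha>)) (real j / real n)) n)
    \<le> 4 * \<theta> / s * (2 * c / d) powr s * \<delta> powr s"
proof -
  let ?P = "\<lambda>j. periodized f (- (real j * \<alpha>)) (real j / real n)"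
  let ?g = "\<lambda>j. iexp (t * ?P j)" and ?g' = "\<lambda>j. cut_kernel t \<delta> (- (real j * \<alpha>)) (real j / real n)"
  define H where "H = {j. 0 < j \<and> real j \<le> \<delta> * n \<and> ?P j \<noteq> 0}"
  let ?h = "\<lambda>j. if j \<in> H then 2 else 0 :: real"
  have diff: "norm (?g j - ?g' j) \<le> ?h j" if "j \<in> {1..n}" for j
  proof (cases "j \<in> H")
    case True
    have "norm (?g j - ?g' j) \<le> norm (?g j) + norm (?g' j)" by (rule norm_triangle_ineq4)
    also have "\<dots> \<le> 1 + 1" by (intro add_mono) (simp_all add: cut_kernel_def)
    finally show ?thesis using True by simp
  next
    case False
    have "\<delta> < real j / n \<or> ?P j = 0" using False that n by (auto simp: H_def field_simps)
    moreover have "real j / n \<le> 2" using that n by (simp add: field_simps)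
    ultimately have "?g j = ?g' j" by (auto simp: cut_kernel_def)
    then show ?thesis using False by simp
  qed
  have "norm ((\<integral>\<sigma>. (\<Prod>b\<in>cycle_sets n \<sigma>. ?g (card b)) \<partial>ewens n \<theta>) - (\<integral>\<sigma>. (\<Prod>b\<in>cycle_sets n \<sigma>. ?g' (card b)) \<partial>ewens n \<theta>))
      = norm (\<integral>\<sigma>. (\<Prod>b\<in>cycle_sets n \<sigma>. ?g (card b)) - (\<Prod>b\<in>cycle_sets n \<sigma>. ?g' (card b)) \<partial>ewens n \<theta>)"
    by (simp add: Bochner_Integration.integral_diff[OF integrable_ewens[OF \<theta>] integrable_ewens[OF \<theta>]])
  also have "\<dots> \<le> (\<integral>\<sigma>. (\<Sum>b\<in>cycle_sets n \<sigma>. ?h (card b)) \<partial>ewens n \<theta>)"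
  proof (rule order_trans[OF integral_norm_bound Bochner_Integration.integral_mono])
    fix \<sigma> assume "\<sigma> \<in> space (ewens n \<theta>)"
    then have \<sigma>: "\<sigma> permutes {1..n}" by (simp add: space_ewens)
    have "norm ((\<Prod>b\<in>cycle_sets n \<sigma>. ?g (card b)) - (\<Prod>b\<in>cycle_sets n \<sigma>. ?g' (card b)))
        \<le> (\<Sum>b\<in>cycle_sets n \<sigma>. norm (?g (card b) - ?g' (card b)))"
      by (intro norm_prod_diff) (simp_all add: cut_kernel_def)
    also have "\<dots> \<le> (\<Sum>b\<in>cycle_sets n \<sigma>. ?h (card b))"
      by (intro sum_mono diff sum_cycle_count(2)[OF \<sigma>])
    finally show "norm ((\<Prod>b\<in>cycle_sets n \<sigma>. ?g (card b)) - (\<Prod>b\<in>cycle_sets n \<sigma>. ?g' (card b)))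
        \<le> (\<Sum>b\<in>cycle_sets n \<sigma>. ?h (card b))" .
  qed (rule integrable_ewens[OF \<theta>])+
  also have "\<dots> = (\<Sum>j=1..n. \<theta> * ?h j / j * (rising_coeff \<theta> (n - j) / rising_coeff \<theta> n))"
    by (rule ewens_cycle_sum[OF \<theta>])
  also have "\<dots> \<le> (\<Sum>j=1..n. if j \<in> H then 4 * \<theta> * (1 / j) else 0)"
  proof (rule sum_mono)
    fix j
    show "\<theta> * ?h j / j * (rising_coeff \<theta> (n - j) / rising_coeff \<theta> n) \<le> (if j \<in> H then 4 * \<theta> * (1 / j) else 0)"
    proof (cases "j \<in> H")
      case True
      then have "real j \<le> \<delta> * n" by (simp add: H_def)
      also have "\<dots> \<le> 1 / 2 * n" using \<delta> by (intro mult_right_mono) auto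
      finally have "2 * j \<le> n" by linarith
      then have "\<theta> * 2 / j * (rising_coeff \<theta> (n - j) / rising_coeff \<theta> n) \<le> \<theta> * 2 / j * 2"
        using \<theta> n by (intro mult_left_mono rising_coeff_ratio_le) auto
      then show ?thesis using True by simp
    qed simp
  qed
  also have "\<dots> = 4 * \<theta> * (\<Sum>j\<in>{1..n} \<inter> H. 1 / real j)"
    unfolding sum_distrib_left by (rule sum.inter_restrict[symmetric]) simp
  also have "{1..n} \<inter> H = H \<inter> {1..nat \<lfloor>\<delta> * n\<rfloor>}"
  proof -
    have "j \<le> n \<and> j \<le> nat \<lfloor>\<delta> * n\<rfloor>" if "j \<in> H" for j
    proof -
      have j: "real j \<le> \<delta> * n" using that by (simp add: H_def)
      also have "\<dots> \<le> 1 * real n" using \<delta> by (intro mult_right_mono) auto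
      finally have "j \<le> n" by simp
      moreover have "int j \<le> \<lfloor>\<delta> * n\<rfloor>" using j by (simp add: le_floor_iff)
      ultimately show ?thesis by linarith
    qed
    then show ?thesis by auto
  qed
  also have "(\<Sum>j\<in>H \<inter> {1..nat \<lfloor>\<delta> * n\<rfloor>}. 1 / real j)
      \<le> (2 * (c / n) / d) powr s / s * real (nat \<lfloor>\<delta> * n\<rfloor>) powr s"
  proof (rule sum_near_integer_multiples[OF d s _ dioph])
    show "0 < c / n" using c n by simp
    fix j assume "j \<in> H"
    then have j: "j > 0" "real j \<le> \<delta> * n" "?P j \<noteq> 0" by (auto simp: H_def)
    have "\<delta> * n \<le> 2 * real n" using \<delta> by (intro mult_right_mono) auto
    with j(2) have "real j \<le> 2 * real n" by (rule order_trans)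
    then have "real j / n \<le> 2" using n by (simp add: pos_divide_le_eq)
    then obtain q :: int where "\<bar>- (real j * \<alpha>) + of_int q\<bar> \<le> c * (real j / n)"
      using periodized_nonzero[OF j(3)] j(1) n by auto
    then have "\<bar>real j * \<alpha> - of_int q\<bar> \<le> c / n * j" by (simp add: abs_minus_commute)
    then show "j > 0 \<and> (\<exists>p::int. \<bar>real j * \<alpha> - of_int p\<bar> \<le> c / n * j)" using j(1) by blast
  qed simp
  also have "\<dots> \<le> (2 * (c / n) / d) powr s / s * (\<delta> * n) powr s"
    using s \<delta> by (intro mult_left_mono powr_mono2) auto
  \<comment> \<open>With \<epsilon> = c / n and about \<delta> n as upper limit the powers of n
    cancel, so the bound is uniform in n.\<close>
  also have "\<dots> = (2 * c / d) powr s / s * \<delta> powr s"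
  proof -
    have "(2 * (c / n) / d) powr s * (\<delta> * n) powr s = (2 * (c / n) / d * (\<delta> * n)) powr s"
      by (rule powr_mult[symmetric])
    also have "2 * (c / n) / d * (\<delta> * n) = 2 * c / d * \<delta>" using n by simp
    also have "(2 * c / d * \<delta>) powr s = (2 * c / d) powr s * \<delta> powr s" by (rule powr_mult)
    finally show ?thesis by (simp only: times_divide_eq_left)
  qed
  finally have "norm ((\<integral>\<sigma>. (\<Prod>b\<in>cycle_sets n \<sigma>. ?g (card b)) \<partial>ewens n \<theta>) - (\<integral>\<sigma>. (\<Prod>b\<in>cycle_sets n \<sigma>. ?g' (card b)) \<partial>ewens n \<theta>))
      \<le> 4 * \<theta> * ((2 * c / d) powr s / s * \<delta> powr s)"
    using \<theta> by (simp add: mult_left_mono)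
  moreover have "(\<integral>\<sigma>. (\<Prod>b\<in>cycle_sets n \<sigma>. ?g' (card b)) \<partial>ewens n \<theta>) = cycle_mean \<theta> ?g' n"
    unfolding cycle_mean_def by (rule ewens_cycle_prod[OF \<theta>])
  moreover have "4 * \<theta> * ((2 * c / d) powr s / s * \<delta> powr s) = 4 * \<theta> / s * (2 * c / d) powr s * \<delta> powr s"
    by simp
  ultimately show ?thesis by (simp only: ewens_char[OF \<theta>])
qed

end

section \<open>The limit process\<close>

locale marked_partition = prob_space M for M :: "'a measure" +
  fixes \<theta> :: real and L U :: "nat \<Rightarrow> 'a \<Rightarrow> real"
  assumes \<theta>: "\<theta> > 0"
    and L_vec: "(\<lambda>\<omega> i. L i \<omega>) \<in> M \<rightarrow>\<^sub>M (\<Pi>\<^sub>M i\<in>(UNIV :: nat set). borel)"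
    and L_law: "distr M (\<Pi>\<^sub>M i\<in>(UNIV :: nat set). borel) (\<lambda>\<omega> i. L i \<omega>) = poisson_dirichlet \<theta>"
    and U_law: "\<And>i. distr M borel (U i) = unit_uniform"
    and U_indep: "indep_vars (\<lambda>_. borel) U UNIV"
    and LU_indep: "indep_var
           (\<Pi>\<^sub>M i\<in>(UNIV :: nat set). borel) (\<lambda>\<omega> i. L i \<omega>)
           (\<Pi>\<^sub>M i\<in>(UNIV :: nat set). borel) (\<lambda>\<omega> i. U i \<omega>)"
begin

abbreviation "seq_borel \<equiv> \<Pi>\<^sub>M i\<in>(UNIV :: nat set). (borel :: real measure)"

lemma component_borel: "(\<lambda>v. v i) \<in> borel_measurable seq_borel"
  by (rule measurable_component_singleton) simp

lemma U_measurable [measurable]: "U i \<in> borel_measurable M"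
  using U_indep by (simp add: indep_vars_def)

lemma U_vec: "(\<lambda>\<omega> i. U i \<omega>) \<in> M \<rightarrow>\<^sub>M seq_borel"
  using LU_indep by (rule indep_var_rv2)

lemma L_measurable [measurable]: "L i \<in> borel_measurable M"
  using measurable_compose[OF L_vec measurable_component_singleton, of i] by simp

lemma AE_L: "AE \<omega> in M. mass_partition (\<lambda>i. L i \<omega>)"
  by (rule AE_distrD[OF L_vec, of mass_partition]) (unfold L_law, rule AE_poisson_dirichlet[OF \<theta>])

lemma AE_U: "AE \<omega> in M. \<forall>i. 0 \<le> U i \<omega> \<and> U i \<omega> \<le> 1"
  unfolding AE_all_countable
proof
  fix i
  have "AE u in unit_uniform. 0 \<le> u \<and> u \<le> 1" by (rule AE_uniform_measureI) auto
  then show "AE \<omega> in M. 0 \<le> U i \<omega> \<and> U i \<omega> \<le> 1"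
    by (intro AE_distrD[OF U_measurable, where P = "\<lambda>u. 0 \<le> u \<and> u \<le> 1"]) (simp only: U_law)
qed

lemma joint_law:
  "distr M seq_borel (\<lambda>\<omega> i. L i \<omega>) \<Otimes>\<^sub>M distr M seq_borel (\<lambda>\<omega> i. U i \<omega>)
    = distr M (seq_borel \<Otimes>\<^sub>M seq_borel) (\<lambda>\<omega>. (\<lambda>i. L i \<omega>, \<lambda>i. U i \<omega>))"
  using LU_indep unfolding indep_var_distribution_eq by blast

lemma pair_measurable: "(\<lambda>\<omega>. (\<lambda>i. L i \<omega>, \<lambda>i. U i \<omega>)) \<in> M \<rightarrow>\<^sub>M seq_borel \<Otimes>\<^sub>M seq_borel"
  by (rule measurable_Pair[OF L_vec U_vec])

text \<open>Given the lengths, the marks are independent and uniform: Fubini separates lengths from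
  marks, and then each mark is integrated out on its own.\<close>

lemma integral_prod_marks:
  fixes \<gamma> :: "real \<Rightarrow> real \<Rightarrow> complex"
  assumes \<gamma>: "(\<lambda>(u, y). \<gamma> u y) \<in> borel_measurable (borel \<Otimes>\<^sub>M borel)"
    and norm: "\<And>u y. norm (\<gamma> u y) \<le> 1"
  shows "(\<integral>\<omega>. (\<Prod>i<N. \<gamma> (U i \<omega>) (L i \<omega>)) \<partial>M)
    = (\<integral>l. (\<Prod>i<N. \<integral>u. \<gamma> u (l i) \<partial>unit_uniform) \<partial>poisson_dirichlet \<theta>)"
proof -
  let ?DL = "distr M seq_borel (\<lambda>\<omega> i. L i \<omega>)" and ?DU = "distr M seq_borel (\<lambda>\<omega> i. U i \<omega>)"
  interpret DL: prob_space ?DL by (rule prob_space_distr[OF L_vec])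
  interpret DU: prob_space ?DU by (rule prob_space_distr[OF U_vec])
  interpret pair: pair_prob_space ?DL ?DU ..
  let ?h = "\<lambda>p :: (nat \<Rightarrow> real) \<times> (nat \<Rightarrow> real). \<Prod>i<N. \<gamma> (snd p i) (fst p i)"
  have h: "?h \<in> borel_measurable (seq_borel \<Otimes>\<^sub>M seq_borel)"
  proof (rule borel_measurable_prod)
    fix i
    have "(\<lambda>p. (snd p i, fst p i)) \<in> seq_borel \<Otimes>\<^sub>M seq_borel \<rightarrow>\<^sub>M borel \<Otimes>\<^sub>M borel" by measurable
    from measurable_compose[OF this \<gamma>]
    show "(\<lambda>p. \<gamma> (snd p i) (fst p i)) \<in> borel_measurable (seq_borel \<Otimes>\<^sub>M seq_borel)" by simp
  qed
  have bound: "norm (\<Prod>i<N. \<gamma> (a i) (b i)) \<le> 1" for a b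
    unfolding prod_norm[symmetric] using norm by (intro prod_le_1) auto
  have "(\<integral>\<omega>. (\<Prod>i<N. \<gamma> (U i \<omega>) (L i \<omega>)) \<partial>M)
      = (\<integral>p. ?h p \<partial>distr M (seq_borel \<Otimes>\<^sub>M seq_borel) (\<lambda>\<omega>. (\<lambda>i. L i \<omega>, \<lambda>i. U i \<omega>)))"
    using integral_distr[OF pair_measurable h] by simp
  also have "\<dots> = (\<integral>p. ?h p \<partial>(?DL \<Otimes>\<^sub>M ?DU))" by (simp only: joint_law)
  also have "\<dots> = (\<integral>l. \<integral>u. ?h (l, u) \<partial>?DU \<partial>?DL)"
  proof (rule pair.integral_fst'[symmetric])
    have "?h \<in> borel_measurable (?DL \<Otimes>\<^sub>M ?DU)" unfolding joint_law using h by simp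
    then show "integrable (?DL \<Otimes>\<^sub>M ?DU) ?h"
      by (intro pair.P.integrable_const_bound[where B = 1] AE_I2 bound)
  qed
  also have "\<dots> = (\<integral>l. (\<Prod>i<N. \<integral>u. \<gamma> u (l i) \<partial>unit_uniform) \<partial>?DL)"
  proof (intro Bochner_Integration.integral_cong refl)
    fix l :: "nat \<Rightarrow> real"
    have \<gamma>_l: "(\<lambda>u. \<gamma> u (l i)) \<in> borel_measurable borel" for i
    proof -
      have "(\<lambda>u. (u, l i)) \<in> borel \<rightarrow>\<^sub>M borel \<Otimes>\<^sub>M borel" by measurable
      from measurable_compose[OF this \<gamma>] show ?thesis by simp
    qed
    have "(\<integral>u. ?h (l, u) \<partial>?DU) = (\<integral>\<omega>. (\<Prod>i<N. \<gamma> (U i \<omega>) (l i)) \<partial>M)"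
    proof -
      have "(\<lambda>u. \<Prod>i<N. \<gamma> (u i) (l i)) \<in> borel_measurable seq_borel"
      proof (rule borel_measurable_prod)
        fix i
        show "(\<lambda>u. \<gamma> (u i) (l i)) \<in> borel_measurable seq_borel"
          by (rule measurable_compose[OF component_borel \<gamma>_l])
      qed
      from integral_distr[OF U_vec this] show ?thesis by simp
    qed
    also have "\<dots> = (\<Prod>i<N. \<integral>\<omega>. \<gamma> (U i \<omega>) (l i) \<partial>M)"
    proof (rule indep_vars_lebesgue_integral)
      show "indep_vars (\<lambda>_. borel) (\<lambda>i \<omega>. \<gamma> (U i \<omega>) (l i)) {..<N}"
        by (rule indep_vars_compose2[OF indep_vars_subset[OF U_indep]]) (auto intro: \<gamma>_l)
      show "integrable M (\<lambda>\<omega>. \<gamma> (U i \<omega>) (l i))" for i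
        by (intro integrable_const_bound[where B = 1] AE_I2 norm measurable_compose[OF U_measurable \<gamma>_l])
    qed simp
    also have "\<dots> = (\<Prod>i<N. \<integral>u. \<gamma> u (l i) \<partial>unit_uniform)"
      using integral_distr[OF U_measurable \<gamma>_l] by (simp add: U_law)
    finally show "(\<integral>u. ?h (l, u) \<partial>?DU) = (\<Prod>i<N. \<integral>u. \<gamma> u (l i) \<partial>unit_uniform)" .
  qed
  finally show ?thesis by (simp only: L_law)
qed

lemma emeasure_unit_uniform_ends:
  assumes "r \<ge> 0"
  shows "emeasure unit_uniform {u. u \<le> r \<or> 1 - u \<le> r} \<le> ennreal (2 * r)"
proof -
  have "{u::real. u \<le> r \<or> 1 - u \<le> r} \<in> sets borel" by measurable
  then have "emeasure unit_uniform {u. u \<le> r \<or> 1 - u \<le> r} = emeasure lborel ({0..1} \<inter> {u. u \<le> r \<or> 1 - u \<le> r})"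
    by (simp add: divide_ennreal_def)
  also have "\<dots> \<le> emeasure lborel ({0..r} \<union> {1 - r..1})" by (intro emeasure_mono) auto
  also have "\<dots> \<le> emeasure lborel {0..r} + emeasure lborel {1 - r..1}" by (intro emeasure_subadditive) auto
  also have "\<dots> = ennreal (2 * r)" using assms by (simp flip: ennreal_plus)
  finally show ?thesis .
qed

text \<open>For a mark in [0, 1] the event says that it is within \<open>c * L i\<close> of an
  integer, and the nearest integer is 0 or 1. Given the lengths this has probability at most 2 c
  times the length.\<close>

lemma emeasure_mark_near_integer:
  assumes c: "c \<ge> 0"
  shows "emeasure M {\<omega>\<in>space M. U i \<omega> \<le> c * L i \<omega> \<or> 1 - U i \<omega> \<le> c * L i \<omega>} \<le> (\<integral>\<^sup>+\<omega>. ennreal (2 * c * L i \<omega>) \<partial>M)"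
proof -
  let ?DL = "distr M seq_borel (\<lambda>\<omega> i. L i \<omega>)" and ?DU = "distr M seq_borel (\<lambda>\<omega> i. U i \<omega>)"
  interpret DU: prob_space ?DU by (rule prob_space_distr[OF U_vec])
  let ?A = "{p \<in> space (seq_borel \<Otimes>\<^sub>M seq_borel). snd p i \<le> c * fst p i \<or> 1 - snd p i \<le> c * fst p i}"
  have comp: "(\<lambda>p. fst p i) \<in> borel_measurable (seq_borel \<Otimes>\<^sub>M seq_borel)"
    "(\<lambda>p. snd p i) \<in> borel_measurable (seq_borel \<Otimes>\<^sub>M seq_borel)" by measurable
  have A: "?A \<in> sets (seq_borel \<Otimes>\<^sub>M seq_borel)"
    by (intro sets.sets_Collect_disj borel_measurable_le borel_measurable_times borel_measurable_diff
        borel_measurable_const comp)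
  have "{\<omega>\<in>space M. U i \<omega> \<le> c * L i \<omega> \<or> 1 - U i \<omega> \<le> c * L i \<omega>}
      = (\<lambda>\<omega>. (\<lambda>i. L i \<omega>, \<lambda>i. U i \<omega>)) -` ?A \<inter> space M"
    using measurable_space[OF pair_measurable] by auto
  then have "emeasure M {\<omega>\<in>space M. U i \<omega> \<le> c * L i \<omega> \<or> 1 - U i \<omega> \<le> c * L i \<omega>} = emeasure (?DL \<Otimes>\<^sub>M ?DU) ?A"
    unfolding joint_law by (simp only: emeasure_distr[OF pair_measurable A])
  also have "\<dots> = (\<integral>\<^sup>+l. emeasure ?DU (Pair l -` ?A) \<partial>?DL)"
  proof (rule DU.emeasure_pair_measure_alt)
    show "?A \<in> sets (?DL \<Otimes>\<^sub>M ?DU)" unfolding joint_law using A by simp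
  qed
  also have "\<dots> \<le> (\<integral>\<^sup>+l. ennreal (2 * c * l i) \<partial>?DL)"
  proof (rule nn_integral_mono_AE)
    have "AE l in ?DL. mass_partition l" unfolding L_law by (rule AE_poisson_dirichlet[OF \<theta>])
    then show "AE l in ?DL. emeasure ?DU (Pair l -` ?A) \<le> ennreal (2 * c * l i)"
    proof eventually_elim
      case (elim l)
      let ?V = "{u. u \<le> c * l i \<or> 1 - u \<le> c * l i}"
      have V: "?V \<in> sets borel" by measurable
      have slice: "Pair l -` ?A = (\<lambda>u. u i) -` ?V \<inter> space seq_borel"
        by (auto simp: space_pair_measure space_PiM)
      have "emeasure ?DU (Pair l -` ?A) = emeasure M ((\<lambda>\<omega> i. U i \<omega>) -` ((\<lambda>u. u i) -` ?V \<inter> space seq_borel) \<inter> space M)"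
        unfolding slice
        by (rule emeasure_distr[OF U_vec measurable_sets[OF component_borel V]])
      also have "(\<lambda>\<omega> i. U i \<omega>) -` ((\<lambda>u. u i) -` ?V \<inter> space seq_borel) \<inter> space M = U i -` ?V \<inter> space M"
        by (auto simp: space_PiM)
      also have "emeasure M (U i -` ?V \<inter> space M) = emeasure unit_uniform ?V"
        unfolding U_law[of i, symmetric] by (rule emeasure_distr[OF U_measurable V, symmetric])
      also have "\<dots> \<le> ennreal (2 * (c * l i))"
        using elim c by (intro emeasure_unit_uniform_ends) (simp add: mass_partition_def less_imp_le)
      finally show ?case by (simp add: mult.assoc)
    qed
  qed
  also have "\<dots> = (\<integral>\<^sup>+\<omega>. ennreal (2 * c * L i \<omega>) \<partial>M)"
    by (rule nn_integral_distr[OF L_vec]) measurable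
  finally show ?thesis .
qed

text \<open>Borel-Cantelli: the probabilities sum to at most 2 c because the lengths sum to at most
  1. Therefore only finitely many i put points into [-c, c], which is the reason why the limit
  process is locally finite.\<close>

lemma AE_finite_near_integer:
  assumes c: "c \<ge> 0"
  shows "AE \<omega> in M. finite {i. \<exists>q::int. \<bar>U i \<omega> + of_int q\<bar> \<le> c * L i \<omega>}"
proof -
  let ?A = "\<lambda>i. {\<omega>\<in>space M. U i \<omega> \<le> c * L i \<omega> \<or> 1 - U i \<omega> \<le> c * L i \<omega>}"
  have sums: "(\<Sum>i<N. measure M (?A i)) \<le> 2 * c" for N
  proof -
    have "ennreal (\<Sum>i<N. measure M (?A i)) = (\<Sum>i<N. emeasure M (?A i))"
      by (simp add: emeasure_eq_measure sum_ennreal)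
    also have "\<dots> \<le> (\<Sum>i<N. \<integral>\<^sup>+\<omega>. ennreal (2 * c * L i \<omega>) \<partial>M)"
      by (intro sum_mono emeasure_mark_near_integer c)
    also have "\<dots> = (\<integral>\<^sup>+\<omega>. (\<Sum>i<N. ennreal (2 * c * L i \<omega>)) \<partial>M)"
      by (rule nn_integral_sum[symmetric]) measurable
    also have "\<dots> \<le> (\<integral>\<^sup>+\<omega>. ennreal (2 * c) \<partial>M)"
    proof (rule nn_integral_mono_AE)
      show "AE \<omega> in M. (\<Sum>i<N. ennreal (2 * c * L i \<omega>)) \<le> ennreal (2 * c)"
        using AE_L
      proof eventually_elim
        case (elim \<omega>)
        then have L: "L i \<omega> \<ge> 0" "(\<Sum>i<N. L i \<omega>) \<le> 1" for i
          by (auto simp: mass_partition_def less_imp_le)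
        have "(\<Sum>i<N. ennreal (2 * c * L i \<omega>)) = ennreal (2 * c * (\<Sum>i<N. L i \<omega>))"
          using L(1) c by (simp add: sum_ennreal sum_distrib_left)
        also have "\<dots> \<le> ennreal (2 * c)"
          using L(2) c by (intro ennreal_leI mult_left_le) auto
        finally show ?case .
      qed
    qed
    also have "\<dots> = ennreal (2 * c)" by (simp add: emeasure_space_1)
    finally show ?thesis using c by (simp add: sum_nonneg)
  qed
  have "AE \<omega> in M. \<forall>\<^sub>F i in sequentially. \<omega> \<in> space M - ?A i"
  proof (rule borel_cantelli_AE1)
    show "summable (\<lambda>i. measure M (?A i))" by (rule summableI_nonneg_bounded[OF _ sums]) simp
    show "emeasure M (?A i) < \<infinity>" for i by (simp add: emeasure_eq_measure)
  qed measurable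
  then show ?thesis
    using AE_U
  proof eventually_elim
    case (elim \<omega>)
    then obtain n where n: "\<And>i. i \<ge> n \<Longrightarrow> \<omega> \<in> space M - ?A i" unfolding eventually_sequentially by blast
    have "i < n" if near: "\<bar>U i \<omega> + of_int q\<bar> \<le> c * L i \<omega>" for i and q :: int
    proof (rule ccontr)
      assume "\<not> i < n"
      then have "\<omega> \<in> space M - ?A i" by (intro n) simp
      then have "\<not> (U i \<omega> \<le> c * L i \<omega> \<or> 1 - U i \<omega> \<le> c * L i \<omega>)" by blast
      moreover have "U i \<omega> \<le> \<bar>U i \<omega> + of_int q\<bar> \<or> 1 - U i \<omega> \<le> \<bar>U i \<omega> + of_int q\<bar>"
      proof (cases "q \<ge> 0")
        case True
        then have "real_of_int q \<ge> 0" by simp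
        then show ?thesis by linarith
      next
        case False
        then have "real_of_int q \<le> -1" by linarith
        then show ?thesis by linarith
      qed
      ultimately show False using near by linarith
    qed
    then have "{i. \<exists>q::int. \<bar>U i \<omega> + of_int q\<bar> \<le> c * L i \<omega>} \<subseteq> {..<n}" by blast
    then show ?case by (rule finite_subset) simp
  qed
qed

end

section \<open>Measurability and local finiteness of the limit process\<close>

context marked_partition
begin

lemma limit_points_measurable:
  "(\<lambda>\<omega>. (U i \<omega> + of_int q) / L i \<omega>) \<in> borel_measurable M"
  by measurable

text \<open>With a countable index set, joint measurability only asks for measurability of each
  point. It allows integrals against the random measure to be treated as integrals over pairs (i, q)
  with \<omega> as a parameter.\<close>

lemma limit_points_pair_measurable:
  fixes g :: "real \<Rightarrow> 'c::topological_space"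
  assumes "g \<in> borel_measurable borel"
  shows "(\<lambda>(\<omega>, i, q). g ((U i \<omega> + of_int q) / L i \<omega>))
    \<in> borel_measurable (M \<Otimes>\<^sub>M count_space (UNIV :: (nat \<times> int) set))"
proof -
  have "(\<lambda>((i, q), \<omega>). g ((U i \<omega> + of_int q) / L i \<omega>))
      \<in> borel_measurable (count_space (UNIV :: (nat \<times> int) set) \<Otimes>\<^sub>M M)"
    by (rule measurable_pair_measure_countable1)
       (auto intro: measurable_compose[OF limit_points_measurable assms])
  then show ?thesis by (subst measurable_pair_swap_iff) (simp add: case_prod_unfold)
qed

lemma limit_integral_eq:
  fixes f :: "real \<Rightarrow> real"
  assumes "f \<in> borel_measurable borel"
  shows "(\<integral>x. f x \<partial>limit_point_process L U \<omega>)
    = (\<integral>(i, q). f ((U i \<omega> + of_int q) / L i \<omega>) \<partial>count_space UNIV)"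
proof -
  have "(\<integral>x. f x \<partial>limit_point_process L U \<omega>)
      = (\<integral>p. f ((\<lambda>(i, q). (U i \<omega> + of_int q) / L i \<omega>) p) \<partial>point_measure (UNIV \<times> UNIV) (\<lambda>_. 1))"
    unfolding limit_point_process_def dirac_sum_def using assms
    by (intro integral_distr) (simp_all add: measurable_def sets_point_measure space_point_measure)
  then show ?thesis by (simp add: point_measure_def density_1 case_prod_unfold)
qed

lemma limit_integral_measurable:
  fixes f :: "real \<Rightarrow> real"
  assumes "f \<in> borel_measurable borel"
  shows "(\<lambda>\<omega>. \<integral>x. f x \<partial>limit_point_process L U \<omega>) \<in> borel_measurable M"
proof -
  interpret C: sigma_finite_measure "count_space (UNIV :: (nat \<times> int) set)"
    by (rule sigma_finite_measure_count_space_countable) simp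
  show ?thesis
    unfolding limit_integral_eq[OF assms] using limit_points_pair_measurable[OF assms]
    by (intro C.borel_measurable_lebesgue_integral) (simp add: case_prod_unfold)
qed

lemma limit_emeasure_measurable:
  assumes B: "B \<in> sets borel"
  shows "(\<lambda>\<omega>. emeasure (limit_point_process L U \<omega>) B) \<in> borel_measurable M"
proof -
  interpret C: sigma_finite_measure "count_space (UNIV :: (nat \<times> int) set)"
    by (rule sigma_finite_measure_count_space_countable) simp
  have "(\<lambda>(\<omega>, i, q). indicator B ((U i \<omega> + of_int q) / L i \<omega>) :: ennreal)
      \<in> borel_measurable (M \<Otimes>\<^sub>M count_space (UNIV :: (nat \<times> int) set))"
    by (rule limit_points_pair_measurable[OF borel_measurable_indicator[OF B]])
  then show ?thesis
    unfolding limit_point_process_def emeasure_dirac_sum[OF B] UNIV_Times_UNIV mult_1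
    by (intro C.borel_measurable_nn_integral) (simp add: case_prod_unfold)
qed

lemma finite_limit_points:
  assumes L: "mass_partition (\<lambda>i. L i \<omega>)"
    and fin: "finite {i. \<exists>q::int. \<bar>U i \<omega> + of_int q\<bar> \<le> c * L i \<omega>}"
  shows "finite {(i, q :: int). \<bar>U i \<omega> + of_int q\<bar> \<le> c * L i \<omega>}"
proof -
  let ?I = "{i. \<exists>q::int. \<bar>U i \<omega> + of_int q\<bar> \<le> c * L i \<omega>}"
  have "finite {q :: int. \<bar>U i \<omega> + of_int q\<bar> \<le> c * L i \<omega>}" for i
  proof (rule finite_subset)
    show "{q :: int. \<bar>U i \<omega> + of_int q\<bar> \<le> c * L i \<omega>} \<subseteq> {\<lfloor>- c * L i \<omega> - U i \<omega>\<rfloor>..\<lceil>c * L i \<omega> - U i \<omega>\<rceil>}"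
    proof
      fix q :: int assume "q \<in> {q :: int. \<bar>U i \<omega> + of_int q\<bar> \<le> c * L i \<omega>}"
      then have "of_int q \<le> c * L i \<omega> - U i \<omega>" "- c * L i \<omega> - U i \<omega> \<le> of_int q" by auto
      then show "q \<in> {\<lfloor>- c * L i \<omega> - U i \<omega>\<rfloor>..\<lceil>c * L i \<omega> - U i \<omega>\<rceil>}"
        unfolding atLeastAtMost_iff by linarith
    qed
  qed simp
  then have "finite (SIGMA i:?I. {q :: int. \<bar>U i \<omega> + of_int q\<bar> \<le> c * L i \<omega>})"
    using fin by (intro finite_SigmaI) auto
  moreover have "{(i, q :: int). \<bar>U i \<omega> + of_int q\<bar> \<le> c * L i \<omega>}
      \<subseteq> (SIGMA i:?I. {q :: int. \<bar>U i \<omega> + of_int q\<bar> \<le> c * L i \<omega>})" by auto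
  ultimately show ?thesis using finite_subset by blast
qed

lemma point_process_limit: "point_process M (limit_point_process L U)"
  unfolding point_process_def
proof (intro conjI ballI limit_emeasure_measurable)
  show "prob_space M" by (rule prob_space_axioms)
  \<comment> \<open>Restricting to integer radii gives one null set that serves all bounded sets
    \<open>B\<close>.\<close>
  have "AE \<omega> in M. \<forall>k::nat. finite {i. \<exists>q::int. \<bar>U i \<omega> + of_int q\<bar> \<le> real k * L i \<omega>}"
    unfolding AE_all_countable by (intro allI AE_finite_near_integer) simp
  then show "AE \<omega> in M. locally_finite_counting (limit_point_process L U \<omega>)"
    using AE_L
  proof eventually_elim
    case (elim \<omega>)
    show ?case unfolding locally_finite_counting_def
    proof (intro conjI ballI impI)
      show "sets (limit_point_process L U \<omega>) = sets borel"
        by (simp add: limit_point_process_def sets_dirac_sum)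
      fix B :: "real set" assume B: "B \<in> sets borel" "bounded B"
      obtain r where r: "\<And>x. x \<in> B \<Longrightarrow> \<bar>x\<bar> \<le> r" using B(2) unfolding bounded_iff real_norm_def by blast
      obtain k :: nat where k: "r \<le> real k" using real_arch_simple by blast
      let ?A = "{(i, q :: int). \<bar>U i \<omega> + of_int q\<bar> \<le> real k * L i \<omega>}"
      have A: "finite ?A" using elim by (intro finite_limit_points) auto
      have out: "(\<lambda>(i, q). (U i \<omega> + of_int q) / L i \<omega>) p \<notin> B" if "p \<notin> ?A" for p
      proof
        obtain i q where p: "p = (i, q)" by (cases p)
        assume "(\<lambda>(i, q). (U i \<omega> + of_int q) / L i \<omega>) p \<in> B"
        then have "\<bar>(U i \<omega> + of_int q) / L i \<omega>\<bar> \<le> real k" using r[of "(U i \<omega> + of_int q) / L i \<omega>"] k p by simp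
        moreover have "L i \<omega> > 0" using elim by (simp add: mass_partition_def)
        ultimately have "\<bar>U i \<omega> + of_int q\<bar> \<le> real k * L i \<omega>" by (simp add: abs_divide pos_divide_le_eq)
        then show False using that p by simp
      qed
      show "\<exists>m::nat. emeasure (limit_point_process L U \<omega>) B = of_nat m"
        using emeasure_dirac_sum_finite[OF B(1) A, of "UNIV \<times> UNIV" "\<lambda>(i, q). (U i \<omega> + of_int q) / L i \<omega>" "\<lambda>_. 1"] out
        unfolding limit_point_process_def by simp
    qed
  qed
qed

end

section \<open>Convergence of characteristic functions\<close>

locale limit_test = marked_partition + test_function
begin

lemma AE_limit_integral:
  "AE \<omega> in M. mass_partition (\<lambda>i. L i \<omega>) \<and> (\<exists>I. finite I
     \<and> (\<forall>i. i \<notin> I \<longrightarrow> periodized f (U i \<omega>) (L i \<omega>) = 0)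
     \<and> (\<integral>x. f x \<partial>limit_point_process L U \<omega>) = (\<Sum>i\<in>I. periodized f (U i \<omega>) (L i \<omega>)))"
  using AE_finite_near_integer[OF less_imp_le[OF c]] AE_L
proof eventually_elim
  case (elim \<omega>)
  let ?I = "{i. \<exists>q::int. \<bar>U i \<omega> + of_int q\<bar> \<le> c * L i \<omega>}"
  let ?A = "{(i, q :: int). \<bar>U i \<omega> + of_int q\<bar> \<le> c * L i \<omega>}"
  \<comment> \<open>All q that occur for some i: the rectangle \<open>?I \<times> K\<close> contains
    every contributing pair, and over it the double sum factors into periodized values.\<close>
  define K where "K = snd ` ?A"
  have A: "finite ?A" using elim by (intro finite_limit_points) auto
  then have K: "finite K" by (simp add: K_def)
  have pos: "L i \<omega> > 0" for i using elim by (simp add: mass_partition_def)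
  have f0: "f ((U i \<omega> + of_int q) / L i \<omega>) = 0" if "\<not> \<bar>U i \<omega> + of_int q\<bar> \<le> c * L i \<omega>" for i q
    using that pos[of i] by (intro f_zero) (simp add: abs_divide pos_less_divide_eq)
  have P: "periodized f (U i \<omega>) (L i \<omega>) = (\<Sum>q\<in>K. f ((U i \<omega> + of_int q) / L i \<omega>))" for i
    by (rule periodized_eq_sum[OF K], rule f0) (force simp: K_def)
  have "(\<integral>x. f x \<partial>limit_point_process L U \<omega>)
      = (\<Sum>p\<in>?I \<times> K. real 1 * f ((\<lambda>(i, q). (U i \<omega> + of_int q) / L i \<omega>) p))"
    using integral_dirac_sum_finite[of f "?I \<times> K" "UNIV \<times> UNIV" "\<lambda>(i, q). (U i \<omega> + of_int q) / L i \<omega>" "\<lambda>_. 1"]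
      elim(1) K f0 f_measurable unfolding limit_point_process_def by (force simp: K_def)
  also have "\<dots> = (\<Sum>i\<in>?I. \<Sum>q\<in>K. f ((U i \<omega> + of_int q) / L i \<omega>))"
    by (simp only: sum.cartesian_product case_prod_unfold of_nat_1 mult_1)
  also have "\<dots> = (\<Sum>i\<in>?I. periodized f (U i \<omega>) (L i \<omega>))" by (simp only: P)
  finally have int: "(\<integral>x. f x \<partial>limit_point_process L U \<omega>) = (\<Sum>i\<in>?I. periodized f (U i \<omega>) (L i \<omega>))" .
  have "periodized f (U i \<omega>) (L i \<omega>) = 0" if "i \<notin> ?I" for i
    unfolding P using f0 that by (intro sum.neutral) blast
  then show ?case using int elim by blast
qed

text \<open>Here \<open>A r\<close> is the characteristic function of the part of the limit sum
  carried by lengths above 1 / (r + 2). These cutoffs form a sequence, as dominated convergence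
  wants, and stay below or equal to 1 / 2, as \<open>ewens_char_cut\<close> wants.\<close>

lemma cut_expectation:
  fixes \<alpha> :: real
  assumes "\<alpha> \<notin> \<rat>"
  shows "\<exists>A. (\<forall>r::nat. (\<lambda>k. stick_mean \<theta> (rotation_kernel.\<phi> (cut_kernel t (1 / (real r + 2)))) k 1) \<longlonglongrightarrow> A r)
    \<and> A \<longlonglongrightarrow> (\<integral>\<omega>. iexp (t * (\<integral>x. f x \<partial>limit_point_process L U \<omega>)) \<partial>M)"
proof -
  define \<delta> where "\<delta> = (\<lambda>r::nat. 1 / (real r + 2))"
  have \<delta>: "\<delta> r > 0" "\<delta> r \<le> 1" for r by (auto simp: \<delta>_def)
  have \<delta>_lim: "\<delta> \<longlonglongrightarrow> 0" unfolding \<delta>_def by real_asymp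
  let ?\<gamma> = "\<lambda>r. cut_kernel t (\<delta> r)"
  let ?X = "\<lambda>r k \<omega>. \<Prod>i<k. ?\<gamma> r (U i \<omega>) (L i \<omega>)"
  let ?D = "\<lambda>r \<omega>. lim (\<lambda>k. ?X r k \<omega>)"
  let ?S = "\<lambda>\<omega>. \<integral>x. f x \<partial>limit_point_process L U \<omega>"
  interpret K: rotation_kernel \<theta> \<alpha> "\<delta> r" "?\<gamma> r" for r
    by (rule rotation_kernel_cut_kernel[OF \<theta> assms \<delta>(1)])
  have X_meas [measurable]: "?X r k \<in> borel_measurable M" for r k
  proof (rule borel_measurable_prod)
    fix i
    show "(\<lambda>\<omega>. ?\<gamma> r (U i \<omega>) (L i \<omega>)) \<in> borel_measurable M"
      using measurable_compose[OF measurable_Pair[OF U_measurable L_measurable] K.\<gamma>_measurable] by simp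
  qed
  have D_meas [measurable]: "?D r \<in> borel_measurable M" for r by measurable
  have X_norm: "norm (?X r k \<omega>) \<le> 1" for r k \<omega>
    unfolding prod_norm[symmetric] using K.norm_\<gamma> by (intro prod_le_1) auto
  have lims: "AE \<omega> in M. (\<forall>r. (\<lambda>k. ?X r k \<omega>) \<longlonglongrightarrow> ?D r \<omega>) \<and> (\<lambda>r. ?D r \<omega>) \<longlonglongrightarrow> iexp (t * ?S \<omega>)"
    using AE_limit_integral
  proof eventually_elim
    case (elim \<omega>)
    then obtain I where I: "finite I" "\<And>i. i \<notin> I \<Longrightarrow> periodized f (U i \<omega>) (L i \<omega>) = 0"
      "?S \<omega> = (\<Sum>i\<in>I. periodized f (U i \<omega>) (L i \<omega>))" and L: "mass_partition (\<lambda>i. L i \<omega>)" by blast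
    have L_pos: "L i \<omega> > 0" and L_le: "L i \<omega> \<le> 2" for i
    proof -
      show "L i \<omega> > 0" using L by (simp add: mass_partition_def)
      have "L i \<omega> \<le> (\<Sum>k<Suc i. L k \<omega>)"
        using L by (intro member_le_sum) (auto simp: mass_partition_def less_imp_le)
      also have "\<dots> \<le> 1" using L unfolding mass_partition_def by blast
      finally show "L i \<omega> \<le> 2" by simp
    qed
    have X_lim: "(\<lambda>k. ?X r k \<omega>) \<longlonglongrightarrow> (\<Prod>i\<in>I. ?\<gamma> r (U i \<omega>) (L i \<omega>))" for r
      using I by (intro prod_finite_support_tendsto) (auto simp: cut_kernel_def)
    then have D: "?D r \<omega> = (\<Prod>i\<in>I. ?\<gamma> r (U i \<omega>) (L i \<omega>))" for r by (rule limI)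
    \<comment> \<open>The index set \<open>I\<close> is finite and each length positive, so
      eventually no factor is cut.\<close>
    have "(\<lambda>r. \<Prod>i\<in>I. ?\<gamma> r (U i \<omega>) (L i \<omega>)) \<longlonglongrightarrow> (\<Prod>i\<in>I. iexp (t * periodized f (U i \<omega>) (L i \<omega>)))"
    proof (intro tendsto_prod tendsto_eventually)
      fix i
      have "\<forall>\<^sub>F r in sequentially. \<delta> r < L i \<omega>" by (rule order_tendstoD(2)[OF \<delta>_lim L_pos])
      then show "\<forall>\<^sub>F r in sequentially. ?\<gamma> r (U i \<omega>) (L i \<omega>) = iexp (t * periodized f (U i \<omega>) (L i \<omega>))"
        by eventually_elim (simp add: cut_kernel_def L_le)
    qed
    also have "(\<Prod>i\<in>I. iexp (t * periodized f (U i \<omega>) (L i \<omega>))) = iexp (t * ?S \<omega>)"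
      unfolding I(3) by (simp add: exp_sum I(1) sum_distrib_left)
    finally show ?case using X_lim by (simp only: D simp_thms)
  qed
  have X_D: "(\<lambda>k. \<integral>\<omega>. ?X r k \<omega> \<partial>M) \<longlonglongrightarrow> (\<integral>\<omega>. ?D r \<omega> \<partial>M)" for r
  proof (rule integral_dominated_convergence[where w = "\<lambda>_. 1"])
    show "AE \<omega> in M. (\<lambda>k. ?X r k \<omega>) \<longlonglongrightarrow> ?D r \<omega>" using lims by eventually_elim blast
  qed (use X_norm in simp_all)
  have D_norm: "AE \<omega> in M. norm (?D r \<omega>) \<le> 1" for r
    using lims
  proof eventually_elim
    case (elim \<omega>)
    have "(\<lambda>k. norm (?X r k \<omega>)) \<longlonglongrightarrow> norm (?D r \<omega>)" using elim by (intro tendsto_norm) blast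
    then show ?case by (rule LIMSEQ_le_const2) (use X_norm in blast)
  qed
  have D_S: "(\<lambda>r. \<integral>\<omega>. ?D r \<omega> \<partial>M) \<longlonglongrightarrow> (\<integral>\<omega>. iexp (t * ?S \<omega>) \<partial>M)"
  proof (rule integral_dominated_convergence[where w = "\<lambda>_. 1"])
    show "AE \<omega> in M. (\<lambda>r. ?D r \<omega>) \<longlonglongrightarrow> iexp (t * ?S \<omega>)" using lims by eventually_elim blast
    have [measurable]: "?S \<in> borel_measurable M" by (rule limit_integral_measurable[OF f_measurable])
    show "(\<lambda>\<omega>. iexp (t * ?S \<omega>)) \<in> borel_measurable M" by measurable
  qed (use D_norm in simp_all)
  have "(\<lambda>k. stick_mean \<theta> (K.\<phi> r) k 1) \<longlonglongrightarrow> (\<integral>\<omega>. ?D r \<omega> \<partial>M)" for r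
  proof -
    interpret uniform: prob_space unit_uniform by (rule prob_space_unit_uniform)
    have "K.\<phi> r y = 1" if "y \<le> \<delta> r" for y
      using that by (simp add: K.\<phi>_def cut_kernel_def uniform.prob_space)
    then obtain A where A: "(\<lambda>k. stick_mean \<theta> (K.\<phi> r) k 1) \<longlonglongrightarrow> A"
      "(\<lambda>k. \<integral>l. (\<Prod>i<k. K.\<phi> r (l i)) \<partial>poisson_dirichlet \<theta>) \<longlonglongrightarrow> A"
      using stick_mean_tendsto[OF \<theta> K.\<phi>_measurable K.norm_\<phi> \<delta>(1)] by blast
    \<comment> \<open>Integrating out the marks leaves \<phi>, the same function that averaging
      along runs produces for permutations. This is where the two sides meet.\<close>
    have "(\<integral>\<omega>. ?X r k \<omega> \<partial>M) = (\<integral>l. (\<Prod>i<k. K.\<phi> r (l i)) \<partial>poisson_dirichlet \<theta>)" for k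
      unfolding K.\<phi>_def by (rule integral_prod_marks[OF K.\<gamma>_measurable K.norm_\<gamma>])
    then have "A = (\<integral>\<omega>. ?D r \<omega> \<partial>M)" using LIMSEQ_unique[OF A(2)] X_D[of r] by simp
    then show ?thesis using A(1) by simp
  qed
  then show ?thesis using D_S unfolding \<delta>_def by (intro exI[of _ "\<lambda>r. \<integral>\<omega>. ?D r \<omega> \<partial>M"]) (auto simp: \<delta>_def)
qed

text \<open>Five errors of e / 5: ignoring short cycles, stopping after k cycles, n to infinity for
  fixed k, k to infinity for the sticks, and the cutoff in the limit. The cutoff index r is chosen
  first, then k, then n; this order works because the first two bounds are uniform in n.\<close>

lemma ewens_char_tendsto:
  fixes \<alpha> :: real
  assumes irr: "\<alpha> \<notin> \<rat>" and fin: "irrationality_measure \<alpha> < \<infinity>"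
  shows "(\<lambda>n. \<integral>\<sigma>. iexp (t * (\<integral>x. f x \<partial>ewens_point_process \<alpha> n \<sigma>)) \<partial>ewens n \<theta>)
    \<longlonglongrightarrow> (\<integral>\<omega>. iexp (t * (\<integral>x. f x \<partial>limit_point_process L U \<omega>)) \<partial>M)"
proof (rule LIMSEQ_I)
  fix e :: real assume e: "e > 0"
  let ?E = "\<integral>\<omega>. iexp (t * (\<integral>x. f x \<partial>limit_point_process L U \<omega>)) \<partial>M"
  let ?C = "\<lambda>n. \<integral>\<sigma>. iexp (t * (\<integral>x. f x \<partial>ewens_point_process \<alpha> n \<sigma>)) \<partial>ewens n \<theta>"
  obtain d s where ds: "d > 0" "0 < s" "s \<le> 1"
    "\<And>(q::nat) (p::int). q > 0 \<Longrightarrow> \<bar>real q * \<alpha> - of_int p\<bar> \<ge> d * real q powr (- (1 / s))"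
    by (rule finite_irrationality_measure[OF irr fin]) blast
  let ?K = "4 * \<theta> / s * (2 * c / d) powr s"
  obtain A where A: "\<And>r::nat. (\<lambda>k. stick_mean \<theta> (rotation_kernel.\<phi> (cut_kernel t (1 / (real r + 2)))) k 1) \<longlonglongrightarrow> A r"
    "A \<longlonglongrightarrow> ?E"
    using cut_expectation[OF irr, of t] by blast
  have "(\<lambda>r::nat. (1 / (real r + 2)) powr s) \<longlonglongrightarrow> 0" using ds(2) by real_asymp
  from tendsto_mult_left[OF this, of ?K] have "(\<lambda>r::nat. ?K * (1 / (real r + 2)) powr s) \<longlonglongrightarrow> 0" by simp
  then have "\<forall>\<^sub>F r::nat in sequentially. ?K * (1 / (real r + 2)) powr s < e / 5"
    using e by (intro order_tendstoD(2)) auto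
  moreover have "\<forall>\<^sub>F r in sequentially. norm (A r - ?E) < e / 5"
    unfolding dist_norm[symmetric] using e by (intro tendstoD[OF A(2)]) simp
  ultimately have "\<forall>\<^sub>F r::nat in sequentially. ?K * (1 / (real r + 2)) powr s < e / 5 \<and> norm (A r - ?E) < e / 5"
    by (rule eventually_conj)
  then obtain r :: nat where r: "?K * (1 / (real r + 2)) powr s < e / 5" "norm (A r - ?E) < e / 5"
    using eventually_happens'[OF sequentially_bot] by blast
  define \<delta> where "\<delta> = 1 / (real r + 2)"
  have \<delta>: "0 < \<delta>" "\<delta> \<le> 1 / 2" by (auto simp: \<delta>_def field_simps)
  interpret K: rotation_kernel \<theta> \<alpha> \<delta> "cut_kernel t \<delta>"
    by (rule rotation_kernel_cut_kernel[OF \<theta> irr \<delta>(1)])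
  have "(\<lambda>k. (\<theta> / (\<theta> + 1)) ^ k) \<longlonglongrightarrow> 0" using \<theta> by (intro LIMSEQ_power_zero) auto
  from tendsto_mult_left[OF this, of "2 / \<delta>"] have "(\<lambda>k. 2 / \<delta> * (\<theta> / (\<theta> + 1)) ^ k) \<longlonglongrightarrow> 0" by simp
  then have "\<forall>\<^sub>F k in sequentially. 2 / \<delta> * (\<theta> / (\<theta> + 1)) ^ k < e / 5"
    using e by (intro order_tendstoD(2)) auto
  moreover have "\<forall>\<^sub>F k in sequentially. norm (stick_mean \<theta> K.\<phi> k 1 - A r) < e / 5"
    unfolding dist_norm[symmetric] \<delta>_def using e by (intro tendstoD[OF A(1)]) simp
  ultimately have "\<forall>\<^sub>F k in sequentially. 2 / \<delta> * (\<theta> / (\<theta> + 1)) ^ k < e / 5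
      \<and> norm (stick_mean \<theta> K.\<phi> k 1 - A r) < e / 5"
    by (rule eventually_conj)
  then obtain k where k: "2 / \<delta> * (\<theta> / (\<theta> + 1)) ^ k < e / 5" "norm (stick_mean \<theta> K.\<phi> k 1 - A r) < e / 5"
    using eventually_happens'[OF sequentially_bot] by blast
  have "(\<lambda>n. real n / real n) \<longlonglongrightarrow> 1"
    by (rule tendsto_eventually) (use eventually_gt_at_top[of 0] in eventually_elim, simp)
  then have "(\<lambda>n. truncated_cycle_mean \<theta> (K.g n) k n) \<longlonglongrightarrow> stick_mean \<theta> K.\<phi> k 1"
    by (intro K.truncated_cycle_mean_tendsto) auto
  then have "\<forall>\<^sub>F n in sequentially. norm (truncated_cycle_mean \<theta> (K.g n) k n - stick_mean \<theta> K.\<phi> k 1) < e / 5"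
    unfolding dist_norm[symmetric] using e by (intro tendstoD) simp_all
  then have "\<forall>\<^sub>F n in sequentially. norm (?C n - ?E) < e"
    using eventually_gt_at_top[of 0]
  proof eventually_elim
    case (elim n)
    have "norm (?C n - cycle_mean \<theta> (K.g n) n) \<le> ?K * \<delta> powr s"
      using ewens_char_cut[OF \<theta> ds(1,2,3) ds(4) \<delta> elim(2)] by (simp add: K.g_def[abs_def])
    then have 1: "norm (?C n - cycle_mean \<theta> (K.g n) n) < e / 5" using r(1) by (simp add: \<delta>_def)
    have "K.g n j = 1" if "real j \<le> \<delta> * n" for j
      using that elim(2) by (simp add: K.g_def cut_kernel_def pos_less_divide_eq)
    \<comment> \<open>\<open>cycle_mean_truncation\<close> with D = \<delta> n: all cycles up to
      this length have factor 1, and n cancels against m = n.\<close>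
    then have "norm (cycle_mean \<theta> (K.g n) n - truncated_cycle_mean \<theta> (K.g n) k n)
        \<le> 2 / (\<delta> * n) * (\<theta> / (\<theta> + 1)) ^ k * n"
      using \<delta>(1) elim(2) by (intro cycle_mean_truncation \<theta> K.norm_g) auto
    also have "\<dots> = 2 / \<delta> * (\<theta> / (\<theta> + 1)) ^ k" using elim(2) by simp
    finally have 2: "norm (cycle_mean \<theta> (K.g n) n - truncated_cycle_mean \<theta> (K.g n) k n) < e / 5"
      using k(1) by simp
    have "?C n - ?E = (?C n - cycle_mean \<theta> (K.g n) n)
        + ((cycle_mean \<theta> (K.g n) n - truncated_cycle_mean \<theta> (K.g n) k n)
        + ((truncated_cycle_mean \<theta> (K.g n) k n - stick_mean \<theta> K.\<phi> k 1)
        + ((stick_mean \<theta> K.\<phi> k 1 - A r) + (A r - ?E))))" by simp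
    also have "norm \<dots> < e / 5 + (e / 5 + (e / 5 + (e / 5 + e / 5)))"
      by (intro norm_add_less 1 2 elim(1) k(2) r(2))
    finally show ?case by simp
  qed
  then show "\<exists>n0. \<forall>n\<ge>n0. norm (?C n - ?E) < e" by (simp add: eventually_sequentially)
qed

end

theorem theorem1p1:
  fixes \<theta> \<alpha> :: real
    and M :: "'a measure"
    and L U :: "nat \<Rightarrow> 'a \<Rightarrow> real"
  assumes "\<theta> > 0"
    and "prob_space M"
    and "(\<lambda>\<omega> i. L i \<omega>) \<in> M \<rightarrow>\<^sub>M (\<Pi>\<^sub>M i\<in>(UNIV :: nat set). borel)"
    and "distr M (\<Pi>\<^sub>M i\<in>(UNIV :: nat set). borel) (\<lambda>\<omega> i. L i \<omega>) = poisson_dirichlet \<theta>"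
    and "\<And>i. distr M borel (U i) = uniform_measure lborel {0..1}"
    and "prob_space.indep_vars M (\<lambda>_. borel) U UNIV"
    and "prob_space.indep_var M
           (\<Pi>\<^sub>M i\<in>(UNIV :: nat set). borel) (\<lambda>\<omega> i. L i \<omega>)
           (\<Pi>\<^sub>M i\<in>(UNIV :: nat set). borel) (\<lambda>\<omega> i. U i \<omega>)"
    and "0 < \<alpha>" and "\<alpha> < 1"
    and "\<alpha> \<notin> \<rat>"
    and "irrationality_measure \<alpha> < \<infinity>"
  shows "point_processes_converge
           (\<lambda>n. ewens n \<theta>) (\<lambda>n. ewens_point_process \<alpha> n)
           M (limit_point_process L U)"
proof -
  interpret marked_partition M \<theta> L U
    using assms by (intro marked_partition.intro marked_partition_axioms.intro)
  show ?thesis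
    unfolding point_processes_converge_def
  proof (intro conjI allI impI point_process_ewens point_process_limit \<theta>)
    fix f :: "real \<Rightarrow> real"
    assume cont: "continuous_on UNIV f" and supp: "compact (closure {x. f x \<noteq> 0})"
    have "bounded {x. f x \<noteq> 0}"
      by (rule bounded_subset[OF compact_imp_bounded[OF supp] closure_subset])
    then obtain b where b: "\<And>x. f x \<noteq> 0 \<Longrightarrow> \<bar>x\<bar> \<le> b"
      unfolding bounded_iff real_norm_def by blast
    \<comment> \<open>The maximum makes \<open>c\<close> positive even if \<open>f\<close> vanishes
      identically, when \<open>b\<close> is arbitrary.\<close>
    define c where "c = max b 1"
    interpret limit_test M \<theta> L U f c
    proof
      show "c > 0" by (simp add: c_def)
      show "f x = 0" if "\<bar>x\<bar> > c" for x
      proof (rule ccontr)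
        assume "f x \<noteq> 0"
        then have "\<bar>x\<bar> \<le> b" by (rule b)
        then show False using that by (simp add: c_def)
      qed
    qed (rule cont)
    let ?X = "\<lambda>n \<sigma>. \<integral>x. f x \<partial>ewens_point_process \<alpha> n \<sigma>"
    let ?Y = "\<lambda>\<omega>. \<integral>x. f x \<partial>limit_point_process L U \<omega>"
    have Y: "?Y \<in> borel_measurable M" by (rule limit_integral_measurable[OF f_measurable])
    show "weak_conv_m (\<lambda>n. distr (ewens n \<theta>) borel (?X n)) (distr M borel ?Y)"
    proof (rule levy_continuity)
      show "real_distribution (distr (ewens n \<theta>) borel (?X n))" for n
        by (rule prob_space.real_distribution_distr[OF prob_space_ewens[OF \<theta>] measurable_ewens])
      show "real_distribution (distr M borel ?Y)" using Y by (rule real_distribution_distr)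
      have "char (distr (ewens n \<theta>) borel (?X n)) t = (\<integral>\<sigma>. iexp (t * ?X n \<sigma>) \<partial>ewens n \<theta>)" for n t
        unfolding char_def by (rule integral_distr[OF measurable_ewens]) measurable
      moreover have "char (distr M borel ?Y) t = (\<integral>\<omega>. iexp (t * ?Y \<omega>) \<partial>M)" for t
        unfolding char_def by (rule integral_distr[OF Y]) measurable
      ultimately show "(\<lambda>n. char (distr (ewens n \<theta>) borel (?X n)) t) \<longlonglongrightarrow> char (distr M borel ?Y) t" for t
        using ewens_char_tendsto[OF assms(10,11), of t] by (simp only:)
    qed
  qed
qed

end
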